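(* Let $G$ be a connected simple graph with $n$ vertices, let $P$ be a set of $m$ pebbles with vacancy size $k = n-m \ge 1$, let $f$ be a configuration and let $p, q \in P$ be distinct. Then $p$ can contact $q$ starting from $f$ if and only if one of the following holds: (1) $R(p,f) = R(q,f)$ and $G[R(p,f)]$ is not a cycle; (2) $R(p,f) = R(q,f)$, $G[R(p,f)]$ is a cycle, and $q$ is next to $p$ along this cycle in $f$ (i.e. on one of the two arcs of the cycle between $f(p)$ and $f(q)$ no other pebble is placed); (3) $R(p,f) \ne R(q,f)$ and $R(p,f) \cap R(q,f)$ is the vertex set of a $k$-isthmus of $G$.
   Context: A configuration of the pebble set $P$ on $G$ is an injective map $f: P \to V(G)$; vertices not in $f(P)$ are unoccupied. A move transfers one pebble to an adjacent unoccupied vertex. Two configurations $f,g$ are equivalent ($f \sim g$) if $f$ can be transformed into $g$ by a finite sequence of moves. The reachable range of $p$ from $f$ is $R(p,f) = \{ g(p) : g \sim f\}$. Pebble $p$ contacts pebble $q$ starting from $f$ if there is a configuration $g \sim f$ with $g(p)$ and $g(q)$ adjacent in $G$. For a graph $H$ and a positive integer $k$, a path $I = v_1 \cdots v_k$ in $H$ on $k$ vertices is a $k$-isthmus of $H$ if $V(H)\setminus V(I)$ can be partitioned into two nonempty sets $X$, $Y$ such that every path in $H$ from $X$ to $Y$ passes through a vertex of $I$. $G[S]$ denotes the induced subgraph on $S$.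
   Formalization: In (2), "no other pebble is placed" on an arc counts only pebbles r with R(r,f) = R(p,f). Counting all pebbles is false: 4-cycle v,a,b,c with pendant w at v, k=1, pebbles r,p,s,q at v,a,b,c; p contacts q after r moves to w, yet both arcs carry a pebble. *)

theory Defs
  imports "Graph_Theory.Digraph_Component" "Graph_Theory.Vertex_Walk"
begin

(* A finite simple graph is a symmetric, loop-free digraph without parallel arcs, that is, the
   locale predicate graph; vertices u and v are adjacent iff u dominates v.

   Configurations are total functions of which only the values on P matter.  Moves leave the
   values outside P unchanged, so they have no influence on equivalence. *)

definition configuration :: "('a, 'b) pre_digraph \<Rightarrow> 'p set \<Rightarrow> ('p \<Rightarrow> 'a) \<Rightarrow> bool" where
  "configuration G P f \<longleftrightarrow> inj_on f P \<and> f ` P \<subseteq> verts G"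

definition pebble_move ::
  "('a, 'b) pre_digraph \<Rightarrow> 'p set \<Rightarrow> ('p \<Rightarrow> 'a) \<Rightarrow> ('p \<Rightarrow> 'a) \<Rightarrow> bool" where
  "pebble_move G P f g \<longleftrightarrow> configuration G P f \<and>
     (\<exists>p\<in>P. \<exists>v. f p \<rightarrow>\<^bsub>G\<^esub> v \<and> v \<notin> f ` P \<and> g = f(p := v))"

definition pebble_equiv ::
  "('a, 'b) pre_digraph \<Rightarrow> 'p set \<Rightarrow> ('p \<Rightarrow> 'a) \<Rightarrow> ('p \<Rightarrow> 'a) \<Rightarrow> bool" where
  "pebble_equiv G P = (pebble_move G P)\<^sup>*\<^sup>*"

definition reachable_range ::
  "('a, 'b) pre_digraph \<Rightarrow> 'p set \<Rightarrow> 'p \<Rightarrow> ('p \<Rightarrow> 'a) \<Rightarrow> 'a set" where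
  "reachable_range G P p f = {g p | g. pebble_equiv G P g f}"

definition contacts ::
  "('a, 'b) pre_digraph \<Rightarrow> 'p set \<Rightarrow> ('p \<Rightarrow> 'a) \<Rightarrow> 'p \<Rightarrow> 'p \<Rightarrow> bool" where
  "contacts G P f p q \<longleftrightarrow> (\<exists>g. pebble_equiv G P g f \<and> g p \<rightarrow>\<^bsub>G\<^esub> g q)"

definition isthmus :: "('a, 'b) pre_digraph \<Rightarrow> nat \<Rightarrow> 'a list \<Rightarrow> bool" where
  "isthmus H k vs \<longleftrightarrow> vpath vs H \<and> length vs = k \<and>
     (\<exists>X Y. X \<noteq> {} \<and> Y \<noteq> {} \<and> X \<inter> Y = {} \<and> X \<union> Y = verts H - set vs \<and>
        (\<forall>w. vpath w H \<and> hd w \<in> X \<and> last w \<in> Y \<longrightarrow> set w \<inter> set vs \<noteq> {}))"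

(* The graph as a whole is a cycle (of length at least 3).  The library's predicate cycle is
   about closed arc walks, and in a symmetric digraph it also accepts a walk along one edge and
   back. *)
definition is_cycle :: "('a, 'b) pre_digraph \<Rightarrow> bool" where
  "is_cycle H \<longleftrightarrow> (\<exists>vs. length vs \<ge> 3 \<and> distinct vs \<and> set vs = verts H \<and>
     arcs_ends H = set (vwalk_arcs (vs @ [hd vs])) \<union> (set (vwalk_arcs (vs @ [hd vs])))\<inverse>)"

(* Meant for the case that C = G \<restriction> reachable_range G P p f is a cycle containing f p and
   f q; the two arcs of C between f p and f q are then exactly the two paths of C from f p to f q.

   The other pebbles that count are those belonging to the cycle, that is, with the same range
   as p.  This matters only if the vacancy size is 1: then a pebble from outside may stand in f on
   a cut vertex of G on the cycle, but it leaves the cycle before any pebble of the cycle moves.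
   Example: G is the 4-cycle v a b c with a pendant vertex w at v; the pebbles r, p, s, q are at
   v, a, b, c.  Each of p, s, q has range {v, a, b, c} and r has range {v, w}.  Moving r to w and
   then p to v brings p next to q, although in f both arcs between p and q carry a pebble. *)
definition next_along_cycle ::
  "('a, 'b) pre_digraph \<Rightarrow> 'p set \<Rightarrow> ('p \<Rightarrow> 'a) \<Rightarrow> 'p \<Rightarrow> 'p \<Rightarrow> bool" where
  "next_along_cycle G P f p q \<longleftrightarrow>
     (\<exists>w. vpath w (G \<restriction> reachable_range G P p f) \<and> hd w = f p \<and> last w = f q \<and>
        (\<forall>r\<in>P - {p, q}. reachable_range G P r f = reachable_range G P p f \<longrightarrow> f r \<notin> set w))"

end

theory Submission
  imports Defs
begin

text \<open>Let \<open>k\<close> be the number of holes.  Suppose that \<open>p\<close> can reach \<open>x\<close> but not its neighbour \<open>y\<close>.  Moving \<open>p\<close> back from \<open>x\<close>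
lets one hole at a time pass to the side of \<open>y\<close>, and \<open>p\<close> cannot be prevented from reaching \<open>y\<close> unless its retreat leads through
\<open>k\<close> vertices without side branches.  Hence every boundary edge of a range comes from a \<open>k\<close>-isthmus.  Each
such isthmus divides the pebbles into two sides, and this division and the order of the pebbles on the isthmus are invariant.
So pebbles with different ranges are separated by an isthmus that contains the
intersection of the ranges; they can be brought together exactly if both can traverse it.

For pebbles with equal range, consider a configuration with \<open>p\<close> and \<open>q\<close> at the least possible distance, and suppose that they are not
adjacent.  No hole can reach the shortest paths between them.  As no isthmus separates \<open>p\<close> from \<open>q\<close>, there is a hole on a detour from \<open>p\<close> to
\<open>q\<close>; by means of it both pebbles can be rotated along a cycle without changing their distance.  Any further neighbour of a vertex visited by
\<open>p\<close> would allow \<open>p\<close> or a hole to leave the cycle and the distance to drop.  So the range is a cycle, and there the cyclic order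
of the pebbles with this range is invariant.\<close>

section \<open>Connected sets and restricted motion\<close>

text \<open>The number \<open>k\<close> enters by counting. When the holes are exactly the
  \<open>k\<close> vertices of the isthmus, both sides are full; a pebble leaving the isthmus on the
  wrong side would need a vacancy in a region that its own pebbles fill completely.

  Branches along the isthmus of the statement could let pebbles pass each other. The boundary
  argument therefore produces a path without branches, and the two notions are matched at the end by
  comparing cardinalities with the intersection of the ranges.

  The elementary motions control at most one pebble and otherwise only the occupied set, because a
  hole can then be sent along any walk. They are confined to a set \<open>S\<close> so that
  \<open>p\<close> or \<open>q\<close> can be held fixed, and so that the boundary argument can be
  repeated in the graph without the position of \<open>p\<close>.

  The number of holes matters once more for side branches of the cycle. With two holes,
  \<open>p\<close> can turn aside into a branch and come back closer to \<open>q\<close>. With a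
  single hole a branch may really exist; then its vertex of attachment is an isthmus, and the branch
  is excluded from the range instead.\<close>

inductive con :: "('a \<Rightarrow> 'a \<Rightarrow> bool) \<Rightarrow> 'a set \<Rightarrow> 'a \<Rightarrow> 'a \<Rightarrow> bool" for adj S where
  con_refl: "a \<in> S \<Longrightarrow> con adj S a a"
| con_step: "con adj S a b \<Longrightarrow> adj b c \<Longrightarrow> c \<in> S \<Longrightarrow> con adj S a c"

locale pebbling =
  fixes V :: "'a set" and adj :: "'a \<Rightarrow> 'a \<Rightarrow> bool" and P :: "'p set"
  assumes finite_V: "finite V" and finite_P: "finite P"
    and adj_V: "adj a b \<Longrightarrow> b \<in> V"
    and adj_sym: "adj a b \<Longrightarrow> adj b a"
    and adj_irrefl: "\<not> adj a a"
begin

section \<open>Connectivity inside a vertex set\<close>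

abbreviation "cn \<equiv> con adj"

lemma con_in: "cn S a b \<Longrightarrow> a \<in> S \<and> b \<in> S"
  by (induction rule: con.induct) auto

lemma con_trans: "cn S b c \<Longrightarrow> cn S a b \<Longrightarrow> cn S a c"
  by (induction rule: con.induct) (auto intro: con_step)

lemma con_edge: "a \<in> S \<Longrightarrow> b \<in> S \<Longrightarrow> adj a b \<Longrightarrow> cn S a b"
  by (meson con_refl con_step)

lemma con_sym: "cn S a b \<Longrightarrow> cn S b a"
proof (induction rule: con.induct)
  case (con_step a b c)
  then show ?case by (meson adj_sym con_edge con_in con_trans)
qed (rule con_refl)

lemma con_mono: "cn S a b \<Longrightarrow> S \<subseteq> T \<Longrightarrow> cn T a b"
  by (induction rule: con.induct) (auto intro: con.intros)

definition component where "component S a = {b. cn S a b}"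
definition conn where "conn S \<longleftrightarrow> (\<forall>a\<in>S. \<forall>b\<in>S. cn S a b)"

lemma component_subset: "component S a \<subseteq> S" using con_in component_def by fastforce

lemma con_comp: "cn S a b \<Longrightarrow> cn (component S a) a b"
  by (induction rule: con.induct) (auto intro: con.intros simp: component_def)

lemma conn_comp: "conn (component S a)"
  unfolding conn_def
proof (intro ballI)
  fix b c assume "b \<in> component S a" "c \<in> component S a"
  then have "cn (component S a) a b" "cn (component S a) a c" using con_comp component_def by auto
  then show "cn (component S a) b c" using con_sym con_trans by blast
qed

lemma con_closed: "cn S a b \<Longrightarrow> a \<in> U \<Longrightarrow> (\<And>b c. b \<in> U \<Longrightarrow> adj b c \<Longrightarrow> c \<in> S \<Longrightarrow> c \<in> U) \<Longrightarrow> b \<in> U"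
  by (induction rule: con.induct) auto

text \<open>A walk that leaves \<open>U\<close> can do so only through the gate \<open>t\<close>, and it re-enters there.\<close>
lemma con_gate:
  assumes "cn S v a" "v \<in> U" "\<And>b c. b \<in> U \<Longrightarrow> c \<in> S - U \<Longrightarrow> adj b c \<Longrightarrow> b = t"
  shows "if a \<in> U then cn U v a else cn U v t"
  using assms
proof (induction rule: con.induct)
  case (con_step a b c)
  have "\<And>b c. b \<in> U \<Longrightarrow> c \<in> S - U \<Longrightarrow> adj b c \<Longrightarrow> b = t" using con_step.prems by blast
  then have *: "b \<in> U \<Longrightarrow> c \<notin> U \<Longrightarrow> b = t" "b \<notin> U \<Longrightarrow> c \<in> U \<Longrightarrow> c = t"
    using con_step.hyps adj_sym con_in by blast+
  have "if b \<in> U then cn U a b else cn U a t" using con_step by simp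
  then show ?case using * con_step.hyps con.con_step[of adj U a b c]
    by (cases "b \<in> U"; cases "c \<in> U") auto
qed (auto intro: con_refl)

text \<open>Look at the last visit of the walk to \<open>{a, b}\<close>: what follows it avoids the
  other of the two vertices.\<close>

lemma con_split:
  assumes "cn U a c" "a \<noteq> b" "b \<in> U"
  shows "cn (U - {b}) a c \<or> cn (U - {a}) b c"
  using assms
proof (induction rule: con.induct)
  case (con_step a b' c)
  consider "c = a" | "c = b" | "c \<noteq> a" "c \<noteq> b" by blast
  then show ?case
  proof cases
    case 3
    then show ?thesis using con_step con.con_step[of adj "U - {b}" a b' c] con.con_step[of adj "U - {a}" b b' c] by auto
  qed (use con_step con_in[of U a b'] in \<open>auto intro: con_refl\<close>)
qed (auto intro: con_refl)

text \<open>Stop the walk at its first entry into \<open>B\<close>: \<open>b\<close> is the entry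
  and \<open>t\<close> the vertex before it.\<close>

lemma con_hit:
  assumes "cn U a c" "a \<notin> B"
  shows "cn (U - B) a c \<or> (\<exists>t b. cn (U - B) a t \<and> b \<in> B \<and> b \<in> U \<and> adj t b)"
  using assms
proof (induction rule: con.induct)
  case (con_step a b c)
  consider "cn (U - B) a b" "c \<notin> B" | "cn (U - B) a b" "c \<in> B"
    | "\<exists>t b. cn (U - B) a t \<and> b \<in> B \<and> b \<in> U \<and> adj t b" using con_step by blast
  then show ?case
  proof cases
    case 1
    then show ?thesis using con_step con.con_step[of adj "U - B" a b c] by auto
  qed (use con_step in auto)
qed (auto intro: con_refl)

lemma con_path:
  assumes "successively adj (a # ws)" "set (a # ws) \<subseteq> S" "b \<in> set (a # ws)"
  shows "cn S a b"
  using assms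
proof (induction ws arbitrary: a)
  case (Cons w ws)
  show ?case
  proof (cases "b = a")
    case False
    then have "cn S w b" using Cons by auto
    moreover have "cn S a w" using Cons.prems by (intro con_edge) auto
    ultimately show ?thesis using con_trans by blast
  qed (use Cons in \<open>auto intro: con_refl\<close>)
qed (auto intro: con_refl)

lemma con_path2:
  assumes "successively adj ws" "set ws \<subseteq> S" "a \<in> set ws" "b \<in> set ws"
  shows "cn S a b"
proof (cases ws)
  case (Cons w ws')
  have "cn S w a" "cn S w b" using con_path[of w ws' S] assms Cons by auto
  then show ?thesis using con_sym con_trans by blast
qed (use assms in auto)

section \<open>Configurations, restricted moves and the transport of holes\<close>

definition cfg where "cfg f \<longleftrightarrow> inj_on f P \<and> f ` P \<subseteq> V"

text \<open>Pebbles outside \<open>S\<close> do not move, so that motion in induced subgraphs needs no graph of its own.\<close>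
definition step where
  "step S f g \<longleftrightarrow> (\<exists>r\<in>P. \<exists>b\<in>S. f r \<in> S \<and> adj (f r) b \<and> b \<notin> f ` P \<and> g = f(r := b))"

definition eqv where "eqv S = (step S)\<^sup>*\<^sup>*"
definition Rng where "Rng S p f = {g p | g. eqv S f g}"

lemma eqv_refl: "eqv S f f" by (simp add: eqv_def)
lemma eqv_trans: "eqv S f g \<Longrightarrow> eqv S g h \<Longrightarrow> eqv S f h" by (simp add: eqv_def)
lemma eqv_step: "eqv S f g \<Longrightarrow> step S g h \<Longrightarrow> eqv S f h" unfolding eqv_def by (rule rtranclp.intros(2))
lemma eqv_move: "r \<in> P \<Longrightarrow> f r \<in> S \<Longrightarrow> b \<in> S \<Longrightarrow> adj (f r) b \<Longrightarrow> b \<notin> f ` P \<Longrightarrow> eqv S f (f(r := b))"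
  unfolding eqv_def step_def by (blast intro: r_into_rtranclp)

lemma eqv_induct [consumes 1, case_names refl step]:
  assumes "eqv S f g" "Q f" "\<And>g h. eqv S f g \<Longrightarrow> step S g h \<Longrightarrow> Q g \<Longrightarrow> Q h"
  shows "Q g"
  using assms(1) unfolding eqv_def
  by (induction rule: rtranclp_induct) (use assms in \<open>auto simp: eqv_def\<close>)

lemma eqv_mono: "eqv S f g \<Longrightarrow> S \<subseteq> T \<Longrightarrow> eqv T f g"
proof (induction rule: eqv_induct)
  case (step g h)
  then have "step T g h" unfolding step_def by blast
  then show ?case using step eqv_step by blast
qed (rule eqv_refl)

lemma image_upd: "inj_on f P \<Longrightarrow> r \<in> P \<Longrightarrow> (f(r := b)) ` P = insert b (f ` P - {f r})"
  by (auto simp: inj_on_def image_iff)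

lemma step_cfg: "cfg f \<Longrightarrow> step S f g \<Longrightarrow> cfg g"
proof -
  assume f: "cfg f" "step S f g"
  then obtain r b where rb: "r \<in> P" "adj (f r) b" "b \<notin> f ` P" "g = f(r := b)"
    unfolding step_def by blast
  have "inj_on g P" unfolding rb(4) by (rule inj_on_fun_updI) (use f rb in \<open>auto simp: cfg_def\<close>)
  moreover have "g ` P \<subseteq> V" using f rb adj_V unfolding cfg_def by auto
  ultimately show ?thesis unfolding cfg_def by blast
qed

lemma eqv_cfg: "eqv S f g \<Longrightarrow> cfg f \<Longrightarrow> cfg g"
  by (induction rule: eqv_induct) (auto intro: step_cfg)

lemma step_sym: "cfg f \<Longrightarrow> step S f g \<Longrightarrow> step S g f"
proof -
  assume f: "cfg f" "step S f g"
  then obtain r b where rb: "r \<in> P" "b \<in> S" "f r \<in> S" "adj (f r) b" "b \<notin> f ` P" "g = f(r := b)"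
    unfolding step_def by blast
  have "f r \<notin> g ` P" using f rb image_upd[of f r b] unfolding cfg_def by auto
  then show ?thesis unfolding step_def using rb adj_sym by (intro bexI[of _ r] bexI[of _ "f r"]) auto
qed

lemma eqv_sym: "eqv S f g \<Longrightarrow> cfg f \<Longrightarrow> eqv S g f"
proof (induction rule: eqv_induct)
  case (step g h)
  then have "step S h g" using eqv_cfg step_sym by blast
  then show ?case using step unfolding eqv_def by (simp add: converse_rtranclp_into_rtranclp)
qed (rule eqv_refl)

lemma eqv_out: "eqv S f g \<Longrightarrow> f r \<notin> S \<Longrightarrow> g r = f r"
  by (induction rule: eqv_induct) (auto simp: step_def)

lemma eqv_in: "eqv S f g \<Longrightarrow> f r \<in> S \<Longrightarrow> g r \<in> S"
  by (induction rule: eqv_induct) (auto simp: step_def)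

lemma card_occ: "cfg f \<Longrightarrow> card (S \<inter> f ` P) = card {r\<in>P. f r \<in> S}"
proof -
  assume "cfg f"
  then have "inj_on f {r\<in>P. f r \<in> S}" unfolding cfg_def inj_on_def by auto
  moreover have "S \<inter> f ` P = f ` {r\<in>P. f r \<in> S}" by auto
  ultimately show ?thesis by (simp add: card_image)
qed

lemma card_holes:
  assumes "finite S" "cfg f" shows "card (S - f ` P) = card S - card {r\<in>P. f r \<in> S}"
  by (metis assms card_Diff_subset_Int card_occ finite_Int)

lemma eqv_card:
  assumes "eqv S f g" "cfg f" "finite S"
  shows "card (S - g ` P) = card (S - f ` P)"
proof -
  have "f r \<in> S \<longleftrightarrow> g r \<in> S" for r using eqv_in eqv_out assms(1) by metis
  then have "{r\<in>P. f r \<in> S} = {r\<in>P. g r \<in> S}" by blast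
  then show ?thesis using card_holes[OF assms(3,2)] card_holes[OF assms(3) eqv_cfg[OF assms(1,2)]] by simp
qed

lemma Rng_self: "f p \<in> Rng S p f" unfolding Rng_def using eqv_refl by blast
lemma RngI: "eqv S f g \<Longrightarrow> g p \<in> Rng S p f" unfolding Rng_def by blast
lemma RngE: "a \<in> Rng S p f \<Longrightarrow> (\<And>g. eqv S f g \<Longrightarrow> g p = a \<Longrightarrow> thesis) \<Longrightarrow> thesis" unfolding Rng_def by blast

lemma Rng_eqv: "cfg f \<Longrightarrow> eqv S f g \<Longrightarrow> Rng S p g = Rng S p f"
proof -
  assume "cfg f" "eqv S f g"
  then have "eqv S g h \<longleftrightarrow> eqv S f h" for h using eqv_sym eqv_trans by blast
  then show ?thesis unfolding Rng_def by simp
qed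

lemma Rng_sub: "f p \<in> S \<Longrightarrow> Rng S p f \<subseteq> S" unfolding Rng_def using eqv_in by blast

text \<open>Pebbles shift along the walk one after another. Which pebble ends where is not recorded;
  for the occupied set it is as if one pebble had jumped from \<open>y\<close> to
  \<open>h\<close>.\<close>

lemma swap_hole:
  assumes "cn S h y" "cfg f" "h \<notin> f ` P" "y \<in> f ` P"
  shows "\<exists>g. eqv S f g \<and> g ` P = insert h (f ` P - {y})"
  using assms
proof (induction arbitrary: f rule: con.induct)
  case (con_step h b y)
  have yS: "y \<in> S" "b \<in> S" "b \<noteq> y" using con_step con_in adj_irrefl by auto
  show ?case
  proof (cases "b \<in> f ` P")
    case False
    \<comment> \<open>A hole at \<open>b\<close> is used first; exchanging \<open>h\<close> for
      \<open>b\<close> afterwards restores it.\<close>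
    obtain r where r: "r \<in> P" "f r = y" using con_step by blast
    define f1 where "f1 = f(r := b)"
    have e1: "eqv S f f1" unfolding f1_def using eqv_move[of r f S b] r yS con_step.hyps adj_sym False by auto
    have i1: "f1 ` P = insert b (f ` P - {y})" using image_upd con_step.prems r unfolding f1_def cfg_def by metis
    show ?thesis
    proof (cases "b = h")
      case False
      obtain g where "eqv S f1 g" "g ` P = insert h (f1 ` P - {b})"
        using con_step.IH[of f1] i1 False con_step.prems e1 eqv_cfg by auto
      moreover then have "eqv S f g" using e1 eqv_trans by blast
      ultimately show ?thesis using i1 \<open>b \<notin> f ` P\<close> by (intro exI[of _ g]) auto
    qed (use e1 i1 in auto)
  next
    case True
    then obtain g where g: "eqv S f g" "g ` P = insert h (f ` P - {b})"
      using con_step by blast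
    have cg: "cfg g" using g eqv_cfg con_step by blast
    have "y \<noteq> h" using con_step by blast
    have "y \<in> g ` P" using g con_step yS by auto
    then obtain r where r: "r \<in> P" "g r = y" by blast
    have "b \<notin> g ` P" using g con_step True by auto
    then have "eqv S g (g(r := b))" using eqv_move[of r g S b] r yS con_step.hyps adj_sym by auto
    then have "eqv S f (g(r := b))" using g eqv_trans by blast
    moreover have "(g(r := b)) ` P = insert b (g ` P - {y})" using image_upd[of g r b] cg r unfolding cfg_def by auto
    moreover have "insert b (g ` P - {y}) = insert h (f ` P - {y})" using g True yS \<open>y \<noteq> h\<close> by auto
    ultimately show ?thesis by metis
  qed
qed auto

text \<open>By counting, an occupied target leaves some hole outside \<open>Hs\<close>; exchanging
  the two lowers the number of occupied targets.\<close>

lemma clear: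
  assumes "conn S" "finite S" "cfg f" "Hs \<subseteq> S" "card Hs \<le> card (S - f ` P)"
  shows "\<exists>g. eqv S f g \<and> Hs \<inter> g ` P = {}"
  using assms(3,5)
proof (induction "card (Hs \<inter> f ` P)" arbitrary: f rule: less_induct)
  case less
  have finH: "finite Hs" using assms finite_subset by blast
  show ?case
  proof (cases "Hs \<inter> f ` P = {}")
    case True then show ?thesis using eqv_refl by blast
  next
    case False
    then obtain y where y: "y \<in> Hs" "y \<in> f ` P" by blast
    have "\<not> S - f ` P \<subseteq> Hs - {y}"
    proof
      assume "S - f ` P \<subseteq> Hs - {y}"
      then have "card (S - f ` P) \<le> card (Hs - {y})" using finH card_mono by blast
      also have "\<dots> < card Hs" using y finH by (intro psubset_card_mono) auto
      finally show False using less by simp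
    qed
    then obtain h where h: "h \<in> S" "h \<notin> f ` P" "h \<notin> Hs" using y by blast
    have "cn S h y" using assms h y unfolding conn_def by blast
    then obtain g where g: "eqv S f g" "g ` P = insert h (f ` P - {y})"
      using swap_hole less h y by blast
    have "Hs \<inter> g ` P = Hs \<inter> f ` P - {y}" using g h y by auto
    then have "card (Hs \<inter> g ` P) < card (Hs \<inter> f ` P)" using y finH by (metis Int_iff card_Diff1_less finite_Int)
    moreover have "card Hs \<le> card (S - g ` P)" using eqv_card[OF g(1) less.prems(1) assms(2)] less.prems(2) by simp
    ultimately have "\<exists>g'. eqv S g g' \<and> Hs \<inter> g' ` P = {}" by (intro less.hyps[OF _ eqv_cfg[OF g(1) less.prems(1)]])
    then show ?thesis using eqv_trans[OF g(1)] by blast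
  qed
qed

lemma walk:
  assumes "cfg f" "p \<in> P" "successively adj (f p # ws)" "distinct ws" "set ws \<inter> f ` P = {}"
    "set ws \<subseteq> S" "f p \<in> S"
  shows "eqv S f (f(p := last (f p # ws)))"
  using assms
proof (induction ws arbitrary: f)
  case (Cons w ws)
  define f1 where "f1 = f(p := w)"
  have e: "eqv S f f1" unfolding f1_def using eqv_move[of p f S w] Cons by auto
  have i: "f1 ` P = insert w (f ` P - {f p})" using image_upd Cons.prems unfolding f1_def cfg_def by metis
  have "eqv S f1 (f1(p := last (f1 p # ws)))"
  proof (rule Cons.IH)
    show "cfg f1" using e eqv_cfg Cons by blast
    show "set ws \<inter> f1 ` P = {}" using i Cons.prems by auto
  qed (use Cons.prems f1_def in auto)
  moreover have "f1(p := last (f1 p # ws)) = f(p := last (f p # w # ws))" by (simp add: f1_def)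
  ultimately show ?case using eqv_trans[OF e] by metis
qed (auto simp: eqv_refl)

text \<open>The pebble \<open>p\<close> stays outside \<open>C\<close> while the path in
  \<open>C\<close> is emptied, and then walks. The path behind it is empty afterwards, which later
  motions exploit.\<close>

lemma push:
  assumes "cfg f" "p \<in> P" "conn C" "C \<subseteq> V" "f p \<notin> C" "successively adj (f p # ws)" "distinct ws"
    "set ws \<subseteq> C" "length ws \<le> card (C - f ` P)"
  shows "\<exists>g. eqv (insert (f p) C) f g \<and> g p = last (f p # ws) \<and> set (butlast (f p # ws)) \<inter> g ` P = {}"
proof -
  have finC: "finite C" using assms finite_V finite_subset by blast
  obtain f1 where f1: "eqv C f f1" "set ws \<inter> f1 ` P = {}"
    using clear[of C f "set ws"] assms finC by (auto simp: distinct_card)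
  have p1: "f1 p = f p" using f1 eqv_out assms by blast
  define g where "g = f1(p := last (f p # ws))"
  have c1: "cfg f1" using f1 eqv_cfg assms by blast
  have e: "eqv (insert (f p) C) f1 g"
    unfolding g_def using walk[of f1 p ws "insert (f p) C"] assms f1 p1 c1 subset_insertI2[of "set ws" C "f p"] by auto
  have i: "g ` P = insert (last (f p # ws)) (f1 ` P - {f p})"
    unfolding g_def using image_upd[of f1 p] c1 assms p1 unfolding cfg_def by auto
  have "distinct (f p # ws)" using assms by auto
  then have "distinct (butlast (f p # ws) @ [last (f p # ws)])"
    by (simp only: append_butlast_last_id list.distinct not_False_eq_True)
  then have "last (f p # ws) \<notin> set (butlast (f p # ws))" by (simp only: distinct_append) simp
  moreover have "set (butlast (f p # ws)) \<subseteq> insert (f p) (set ws)"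
    by (metis in_set_butlastD list.set(2) subsetI)
  ultimately have "set (butlast (f p # ws)) \<inter> g ` P = {}" unfolding i using f1 by blast
  moreover have "g p = last (f p # ws)" by (simp add: g_def)
  moreover have "eqv (insert (f p) C) f g" using eqv_mono[OF f1(1) subset_insertI] e eqv_trans by blast
  ultimately show ?thesis by blast
qed


lemma eqv_image: "eqv S f g \<Longrightarrow> v \<notin> S \<Longrightarrow> v \<in> g ` P \<longleftrightarrow> v \<in> f ` P"
proof (induction rule: eqv_induct)
  case (step g h)
  then obtain r b where "r \<in> P" "b \<in> S" "g r \<in> S" "h = g(r := b)" unfolding step_def by blast
  then have "v \<in> h ` P \<longleftrightarrow> v \<in> g ` P" using \<open>v \<notin> S\<close> by (auto simp: image_iff)
  then show ?case using step by blast
qed simp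

lemma conn_in_comp: "conn A \<Longrightarrow> t \<in> A \<Longrightarrow> A \<subseteq> U \<Longrightarrow> A \<subseteq> component U t"
  using con_mono[of A t _ U] unfolding component_def conn_def by blast

lemma con_nbr: "cn S h x \<Longrightarrow> h \<noteq> x \<Longrightarrow> \<exists>t. cn (S - {x}) h t \<and> adj t x"
  using con_hit[of S h x "{x}"] con_in by blast

lemma con_avoid: "cn U h t \<Longrightarrow> \<not> cn U h z \<Longrightarrow> cn (U - {z}) h t"
  using con_mono[OF con_comp, of U h t "U - {z}"] component_subset[of U h] by (auto simp: component_def)

text \<open>The hole is brought to \<open>y\<close> without passing \<open>p\<close>. If
  \<open>y\<close> is empty already, nothing is transported; hence the two alternatives for the
  consumed hole \<open>h'\<close>.\<close>

lemma advance:
  assumes "cfg g" "p \<in> P" "g p \<in> S" "cn (S - {g p}) h y" "h \<notin> g ` P" "adj (g p) y"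
  shows "\<exists>g' h'. (h' = h \<or> h' = y) \<and> h' \<notin> g ` P \<and> eqv S g g' \<and> g' p = y \<and> g' ` P = insert h' (g ` P) - {g p}"
proof -
  have yS: "y \<in> S" "y \<noteq> g p" using assms(4) con_in by auto
  obtain g1 h' where g1: "h' = h \<or> h' = y" "h' \<notin> g ` P" "eqv (S - {g p}) g g1" "g1 ` P = insert h' (g ` P) - {y}"
    "h' = y \<or> y \<in> g ` P"
  proof (cases "y \<in> g ` P")
    case True
    then obtain g1 where "eqv (S - {g p}) g g1" "g1 ` P = insert h (g ` P - {y})"
      using swap_hole[OF assms(4,1,5)] by blast
    then show ?thesis using that[of h g1] assms(5) True by auto
  next
    case False
    then show ?thesis using that[of y g] eqv_refl by auto
  qed
  have p1: "g1 p = g p" using eqv_out[OF g1(3)] by blast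
  have c1: "cfg g1" using eqv_cfg[OF g1(3) assms(1)] .
  have e: "eqv S g1 (g1(p := y))" by (rule eqv_move) (use assms p1 yS g1 in auto)
  have "(g1(p := y)) ` P = insert y (g1 ` P - {g p})" using image_upd[of g1 p y] c1 p1 assms(2) unfolding cfg_def by auto
  also have "\<dots> = insert h' (g ` P) - {g p} \<union> {y}" using g1(4) yS by auto
  also have "insert h' (g ` P) - {g p} \<union> {y} = insert h' (g ` P) - {g p}" using yS g1(5) by auto
  finally show ?thesis using eqv_trans[OF eqv_mono[OF g1(3)] e] g1(1,2)
    by (intro exI[of _ "g1(p := y)"] exI[of _ h']) auto
qed

section \<open>The boundary of a reachable range\<close>

text \<open>An isthmus through which no pebble can turn round: \<open>u\<close> is an induced path whose inner vertices have no
neighbours off \<open>u\<close>.  This is stronger than \<open>isthmus\<close> of the statement, which allows branches along the path.\<close>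
definition bare_isthmus where
  "bare_isthmus S X u Y \<longleftrightarrow> u \<noteq> [] \<and> distinct u \<and> successively adj u \<and> X \<union> set u \<union> Y = S \<and>
     X \<inter> set u = {} \<and> Y \<inter> set u = {} \<and> X \<inter> Y = {} \<and> X \<noteq> {} \<and> Y \<noteq> {} \<and>
     (\<forall>a\<in>X. \<forall>b\<in>Y. \<not> adj a b) \<and>
     (\<forall>a\<in>X. \<forall>v\<in>set u. adj a v \<longrightarrow> v = hd u) \<and> (\<forall>b\<in>Y. \<forall>v\<in>set u. adj b v \<longrightarrow> v = last u) \<and>
     (\<forall>i j. i < j \<longrightarrow> j < length u \<longrightarrow> adj (u ! i) (u ! j) \<longrightarrow> j = Suc i)"

section \<open>Elementary properties of bare isthmuses\<close>

lemma bare_isthmusD: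
  assumes "bare_isthmus S X u Y"
  shows "u \<noteq> []" "distinct u" "successively adj u" "X \<union> set u \<union> Y = S"
    "X \<inter> set u = {}" "Y \<inter> set u = {}" "X \<inter> Y = {}" "X \<noteq> {}" "Y \<noteq> {}"
  using assms unfolding bare_isthmus_def by blast+

lemma bare_isthmus_edges:
  assumes "bare_isthmus S X u Y"
  shows "a \<in> X \<Longrightarrow> b \<in> Y \<Longrightarrow> \<not> adj a b" "a \<in> X \<Longrightarrow> b \<in> Y \<Longrightarrow> \<not> adj b a"
    "a \<in> X \<Longrightarrow> v \<in> set u \<Longrightarrow> adj a v \<Longrightarrow> v = hd u" "a \<in> X \<Longrightarrow> v \<in> set u \<Longrightarrow> adj v a \<Longrightarrow> v = hd u"
    "b \<in> Y \<Longrightarrow> v \<in> set u \<Longrightarrow> adj b v \<Longrightarrow> v = last u" "b \<in> Y \<Longrightarrow> v \<in> set u \<Longrightarrow> adj v b \<Longrightarrow> v = last u"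
    "i < j \<Longrightarrow> j < length u \<Longrightarrow> adj (u ! i) (u ! j) \<Longrightarrow> j = Suc i"
proof -
  have 1: "\<And>a b. a \<in> X \<Longrightarrow> b \<in> Y \<Longrightarrow> \<not> adj a b" "\<And>a v. a \<in> X \<Longrightarrow> v \<in> set u \<Longrightarrow> adj a v \<Longrightarrow> v = hd u"
    "\<And>b v. b \<in> Y \<Longrightarrow> v \<in> set u \<Longrightarrow> adj b v \<Longrightarrow> v = last u"
    "\<And>i j. i < j \<Longrightarrow> j < length u \<Longrightarrow> adj (u ! i) (u ! j) \<Longrightarrow> j = Suc i"
    using assms unfolding bare_isthmus_def by simp_all
  show "a \<in> X \<Longrightarrow> b \<in> Y \<Longrightarrow> \<not> adj a b" "a \<in> X \<Longrightarrow> b \<in> Y \<Longrightarrow> \<not> adj b a"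
    "a \<in> X \<Longrightarrow> v \<in> set u \<Longrightarrow> adj a v \<Longrightarrow> v = hd u" "a \<in> X \<Longrightarrow> v \<in> set u \<Longrightarrow> adj v a \<Longrightarrow> v = hd u"
    "b \<in> Y \<Longrightarrow> v \<in> set u \<Longrightarrow> adj b v \<Longrightarrow> v = last u" "b \<in> Y \<Longrightarrow> v \<in> set u \<Longrightarrow> adj v b \<Longrightarrow> v = last u"
    "i < j \<Longrightarrow> j < length u \<Longrightarrow> adj (u ! i) (u ! j) \<Longrightarrow> j = Suc i"
    by (fact 1, metis 1(1) adj_sym, fact 1, metis 1(2) adj_sym, fact 1, metis 1(3) adj_sym, fact 1)
qed

lemma succ_rev: "successively adj (rev u) = successively adj u"
proof -
  have "(\<lambda>x y. adj y x) = adj" using adj_sym by blast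
  then show ?thesis by (metis successively_rev)
qed

lemma bare_isthmus_rev:
  assumes "bare_isthmus S X u Y" shows "bare_isthmus S Y (rev u) X"
proof -
  have "j = Suc i" if "i < j" "j < length u" "adj (rev u ! i) (rev u ! j)" for i j
  proof -
    have "adj (u ! (length u - Suc j)) (u ! (length u - Suc i))" using that adj_sym by (simp add: rev_nth)
    moreover have "length u - Suc j < length u - Suc i" "length u - Suc i < length u" using that by auto
    ultimately have "length u - Suc i = Suc (length u - Suc j)" using assms unfolding bare_isthmus_def by blast
    then show ?thesis using that by linarith
  qed
  moreover have "\<not> adj a b" if "a \<in> Y" "b \<in> X" for a b
    using assms that adj_sym[of a b] unfolding bare_isthmus_def by blast
  ultimately show ?thesis using assms unfolding bare_isthmus_def
    by (simp add: hd_rev last_rev succ_rev del: successively_rev) blast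
qed

text \<open>A walk can leave \<open>X\<close> together with the path only through
  \<open>last u\<close>, so \<open>con_gate\<close> applies.\<close>

lemma bare_isthmus_conn:
  assumes "bare_isthmus S X u Y" "conn S" shows "conn (X \<union> set u)"
  unfolding conn_def
proof (intro ballI)
  fix a b assume ab: "a \<in> X \<union> set u" "b \<in> X \<union> set u"
  have "a \<in> S" "b \<in> S" using ab bare_isthmusD(4)[OF assms(1)] by auto
  then have "cn S a b" using assms unfolding conn_def by blast
  moreover have "b = last u" if "b \<in> X \<union> set u" "c \<in> S - (X \<union> set u)" "adj b c" for b c
  proof -
    have "c \<in> Y" using that bare_isthmusD(4)[OF assms(1)] by blast
    then show ?thesis using that bare_isthmus_edges[OF assms(1)] by blast
  qed
  ultimately have "if b \<in> X \<union> set u then cn (X \<union> set u) a b else cn (X \<union> set u) a (last u)"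
    using ab by (intro con_gate) auto
  then show "cn (X \<union> set u) a b" using ab by simp
qed

lemma bare_isthmus_reach:
  assumes "bare_isthmus S X u Y" "conn S" "h \<in> Y"
  shows "\<exists>z\<in>Y. cn Y h z \<and> adj z (last u)"
proof -
  note I = bare_isthmusD[OF assms(1)]
  have Y: "S - (X \<union> set u) = Y" "h \<notin> X \<union> set u" using I assms(3) by blast+
  have l: "last u \<in> set u" "last u \<in> S" "h \<in> S" using I assms(3) by auto
  then have "cn S h (last u)" using assms(2) unfolding conn_def by blast
  then obtain t b where "cn Y h t" "b \<in> X \<union> set u" "adj t b"
    using con_hit[of S h "last u" "X \<union> set u"] Y con_in[of Y h "last u"] l I(6) by auto
  moreover then have "t \<in> Y" using con_in by blast
  ultimately show ?thesis using bare_isthmus_edges[OF assms(1)] by blast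
qed

text \<open>The pebble retraces \<open>u\<close> backwards and continues to \<open>y\<close>; the
  extra hole is the one for \<open>y\<close>.\<close>

lemma escape:
  assumes "cfg g" "p \<in> P" "S \<subseteq> V" "conn C" "C \<subseteq> S" "g p \<in> S" "g p \<notin> C"
    and u: "u \<noteq> []" "distinct u" "successively adj u" "y \<notin> set u" "adj (g p) (last u)" "adj (hd u) y"
    and C: "set u \<subseteq> C" "y \<in> C" "length u + 1 \<le> card (C - g ` P)"
  shows "y \<in> Rng S p g"
proof -
  have "successively adj (g p # rev u @ [y])"
    using u by (auto simp del: successively_rev simp: successively_append_iff succ_rev hd_rev last_rev successively_Cons)
  then obtain g' where "eqv (insert (g p) C) g g'" "g' p = y"
    using push[of g p C "rev u @ [y]"] assms by auto
  then show ?thesis using RngI eqv_mono assms by (metis insert_subset)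
qed

text \<open>If two vertices of \<open>E\<close> were adjacent to the end of \<open>u\<close>, then \<open>p\<close> could step into one of them, let an additional
hole pass behind it through the other, and escape to \<open>y\<close>.\<close>
lemma range_step:
  assumes I: "bare_isthmus S D u E" and S: "conn S" "S \<subseteq> V" and g: "cfg g" "p \<in> P" "g p = last u"
    and y: "y \<in> D" "adj (hd u) y" "y \<notin> Rng S p g"
    and L: "card (D \<union> set u - g ` P) = length u - 1" and H: "2 \<le> card (E - g ` P)"
    and one: "length u = 1 \<Longrightarrow> conn E"
  shows "\<exists>z\<in>E. \<exists>g'. adj z (last u) \<and> (\<forall>z'\<in>E. adj z' (last u) \<longrightarrow> z' = z) \<and> eqv S g g' \<and> g' p = z \<and>
    card (D \<union> set u - g' ` P) = length u"
proof -
  define A t j where "A = D \<union> set u" and "t = last u" and "j = length u"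
  have u: "u \<noteq> []" "distinct u" "successively adj u" "y \<notin> set u" "t \<in> set u" "t \<in> A"
    using I y unfolding bare_isthmus_def A_def t_def by auto
  have AES: "S \<subseteq> A \<union> E" "S - A = E" using bare_isthmusD[OF I] unfolding A_def by blast+
  have AE: "A \<subseteq> S" "E \<subseteq> S" "\<And>v. v \<in> A \<Longrightarrow> v \<notin> E" using bare_isthmusD[OF I] unfolding A_def by blast+
  have finS: "finite S" using S finite_V finite_subset by blast
  have finA: "finite A" "finite E" using AE(1,2) finS finite_subset by blast+
  have cA: "conn A" using bare_isthmus_conn[OF I S(1)] A_def by simp
  have jA: "card (A - g ` P) = j - 1" "j \<ge> 1" using L u unfolding A_def j_def by (auto simp: Suc_le_eq)
  have tg: "t \<in> g ` P" using g t_def by (metis imageI)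
  have reach: "\<exists>z\<in>E. cn E h z \<and> adj z t" if "h \<in> E" for h
    using bare_isthmus_reach[OF I S(1) that] t_def by simp
  have A_u: "set u \<subseteq> A" "y \<in> A" using y A_def by auto
  \<comment> \<open>One hole beyond the \<open>j\<close> in \<open>A\<close> suffices for
    \<open>escape\<close>. It may lie in \<open>E\<close>, provided that it reaches \<open>t\<close>
    without crossing \<open>z\<close>, where \<open>p\<close> stands.\<close>
  have Key: False if g1: "eqv S g g1" "g1 p = z" "z \<in> E" "adj z t" "j \<le> card (A - g1 ` P)"
    "h2 \<in> E" "h2 \<notin> g1 ` P" "cn (E - {z}) h2 z2" "adj z2 t" for g1 z h2 z2
  proof -
    define C where "C = component (S - {z}) t"
    have "A \<subseteq> S - {z}" using AE g1 by auto
    then have AC: "A \<subseteq> C" unfolding C_def by (rule conn_in_comp[OF cA u(6)])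
    have c1: "cn (S - {z}) h2 z2" by (rule con_mono[OF g1(8)]) (use AE(2) in blast)
    have "t \<in> S - {z}" using g1(3) AE(1,3) u(6) by blast
    then have "cn (S - {z}) h2 t" by (rule con_step[OF c1 g1(9)])
    then have "cn (S - {z}) t h2" by (rule con_sym)
    then have "h2 \<in> C" unfolding C_def component_def by blast
    then have "insert h2 (A - g1 ` P) \<subseteq> C - g1 ` P" using AC g1 by blast
    moreover have CS: "C \<subseteq> S - {z}" using component_subset C_def by simp
    then have "finite C" using finS finite_subset by blast
    ultimately have "card (insert h2 (A - g1 ` P)) \<le> card (C - g1 ` P)" by (intro card_mono) auto
    moreover have "card (insert h2 (A - g1 ` P)) = Suc (card (A - g1 ` P))" using finA g1 AE by (subst card_insert_disjoint) auto
    ultimately have "length u + 1 \<le> card (C - g1 ` P)" using g1 j_def by linarith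
    then have "y \<in> Rng S p g1"
    proof (intro escape[of g1 p S C u y])
      show "conn C" unfolding C_def by (rule conn_comp)
      show "adj (g1 p) (last u)" using g1(2,4) t_def by simp
    qed (use eqv_cfg[OF g1(1) g(1)] g(2) S CS g1(2,3) AE(1,2) u y AC A_u in \<open>auto\<close>)
    then show False using y Rng_eqv[OF g(1) g1(1)] by simp
  qed
  \<comment> \<open>\<open>E\<close> may be rearranged before \<open>p\<close> steps from
    \<open>t\<close> to \<open>z\<close>. The vacated \<open>t\<close> raises the number of holes in
    \<open>A\<close> from \<open>j - 1\<close> to \<open>j\<close>.\<close>
  have Adv: "\<exists>g1 h'. eqv S g g1 \<and> g1 p = z \<and> (h' = h \<or> h' = z) \<and> h' \<notin> g0 ` P \<and> g1 ` P = insert h' (g0 ` P) - {t} \<and>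
      card (A - g1 ` P) = j"
    if av: "eqv E g g0" "h \<in> E" "h \<notin> g0 ` P" "cn E h z" "adj z t" for g0 h z
  proof -
    have p0: "g0 p = t" using eqv_out[OF av(1)] g t_def AE u by auto
    have c0: "cfg g0" using eqv_cfg[OF av(1) g(1)] .
    have A0: "A - g0 ` P = A - g ` P" using eqv_image[OF av(1)] AE by blast
    have E': "insert t E - {g0 p} = E" using p0 u AE by auto
    obtain g1 h' where 1: "h' = h \<or> h' = z" "h' \<notin> g0 ` P" "eqv (insert t E) g0 g1" "g1 p = z" "g1 ` P = insert h' (g0 ` P) - {t}"
      using advance[OF c0 g(2), of "insert t E" h z, unfolded E'] p0 av(3,4) adj_sym[OF av(5)] by auto
    have "insert t E \<subseteq> S" using AE u by auto
    then have "eqv S g g1" using eqv_trans[OF eqv_mono[OF av(1) AE(2)]] eqv_mono[OF 1(3)] by blast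
    moreover have "A - g1 ` P = insert t (A - g ` P)" using A0 1 u AE av con_in[OF av(4)] by auto
    then have "card (A - g1 ` P) = j" using finA tg jA by (simp add: card_insert_disjoint)
    ultimately show ?thesis using 1 by blast
  qed
  obtain h where h: "h \<in> E" "h \<notin> g ` P"
    using H by (metis Diff_iff card.empty all_not_in_conv not_numeral_le_zero)
  obtain z where z: "z \<in> E" "cn E h z" "adj z t" using reach h by blast
  \<comment> \<open>A hole in another component of \<open>E\<close> would reach \<open>t\<close>
    without meeting \<open>z\<close>, contrary to \<open>Key\<close>.\<close>
  have same: "cn E h3 z" if h3: "h3 \<in> E" "h3 \<notin> g ` P" for h3
  proof (rule ccontr)
    assume n: "\<not> cn E h3 z"
    obtain g1 h' where 1: "eqv S g g1" "g1 p = z" "h' = h \<or> h' = z" "g1 ` P = insert h' (g ` P) - {t}" "card (A - g1 ` P) = j"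
      using Adv[OF eqv_refl h z(2,3)] by blast
    obtain z2 where z2: "z2 \<in> E" "cn E h3 z2" "adj z2 t" using reach h3 by blast
    have "cn (E - {z}) h3 z2" using con_avoid z2 n by blast
    moreover have "h3 \<notin> g1 ` P" using 1(3,4) h3 n z(2) con_refl[OF z(1), of adj] by auto
    ultimately show False using Key[OF 1(1,2) z(1,3) _ h3(1) _ _ z2(3)] 1(5) by simp
  qed
  have "z' = z" if z': "z' \<in> E" "adj z' t" for z'
  proof (rule ccontr)
    assume ne: "z' \<noteq> z"
    show False
    proof (cases "cn E z z'")
      case True
      have fin: "finite (component E z)" by (rule finite_subset[OF component_subset finA(2)])
      have "E - g ` P \<subseteq> component E z - g ` P" using same con_sym unfolding component_def by blast
      then have "card (E - g ` P) \<le> card (component E z - g ` P)" using fin by (intro card_mono) auto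
      then have c: "card {z, z'} \<le> card (component E z - g ` P)" using H ne by simp
      have "{z, z'} \<subseteq> component E z" using True con_refl[OF z(1), of adj] unfolding component_def by auto
      then obtain g0 where g0: "eqv (component E z) g g0" "{z, z'} \<inter> g0 ` P = {}"
        using clear[OF conn_comp fin g(1) _ c] by blast
      have "eqv E g g0" using eqv_mono[OF g0(1) component_subset] .
      then obtain g1 h' where 1: "eqv S g g1" "g1 p = z" "h' = z" "g1 ` P = insert h' (g0 ` P) - {t}" "card (A - g1 ` P) = j"
        using Adv[of g0 z z] z g0(2) con_refl[OF z(1), of adj] by blast
      have "z' \<notin> g1 ` P" using 1 g0 ne by auto
      moreover have "cn (E - {z}) z' z'" by (rule con_refl) (use z' ne in simp)
      ultimately show False using Key[OF 1(1,2) z(1,3) _ z'(1) _ _ z'(2)] 1(5) by simp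
    next
      case False
      \<comment> \<open>Here \<open>z\<close> and \<open>z'\<close> lie in different components of
        \<open>E\<close>, and all holes of \<open>E\<close> are with \<open>z\<close>. The hole that
        frees \<open>z'\<close> must come from \<open>A\<close>, which has one because
        \<open>j > 1\<close>.\<close>
      have "j \<noteq> 1" using False one z z' unfolding j_def conn_def by blast
      then have "card (A - g ` P) \<noteq> 0" using jA by simp
      then obtain l where l: "l \<in> A" "l \<notin> g ` P" by (metis Diff_iff card.empty all_not_in_conv)
      obtain g1 h' where 1: "eqv S g g1" "g1 p = z" "h' = h \<or> h' = z" "g1 ` P = insert h' (g ` P) - {t}" "card (A - g1 ` P) = j"
        using Adv[OF eqv_refl h z(2,3)] by blast
      have z'g: "z' \<in> g ` P" using same z' False con_sym by blast
      have lt: "l \<noteq> t" "l \<notin> g1 ` P" using l tg 1 h z AE by auto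
      \<comment> \<open>With \<open>p\<close> waiting at \<open>z\<close>, the hole \<open>l\<close>
        goes to \<open>z'\<close>, and \<open>p\<close> passes through \<open>t\<close> into
        \<open>z'\<close>. From there every hole serves the escape, since those of \<open>E\<close>
        reach \<open>t\<close> through \<open>z\<close>.\<close>
      define B where "B = A \<union> {z'}"
      have "cn B l t" using con_mono[of A l t B] cA l u unfolding B_def conn_def by auto
      then have "cn B l z'" using con_step adj_sym[OF z'(2)] unfolding B_def by fastforce
      moreover have "z' \<in> g1 ` P" using 1 z'g z' u AE by auto
      moreover have c1: "cfg g1" using eqv_cfg[OF 1(1) g(1)] .
      ultimately obtain g2 where g2: "eqv B g1 g2" "g2 ` P = insert l (g1 ` P - {z'})"
        using swap_hole lt by blast
      have "g1 p \<notin> B" using AE(3) 1(2) z(1) ne unfolding B_def by auto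
      then have p2: "g2 p = z" using eqv_out[OF g2(1)] 1(2) by simp
      have c2: "cfg g2" using eqv_cfg[OF g2(1) c1] .
      have t2: "t \<notin> g2 ` P" "z' \<notin> g2 ` P" using g2(2) 1(4) lt l AE(3) z' by auto
      define g3 where "g3 = g2(p := z')"
      have "t \<in> S" "z \<in> S" "z' \<in> S" "t \<noteq> z'" using AE z z' u(6) by auto
      then have e3: "eqv S g2 g3"
        using walk[of g2 p "[t, z']" S] c2 g(2) p2 z(3) adj_sym[OF z'(2)] t2 unfolding g3_def by auto
      have "B \<subseteq> S" using AE z' unfolding B_def by auto
      then have e: "eqv S g g3" using eqv_trans[OF 1(1)] eqv_trans[OF eqv_mono[OF g2(1)]] e3 by blast
      have "g3 ` P = insert z' (g2 ` P - {z})" using image_upd[of g2 p z'] c2 g(2) p2 unfolding g3_def cfg_def by auto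
      then have i3: "g3 ` P = insert l (insert h' (g ` P)) - {t, z}"
        using g2 1 z'g ne z' u AE lt l z by auto
      define C where "C = component (S - {z'}) t"
      have "A \<subseteq> S - {z'}" using AE z' by auto
      then have AC: "A \<subseteq> C" unfolding C_def by (rule conn_in_comp[OF cA u(6)])
      have CS: "C \<subseteq> S - {z'}" using component_subset C_def by simp
      have "v \<in> C" if v: "v \<in> S" "v \<notin> g3 ` P" for v
      proof (cases "v \<in> A")
        case F: False
        then have vE: "v \<in> E" using v AES by blast
        have "cn E v z"
        proof (cases "v = z")
          case False
          then have "v \<notin> g ` P" using v i3 F u by auto
          then show ?thesis using same vE by blast
        qed (use con_refl[OF z(1), of adj] in auto)
        moreover then have "\<not> cn E v z'" using False con_sym con_trans by blast
        ultimately have "cn (E - {z'}) v z" using con_avoid by blast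
        then have "cn (S - {z'}) v z" by (rule con_mono) (use AE(2) in blast)
        moreover have "cn (S - {z'}) z t" using z z' ne AE u by (intro con_edge) auto
        ultimately show "v \<in> C" unfolding C_def component_def using con_sym con_trans by blast
      qed (use AC in auto)
      then have "S - g ` P \<noteq> {} \<Longrightarrow> S - g3 ` P \<subseteq> C - g3 ` P" by blast
      then have "card (S - g3 ` P) \<le> card (C - g3 ` P)" using finite_subset[OF CS] finS h AE by (intro card_mono) auto
      moreover have "card (S - g3 ` P) = card (S - g ` P)" using eqv_card[OF e g(1) finS] .
      moreover have "S - g ` P = (A - g ` P) \<union> (E - g ` P)" "(A - g ` P) \<inter> (E - g ` P) = {}"
        using AE AES by blast+
      then have "card (S - g ` P) = (j - 1) + card (E - g ` P)"
        using card_Un_disjoint[of "A - g ` P" "E - g ` P"] finA jA by simp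
      ultimately have "length u + 1 \<le> card (C - g3 ` P)" using H jA j_def by linarith
      moreover have "g3 p = z'" by (simp add: g3_def)
      ultimately have "y \<in> Rng S p g3"
      proof (intro escape[of g3 p S C u y])
        show "conn C" unfolding C_def by (rule conn_comp)
        show "adj (g3 p) (last u)" using z'(2) t_def by (simp add: g3_def)
      qed (use eqv_cfg[OF e g(1)] g(2) S CS z' AE(1,2) u y AC A_u in auto)
      then show False using y Rng_eqv[OF g(1) e] by simp
    qed
  qed
  moreover obtain g1 where "eqv S g g1" "g1 p = z" "card (A - g1 ` P) = j"
    using Adv[OF eqv_refl h z(2,3)] by blast
  ultimately show ?thesis using z unfolding t_def A_def j_def by blast
qed

lemma bare_isthmus_extend:
  assumes I: "bare_isthmus S D u E" and z: "z \<in> E" "adj z (last u)" "\<And>z'. z' \<in> E \<Longrightarrow> adj z' (last u) \<Longrightarrow> z' = z"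
    and "E - {z} \<noteq> {}"
  shows "bare_isthmus S D (u @ [z]) (E - {z})"
proof -
  note ID = bare_isthmusD[OF I] and IE = bare_isthmus_edges[OF I]
  have zu: "z \<notin> set u" using z ID by blast
  have a: "j = Suc i" if "i < j" "j < length (u @ [z])" "adj ((u @ [z]) ! i) ((u @ [z]) ! j)" for i j
  proof (cases "j = length u")
    case True
    then have "adj (u ! i) z" and iu: "i < length u" using that by (auto simp: nth_append)
    then have "u ! i = last u" using IE(6) z(1) by simp
    then have "u ! i = u ! (length u - 1)" using ID(1) by (simp add: last_conv_nth)
    then have "i = length u - 1" using ID(1,2) iu by (simp add: nth_eq_iff_index_eq)
    then show ?thesis using True ID(1) by simp
  next
    case False
    then have "adj (u ! i) (u ! j)" "j < length u" using that by (auto simp: nth_append)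
    then show ?thesis using IE(7) that(1) by blast
  qed
  have b: "successively adj (u @ [z])"
    using ID(1,3) adj_sym[OF z(2)] by (simp add: successively_append_iff)
  have c: "v = z" if "b \<in> E - {z}" "v \<in> set (u @ [z])" "adj b v" for b v
  proof (rule ccontr)
    assume "v \<noteq> z"
    then have "v \<in> set u" using that by auto
    then have "v = last u" using IE(5) that by blast
    then show False using z(3) that by blast
  qed
  have d: "v = hd (u @ [z])" if "a \<in> D" "v \<in> set (u @ [z])" "adj a v" for a v
  proof -
    have "v \<noteq> z" using IE(1) that z(1) by blast
    then show ?thesis using IE(3) that ID(1) by auto
  qed
  have e: "\<not> adj a b" if "a \<in> D" "b \<in> E - {z}" for a b using IE(1) that by blast
  have sets: "D \<union> set (u @ [z]) \<union> (E - {z}) = S" "D \<inter> set (u @ [z]) = {}" "(E - {z}) \<inter> set (u @ [z]) = {}"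
    "D \<inter> (E - {z}) = {}" "u @ [z] \<noteq> []" "distinct (u @ [z])"
    using ID zu z(1) by auto
  have hol: "\<forall>i j. i < j \<longrightarrow> j < length (u @ [z]) \<longrightarrow> adj ((u @ [z]) ! i) ((u @ [z]) ! j) \<longrightarrow> j = Suc i"
    "\<forall>a\<in>D. \<forall>b\<in>E - {z}. \<not> adj a b" "\<forall>a\<in>D. \<forall>v\<in>set (u @ [z]). adj a v \<longrightarrow> v = hd (u @ [z])"
    using a d e by blast+
  have "\<forall>b\<in>E - {z}. \<forall>v\<in>set (u @ [z]). adj b v \<longrightarrow> v = last (u @ [z])" using c by (metis last_snoc)
  then show ?thesis unfolding bare_isthmus_def by (intro conjI sets hol b ID(8) assms(5)) assumption
qed

text \<open>The vertex \<open>y\<close> is out of reach only because \<open>p\<close>, retreating from it, finds a path of \<open>k\<close> vertices without side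
branches; the path is built one vertex at a time, one hole being left behind at each step.\<close>
lemma range_boundary:
  assumes S: "conn S" "S \<subseteq> V" and f: "cfg f" "p \<in> P" "f p \<in> S" and k: "k = card (S - f ` P)" "k \<ge> 1"
    and y: "y \<in> S" "adj (f p) y" "y \<notin> Rng S p f"
  shows "\<exists>D u E. bare_isthmus S D u E \<and> length u = k \<and> hd u = f p \<and> y \<in> D \<and> Rng S p f \<inter> E \<noteq> {} \<and>
    (\<forall>v\<in>E \<union> set (tl u). \<exists>h\<in>S - f ` P. cn (S - {f p}) v h)"
proof -
  define x where "x = f p"
  have finS: "finite S" using S finite_V finite_subset by blast
  \<comment> \<open>As \<open>p\<close> stands on \<open>last u\<close>, the near part has only
    \<open>j - 1\<close> holes. The clause about \<open>h\<close> refers to the holes of the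
    original \<open>f\<close>; it later locates a hole on a detour.\<close>
  define St where "St = (\<lambda>j D u E g. bare_isthmus S D u E \<and> length u = j \<and> hd u = x \<and> y \<in> D \<and> eqv S f g \<and> g p = last u \<and>
    card (D \<union> set u - g ` P) = j - 1 \<and> (\<forall>v\<in>E \<union> set (tl u). \<exists>h\<in>S - f ` P. cn (S - {x}) v h) \<and> (j = 1 \<longrightarrow> conn E))"
  have holesE: "card (E - g ` P) = k - (j - 1)" if "St j D u E g" for j D u E g
  proof -
    have 1: "bare_isthmus S D u E" "eqv S f g" "card (D \<union> set u - g ` P) = j - 1" using that St_def by auto
    have "D \<union> set u \<union> E = S" "(D \<union> set u) \<inter> E = {}" using 1 unfolding bare_isthmus_def by auto
    then have "S - g ` P = (D \<union> set u - g ` P) \<union> (E - g ` P)" "(D \<union> set u - g ` P) \<inter> (E - g ` P) = {}" by auto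
    then have "card (S - g ` P) = (j - 1) + card (E - g ` P)"
      using finS 1(3) by (metis card_Un_disjoint finite_Diff finite_Un)
    then show ?thesis using eqv_card[OF 1(2) f(1) finS] k by simp
  qed
  have base: "\<exists>D u E g. St 1 D u E g"
  proof -
    obtain h where h: "h \<in> S" "h \<notin> f ` P" using k by (metis Diff_iff card.empty all_not_in_conv not_one_le_zero)
    define F where "F = component (S - {x}) h"
    have hx: "h \<noteq> x" using h f x_def by auto
    have xS: "x \<in> S" using f x_def by simp
    have "cn S h x" using S h xS unfolding conn_def by blast
    then obtain z where z: "cn (S - {x}) h z" "adj z x" using con_nbr hx by blast
    have hF: "h \<in> F" "z \<in> F" "F \<subseteq> S - {x}" using h hx z component_subset unfolding F_def by (auto simp: component_def intro: con_refl)
    have yx: "y \<noteq> x" using y adj_irrefl x_def by metis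
    have yF: "y \<notin> F"
    proof
      assume "y \<in> F"
      then have "cn (S - {f p}) h y" using F_def component_def x_def by simp
      then obtain g' where "eqv S f g'" "g' p = y" using advance f h y by blast
      then show False using y RngI by blast
    qed
    define D where "D = S - {x} - F"
    have DF: "\<not> adj a b" if "a \<in> D" "b \<in> F" for a b
      using that adj_sym con_step[of adj "S - {x}" h b a] unfolding D_def F_def component_def by blast
    \<comment> \<open>After a retreat of \<open>p\<close> to \<open>z\<close>, a hole in
      \<open>D\<close> and the vacated \<open>x\<close> would be two holes on the side of
      \<open>y\<close>, enough to return through \<open>x\<close>.\<close>
    have nod: "l \<in> f ` P" if l: "l \<in> D" for l
    proof (rule ccontr)
      assume lf: "l \<notin> f ` P"
      have zx: "z \<noteq> x" using z adj_irrefl by auto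
      obtain g' h' where 1: "h' = h \<or> h' = z" "eqv S f g'" "g' p = z" "g' ` P = insert h' (f ` P) - {x}"
        using advance[of f p S h z] f h z(1) adj_sym[OF z(2)] x_def by blast
      define C where "C = component (S - {z}) x"
      have lS: "l \<in> S" "l \<noteq> x" "l \<notin> F" using l D_def by auto
      have "cn S l x" using S lS xS unfolding conn_def by blast
      then obtain t where t: "cn (S - {x}) l t" "adj t x" using con_nbr lS by blast
      have "\<not> cn (S - {x}) l z" using lS z(1) con_sym con_trans unfolding F_def component_def by blast
      then have "cn (S - {x} - {z}) l t" using con_avoid t by blast
      then have lt: "cn (S - {z}) l t" using con_mono by blast
      have "cn (S - {z}) t x" using con_in[OF lt] t xS zx by (intro con_edge) auto
      then have "l \<in> C" using lt con_sym con_trans unfolding C_def component_def by blast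
      moreover have xC: "x \<in> C" using con_refl[of x "S - {z}" adj] xS zx unfolding C_def component_def by auto
      moreover have lg: "l \<notin> g' ` P" "x \<notin> g' ` P" using 1 lf lS hF by auto
      ultimately have "{l, x} \<subseteq> C - g' ` P" by auto
      moreover have CS: "C \<subseteq> S - {z}" using component_subset C_def by simp
      ultimately have "card {l, x} \<le> card (C - g' ` P)" using finite_subset[OF CS] finS by (intro card_mono) auto
      then have "2 \<le> card (C - g' ` P)" using lS by simp
      moreover have "y \<in> C" using con_step[of adj "S - {z}" x x y] con_refl[of x "S - {z}" adj] xS zx y yF hF unfolding C_def component_def x_def by auto
      ultimately have "y \<in> Rng S p g'"
        using escape[of g' p S C "[x]" y] eqv_cfg[OF 1(2) f(1)] f S conn_comp[of "S - {z}" x, folded C_def] CS 1(3) hF z xC y yx x_def by auto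
      then show False using y Rng_eqv[OF f(1) 1(2)] by simp
    qed
    have "bare_isthmus S D [x] F" unfolding bare_isthmus_def
      using hF xS DF y yF yx D_def by auto
    moreover have "D - f ` P = {}" using nod by auto
    then have "card (D - f ` P) = 0" by (metis card.empty)
    moreover have "f p \<in> f ` P" using f by simp
    moreover have "conn F" using conn_comp F_def by simp
    moreover have "\<forall>v\<in>F. \<exists>h\<in>S - f ` P. cn (S - {x}) v h" using h con_sym unfolding F_def component_def by blast
    moreover have "y \<in> D" using y yF yx D_def by simp
    ultimately have "St 1 D [x] F f" unfolding St_def using eqv_refl x_def by simp
    then show ?thesis by blast
  qed
  have "\<exists>D u E g. St j D u E g" if "1 \<le> j" "j \<le> k" for j
    using that
  proof (induction j rule: dec_induct)
    case (step j)
    then obtain D u E g where st: "St j D u E g" by auto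
    then have 1: "bare_isthmus S D u E" "length u = j" "hd u = x" "y \<in> D" "eqv S f g" "g p = last u"
      "card (D \<union> set u - g ` P) = j - 1" "\<And>v. v \<in> E \<union> set (tl u) \<Longrightarrow> \<exists>h\<in>S - f ` P. cn (S - {x}) v h"
      "j = 1 \<longrightarrow> conn E"
      unfolding St_def by auto
    have "2 \<le> card (E - g ` P)" using holesE[OF st] step by simp
    then obtain z g' where z: "z \<in> E" "adj z (last u)" "\<And>z'. z' \<in> E \<Longrightarrow> adj z' (last u) \<Longrightarrow> z' = z"
      "eqv S g g'" "g' p = z" "card (D \<union> set u - g' ` P) = j"
      using range_step[OF 1(1) S eqv_cfg[OF 1(5) f(1)] f(2) 1(6,4)] 1 y Rng_eqv[OF f(1) 1(5)] x_def by (metis One_nat_def)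
    have u: "u \<noteq> []" using 1 unfolding bare_isthmus_def by blast
    have zg: "z \<in> g' ` P" using z f by blast
    have "D \<union> set (u @ [z]) - g' ` P = D \<union> set u - g' ` P" using zg by auto
    moreover have "bare_isthmus S D (u @ [z]) (E - {z})"
    proof -
      have "E - {z} \<noteq> {}"
      proof
        assume "E - {z} = {}"
        then have "card (E - g ` P) \<le> card {z}" by (intro card_mono) auto
        then show False using \<open>2 \<le> card (E - g ` P)\<close> by simp
      qed
      then show ?thesis by (intro bare_isthmus_extend[OF 1(1) z(1,2)] z(3))
    qed
    moreover have "hd (u @ [z]) = x" "tl (u @ [z]) = tl u @ [z]" using u 1(3) by simp_all
    moreover have "\<exists>h\<in>S - f ` P. cn (S - {x}) v h" if "v \<in> E - {z} \<union> set (tl u @ [z])" for v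
      using 1(8)[of v] that z(1) by auto
    moreover have "length (u @ [z]) = Suc j" "g' p = last (u @ [z])" using 1(2) z(5) by simp_all
    ultimately have "St (Suc j) D (u @ [z]) (E - {z}) g'"
      unfolding St_def using 1(4) z(6) eqv_trans[OF 1(5) z(4)] step(1) by simp
    then show ?case by blast
  qed (use base in auto)
  then obtain D u E g where st: "St k D u E g" using k by blast
  then have 1: "bare_isthmus S D u E" "length u = k" "hd u = x" "y \<in> D" "eqv S f g" "g p = last u"
      "\<forall>v\<in>E \<union> set (tl u). \<exists>h\<in>S - f ` P. cn (S - {x}) v h"
      unfolding St_def by auto
  \<comment> \<open>The last hole beyond the isthmus takes \<open>p\<close> into \<open>E\<close>.
    That the range meets \<open>E\<close> later decides on which side \<open>p\<close>
    belongs.\<close>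
  have "card (E - g ` P) = 1" using holesE[OF st] k by simp
  then obtain h where h: "h \<in> E" "h \<notin> g ` P" by (metis Diff_iff card.empty all_not_in_conv zero_neq_one)
  obtain z where z: "z \<in> E" "cn E h z" "adj z (last u)" using bare_isthmus_reach[OF 1(1) S(1) h(1)] by blast
  note ID = bare_isthmusD[OF 1(1)]
  have l: "last u \<in> S" "E \<subseteq> S - {g p}" using ID 1(6) last_in_set[OF ID(1)] by auto
  have c: "cn (S - {g p}) h z" using con_mono[OF z(2) l(2)] .
  obtain g' where g': "eqv S g g'" "g' p = z"
    using advance[OF eqv_cfg[OF 1(5) f(1)] f(2) _ c h(2)] 1(6) l(1) adj_sym[OF z(3)] by auto
  have "z \<in> Rng S p f" using RngI[OF eqv_trans[OF 1(5) g'(1)], of p] g'(2) by simp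
  then have "Rng S p f \<inter> E \<noteq> {}" using z(1) by blast
  then show ?thesis using 1(1,2,3,4,7) unfolding x_def by blast
qed


section \<open>The two sides of an isthmus\<close>

text \<open>\<open>PX\<close> and \<open>PY\<close> are the pebbles of the two sides: those that stand in \<open>X\<close> and in \<open>Y\<close> when the holes are exactly \<open>u\<close>.
On \<open>u\<close> itself every pebble of \<open>PX\<close> precedes every pebble of \<open>PY\<close>.\<close>
definition ordered where
  "ordered X u Y PX PY g \<longleftrightarrow> (\<forall>r\<in>PX. g r \<in> X \<union> set u) \<and> (\<forall>r\<in>PY. g r \<in> Y \<union> set u) \<and>
     (\<forall>r\<in>PX. \<forall>s\<in>PY. \<forall>i j. i < length u \<longrightarrow> j < length u \<longrightarrow> g r = u ! i \<longrightarrow> g s = u ! j \<longrightarrow> i < j)"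

lemma orderedD:
  assumes "ordered X u Y PX PY g"
  shows "r \<in> PX \<Longrightarrow> g r \<in> X \<union> set u" "s \<in> PY \<Longrightarrow> g s \<in> Y \<union> set u"
    "r \<in> PX \<Longrightarrow> s \<in> PY \<Longrightarrow> i < length u \<Longrightarrow> j < length u \<Longrightarrow> g r = u ! i \<Longrightarrow> g s = u ! j \<Longrightarrow> i < j"
  using assms unfolding ordered_def by blast+

lemma ordered_rev:
  assumes "ordered X u Y PX PY g" shows "ordered Y (rev u) X PY PX g"
  unfolding ordered_def
proof (intro conjI ballI allI impI)
  fix r s i j assume a: "r \<in> PY" "s \<in> PX" "i < length (rev u)" "j < length (rev u)" "g r = rev u ! i" "g s = rev u ! j"
  then have "g s = u ! (length u - Suc j)" "g r = u ! (length u - Suc i)" by (simp_all add: rev_nth)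
  then have "length u - Suc j < length u - Suc i" using orderedD(3)[OF assms a(2,1)] a(3,4) by simp
  then show "i < j" by linarith
qed (use orderedD(1,2)[OF assms] in auto)

text \<open>A pebble of \<open>PX\<close> at the far end of \<open>u\<close> forces all of \<open>PY\<close> into \<open>Y\<close>, which is then full.\<close>
lemma ordered_step:
  assumes I: "bare_isthmus V X u Y" and o: "ordered X u Y PX PY g" and P: "PX \<union> PY = P"
    and c: "card PY = card Y" and g: "cfg g" and r: "r \<in> PX" "adj (g r) b" "b \<notin> g ` P" "PX \<inter> PY = {}"
  shows "ordered X u Y PX PY (g(r := b))"
proof -
  note ID = bare_isthmusD[OF I] and IE = bare_isthmus_edges[OF I] and O = orderedD[OF o]
  have b: "b \<in> X \<union> set u"
  proof (rule ccontr)
    assume "b \<notin> X \<union> set u"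
    then have bY: "b \<in> Y" using adj_V[OF r(2)] ID(4) by blast
    then have "g r \<in> set u" using IE(1) O(1)[OF r(1)] r(2) by blast
    then have gr: "g r = u ! (length u - 1)" using IE(6)[OF bY _ r(2)] ID(1) by (simp add: last_conv_nth)
    have "g s \<in> Y" if s: "s \<in> PY" for s
    proof (rule ccontr)
      assume "g s \<notin> Y"
      then obtain j where j: "j < length u" "g s = u ! j" using O(2)[OF s] by (auto simp: in_set_conv_nth)
      then have "length u - 1 < j" using O(3)[OF r(1) s _ j(1) gr j(2)] ID(1) by simp
      then show False using j(1) by linarith
    qed
    then have sub: "g ` PY \<subseteq> Y" by blast
    have "inj_on g PY" using g P unfolding cfg_def by (auto intro: inj_on_subset)
    then have "card (g ` PY) = card Y" using c by (simp add: card_image)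
    moreover have "finite Y" using ID(4) finite_V by (metis finite_Un)
    ultimately have "g ` PY = Y" using sub by (intro card_subset_eq)
    then show False using bY r(3) P by blast
  qed
  \<comment> \<open>On the induced path \<open>r\<close> moves at most one place forward, so it
    could overtake \<open>s\<close> only by landing on it.\<close>
  have ord: "i < j" if s: "s \<in> PY" "i < length u" "j < length u" "b = u ! i" "g s = u ! j" for s i j
  proof -
    have ij: "i \<noteq> j" using s r(3) P by (metis UnCI imageI)
    consider "g r \<in> X" | i' where "i' < length u" "g r = u ! i'"
      using O(1)[OF r(1)] by (auto simp: in_set_conv_nth)
    then show ?thesis
    proof cases
      case 1
      then have "u ! i = hd u" using IE(3) r(2) s(2,4) by auto
      then have "u ! i = u ! 0" using ID(1) by (simp add: hd_conv_nth)
      then have "i = 0" using ID(2) s(2) by (metis gr_implies_not0 nth_eq_iff_index_eq neq0_conv)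
      then show ?thesis using ij by simp
    next
      case 2
      then have i'j: "i' < j" using O(3)[OF r(1) s(1) 2(1) s(3) 2(2) s(5)] by simp
      show ?thesis
      proof (cases "i' < i")
        case True
        then have "i = Suc i'" using IE(7)[OF True s(2)] r(2) 2(2) s(4) by simp
        then show ?thesis using i'j ij by simp
      qed (use i'j in simp)
    qed
  qed
  have PY: "(g(r := b)) s = g s" if "s \<in> PY" for s using that r by auto
  show ?thesis unfolding ordered_def
  proof (intro conjI ballI allI impI)
    fix s t i j assume a: "s \<in> PX" "t \<in> PY" "i < length u" "j < length u" "(g(r := b)) s = u ! i" "(g(r := b)) t = u ! j"
    then show "i < j" using ord[of t i j] O(3)[of s t i j] PY[of t] by (cases "s = r") simp_all
  next
    fix s assume "s \<in> PX"
    then show "(g(r := b)) s \<in> X \<union> set u" using b O(1)[of s] by simp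
  next
    fix s assume "s \<in> PY"
    then show "(g(r := b)) s \<in> Y \<union> set u" using O(2)[of s] PY[of s] by simp
  qed
qed

text \<open>The cardinalities express that both sides are full when the holes are exactly
  \<open>u\<close>. Requiring \<open>ordered\<close> of all reachable configurations makes the
  notion itself invariant.\<close>

definition sided where
  "sided X u Y PX PY f \<longleftrightarrow> bare_isthmus V X u Y \<and> cfg f \<and> length u = card (V - f ` P) \<and>
     PX \<union> PY = P \<and> PX \<inter> PY = {} \<and> card PX = card X \<and> card PY = card Y \<and>
     (\<forall>g. eqv V f g \<longrightarrow> ordered X u Y PX PY g)"

section \<open>The invariant division of the pebbles\<close>

lemma sidedD:
  assumes "sided X u Y PX PY f"
  shows "bare_isthmus V X u Y" "cfg f" "length u = card (V - f ` P)" "PX \<union> PY = P" "PX \<inter> PY = {}"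
    "card PX = card X" "card PY = card Y" "eqv V f g \<Longrightarrow> ordered X u Y PX PY g"
  using assms unfolding sided_def by blast+

lemma sided_rev:
  assumes "sided X u Y PX PY f" shows "sided Y (rev u) X PY PX f"
proof -
  note D = sidedD[OF assms]
  have "PY \<union> PX = P" "PY \<inter> PX = {}" using D(4,5) by blast+
  moreover have "\<forall>g. eqv V f g \<longrightarrow> ordered Y (rev u) X PY PX g" using D(8) ordered_rev by blast
  moreover have "length (rev u) = card (V - f ` P)" using D(3) by simp
  ultimately show ?thesis unfolding sided_def using bare_isthmus_rev[OF D(1)] D(2,6,7) by blast
qed

text \<open>The sides are read off from a configuration \<open>f0\<close> whose holes are exactly
  \<open>u\<close>. Both sides are full there, which gives the cardinalities that
  \<open>ordered_step\<close> consumes.\<close>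

lemma sided_exists:
  assumes I: "bare_isthmus V X u Y" and "conn V" and f: "cfg f" and k: "length u = card (V - f ` P)"
  shows "\<exists>PX PY. sided X u Y PX PY f"
proof -
  note ID = bare_isthmusD[OF I]
  have uV: "set u \<subseteq> V" using ID(4) by blast
  have fin: "finite X" "finite Y" using ID(4) finite_V by (metis finite_Un)+
  obtain f0 where f0: "eqv V f f0" "set u \<inter> f0 ` P = {}"
    using clear[OF assms(2) finite_V f uV] k distinct_card[OF ID(2)] by auto
  have c0: "cfg f0" using eqv_cfg[OF f0(1) f] .
  have hs: "card (V - f0 ` P) = length u" using eqv_card[OF f0(1) f finite_V] k by simp
  moreover have "set u \<subseteq> V - f0 ` P" using uV f0 by blast
  ultimately have "V - f0 ` P = set u" using distinct_card[OF ID(2)] finite_V by (metis card_subset_eq finite_Diff)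
  then have XY: "X \<subseteq> f0 ` P" "Y \<subseteq> f0 ` P" using ID(4-6) by blast+
  define PX PY where "PX = {r\<in>P. f0 r \<in> X}" and "PY = {r\<in>P. f0 r \<in> Y}"
  have "f0 ` P \<subseteq> X \<union> Y" using c0 f0(2) ID(4) unfolding cfg_def by blast
  then have P: "PX \<union> PY = P" "PX \<inter> PY = {}" using ID(7) unfolding PX_def PY_def by blast+
  have cards: "card PX = card X" "card PY = card Y"
    using card_occ[OF c0, of X] card_occ[OF c0, of Y] XY unfolding PX_def PY_def by (simp_all add: Int_absorb2)
  have ord: "cfg g \<and> ordered X u Y PX PY g" if "eqv V f0 g" for g
    using that
  proof (induction rule: eqv_induct)
    case refl
    have "f0 r \<notin> set u" if "r \<in> P" for r using f0(2) that by blast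
    then have "f0 r \<noteq> u ! i" if "r \<in> PX" "i < length u" for r i using that unfolding PX_def by (metis (lifting) mem_Collect_eq nth_mem)
    then show ?case using c0 unfolding ordered_def PX_def PY_def by blast
  next
    case (step g h)
    then obtain r b where r: "r \<in> P" "adj (g r) b" "b \<notin> g ` P" "h = g(r := b)" unfolding step_def by blast
    have o: "ordered X u Y PX PY g" and g: "cfg g" using step by auto
    have "ordered X u Y PX PY h"
    proof (cases "r \<in> PX")
      case True
      then show ?thesis unfolding r(4) using ordered_step[OF I o P(1) cards(2) g _ r(2,3) P(2)] by blast
    next
      case False
      then have "r \<in> PY" using r(1) P by blast
      then have "ordered Y (rev u) X PY PX h" unfolding r(4)
        using ordered_step[OF bare_isthmus_rev[OF I] ordered_rev[OF o] _ cards(1) g _ r(2,3)] P by (simp add: Un_commute Int_commute)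
      then show ?thesis using ordered_rev[of Y "rev u" X PY PX h] by simp
    qed
    then show ?case using step_cfg[OF g step(2)] by blast
  qed
  have "ordered X u Y PX PY g" if "eqv V f g" for g
    using ord eqv_trans[OF eqv_sym[OF f0(1) f] that] by blast
  then show ?thesis unfolding sided_def using I f k P cards by blast
qed

lemma sided_eqv:
  assumes "sided X u Y PX PY f" "eqv V f g" shows "sided X u Y PX PY g"
proof -
  note D = sidedD[OF assms(1)]
  have "ordered X u Y PX PY h" if "eqv V g h" for h using D(8) eqv_trans[OF assms(2) that] by blast
  then show ?thesis unfolding sided_def
    using D(1-7) eqv_cfg[OF assms(2) D(2)] eqv_card[OF assms(2) D(2) finite_V] by simp
qed

lemma sided_Rng:
  assumes "sided X u Y PX PY f"
  shows "p \<in> PX \<Longrightarrow> Rng V p f \<subseteq> X \<union> set u" "p \<in> PY \<Longrightarrow> Rng V p f \<subseteq> Y \<union> set u"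
  by (auto elim!: RngE dest: sidedD(8)[OF assms] orderedD(1,2))

text \<open>The edge by which a walk from \<open>v\<close> enters the range of \<open>p\<close> determines the isthmus.\<close>
lemma separated_aux:
  assumes "conn V" "cfg f" "p \<in> P" "q \<in> P" "1 \<le> card (V - f ` P)" "v \<in> Rng V q f" "v \<notin> Rng V p f"
  shows "\<exists>X u Y PX PY. sided X u Y PX PY f \<and> q \<in> PX \<and> p \<in> PY \<and> Rng V q f \<inter> X \<noteq> {} \<and> Rng V p f \<inter> Y \<noteq> {}"
proof -
  have inV: "f r \<in> V" if "r \<in> P" for r using assms(2) that unfolding cfg_def by blast
  have "v \<in> V" using Rng_sub[of f q V] inV assms by blast
  then have "cn V v (f p)" using assms(1) inV[OF assms(3)] unfolding conn_def by blast
  moreover have "\<not> cn (V - Rng V p f) v (f p)" using con_in[of "V - Rng V p f" v "f p"] Rng_self by blast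
  ultimately obtain y x where yx: "cn (V - Rng V p f) v y" "x \<in> Rng V p f" "adj y x"
    using con_hit[of V v "f p" "Rng V p f"] assms(7) by blast
  obtain g where g: "eqv V f g" "g p = x" using yx(2) by (rule RngE)
  have cg: "cfg g" using eqv_cfg[OF g(1) assms(2)] .
  have R: "Rng V r g = Rng V r f" for r using Rng_eqv[OF assms(2) g(1)] .
  have y: "y \<in> V" "adj (g p) y" "y \<notin> Rng V p g" using con_in[OF yx(1)] adj_sym[OF yx(3)] g(2) R by auto
  have k: "1 \<le> card (V - g ` P)" using eqv_card[OF g(1) assms(2) finite_V] assms(5) by simp
  have "g p \<in> V" using cg assms(3) unfolding cfg_def by blast
  then obtain X u Y where XuY: "bare_isthmus V X u Y" "length u = card (V - g ` P)" "hd u = x" "y \<in> X" "Rng V p g \<inter> Y \<noteq> {}"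
    using range_boundary[OF assms(1) subset_refl cg assms(3) _ refl k y] g(2) by blast
  obtain PX PY where s: "sided X u Y PX PY g" using sided_exists[OF XuY(1) assms(1) cg XuY(2)] by blast
  have sf: "sided X u Y PX PY f" using sided_eqv[OF s eqv_sym[OF g(1) assms(2)]] .
  \<comment> \<open>The walk between \<open>v\<close> and \<open>y\<close> stays off the range of
    \<open>p\<close>, hence off \<open>hd u\<close>, the only vertex through which \<open>X\<close>
    can be left.\<close>
  have "v \<in> X"
  proof (rule con_closed[OF con_sym[OF yx(1)] XuY(4)])
    fix b c assume bc: "b \<in> X" "adj b c" "c \<in> V - Rng V p f"
    have "c \<notin> set u" using bare_isthmus_edges(3)[OF XuY(1) bc(1) _ bc(2)] XuY(3) yx(2) bc(3) by auto
    moreover have "c \<notin> Y" using bare_isthmus_edges(1)[OF XuY(1) bc(1)] bc(2) by blast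
    ultimately show "c \<in> X" using bare_isthmusD(4)[OF XuY(1)] bc(3) by blast
  qed
  then have "Rng V q f \<inter> X \<noteq> {}" "Rng V p f \<inter> Y \<noteq> {}" using assms(6) XuY(5) R by auto
  moreover have "q \<notin> PY"
    using sided_Rng(2)[OF sf, of q] \<open>v \<in> X\<close> assms(6) bare_isthmusD(5,7)[OF XuY(1)] by blast
  moreover have "p \<notin> PX"
    using sided_Rng(1)[OF sf, of p] \<open>Rng V p f \<inter> Y \<noteq> {}\<close> bare_isthmusD(6,7)[OF XuY(1)] by blast
  moreover have "PX \<union> PY = P" using sidedD(4)[OF sf] .
  ultimately show ?thesis using sf assms(3,4) by blast
qed

lemma separated:
  assumes "conn V" "cfg f" "p \<in> P" "q \<in> P" "1 \<le> card (V - f ` P)" "Rng V p f \<noteq> Rng V q f"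
  shows "\<exists>X u Y PX PY. sided X u Y PX PY f \<and> p \<in> PX \<and> q \<in> PY \<and> Rng V p f \<inter> X \<noteq> {} \<and> Rng V q f \<inter> Y \<noteq> {}"
proof -
  consider v where "v \<in> Rng V q f" "v \<notin> Rng V p f" | v where "v \<in> Rng V p f" "v \<notin> Rng V q f"
    using assms(6) by blast
  then show ?thesis
  proof cases
    case 1
    then show ?thesis using separated_aux[OF assms(1-5) 1] sided_rev by blast
  next
    case 2
    then show ?thesis using separated_aux[OF assms(1,2,4,3,5) 2] by blast
  qed
qed

section \<open>Contact across an isthmus\<close>

lemma bare_isthmus_prefix_conn:
  assumes I: "bare_isthmus V X u Y" and "conn V" and i: "i < length u"
  shows "conn (X \<union> set (take (Suc i) u))"
  unfolding conn_def
proof (intro ballI)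
  note ID = bare_isthmusD[OF I] and IE = bare_isthmus_edges[OF I]
  let ?U = "X \<union> set (take (Suc i) u)"
  have sub: "?U \<subseteq> X \<union> set u" using set_take_subset[of "Suc i" u] by blast
  fix a b assume ab: "a \<in> ?U" "b \<in> ?U"
  have "a \<in> X \<union> set u" "b \<in> X \<union> set u" using ab sub by blast+
  then have cab: "cn (X \<union> set u) a b" using bare_isthmus_conn[OF I assms(2)] unfolding conn_def by blast
  have "if b \<in> ?U then cn ?U a b else cn ?U a (u ! i)"
  proof (rule con_gate[OF cab ab(1)])
    fix b c assume bc: "b \<in> ?U" "c \<in> X \<union> set u - ?U" "adj b c"
    then obtain j where j: "j < length u" "c = u ! j" by (auto simp: in_set_conv_nth)
    have ji: "i < j"
    proof (rule ccontr)
      assume "\<not> i < j"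
      then have "c \<in> set (take (Suc i) u)" using j i by (auto simp: in_set_conv_nth intro!: exI[of _ j])
      then show False using bc by blast
    qed
    have "b \<notin> X"
    proof
      assume "b \<in> X"
      then have "u ! j = u ! 0" using IE(3)[of b c] bc(3) j ID(1) by (simp add: hd_conv_nth)
      then show False using ID(1,2) j(1) ji by (simp add: nth_eq_iff_index_eq)
    qed
    then obtain a where a: "a \<le> i" "b = u ! a" using bc(1) by (auto simp: in_set_conv_nth less_Suc_eq_le)
    then have "j = Suc a" using IE(7)[of a j] ji j bc(3) by simp
    then show "b = u ! i" using a ji by (simp add: le_less_Suc_eq)
  qed
  then show "cn ?U a b" using ab by simp
qed

text \<open>The region up to the foremost pebble of \<open>PX\<close>, at index \<open>i\<close>,
  contains exactly the pebbles of \<open>PX\<close>, as many as \<open>X\<close> has vertices. So it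
  has \<open>i + 1\<close> holes, just enough to empty its part of the path.\<close>

lemma retreat:
  assumes "conn V" and s: "sided X u Y PX PY g"
  shows "\<exists>g'. eqv V g g' \<and> (\<forall>r\<in>PX. g' r \<in> X) \<and> (\<forall>r\<in>PY. g' r = g r)"
proof (cases "g ` PX \<inter> set u = {}")
  case True
  then have "\<forall>r\<in>PX. g r \<in> X" using orderedD(1)[OF sidedD(8)[OF s eqv_refl]] by blast
  then show ?thesis using eqv_refl[of V g] by blast
next
  case False
  note D = sidedD[OF s] and O = orderedD[OF sidedD(8)[OF s eqv_refl]] and I = sidedD(1)[OF s]
  note ID = bare_isthmusD[OF I]
  define J where "J = {j. j < length u \<and> u ! j \<in> g ` PX}"
  have "finite J" unfolding J_def by simp
  obtain v where "v \<in> g ` PX" "v \<in> set u" using False by blast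
  then have "J \<noteq> {}" unfolding J_def by (auto simp: in_set_conv_nth)
  define i where "i = Max J"
  have iJ: "i \<in> J" "\<And>j. j \<in> J \<Longrightarrow> j \<le> i" using Max_in Max_ge \<open>finite J\<close> \<open>J \<noteq> {}\<close> i_def by auto
  then obtain r0 where r0: "i < length u" "r0 \<in> PX" "g r0 = u ! i" unfolding J_def by auto
  let ?H = "set (take (Suc i) u)" and ?S = "X \<union> set (take (Suc i) u)"
  have nth: "u ! j \<in> ?H \<longleftrightarrow> j \<le> i" if "j < length u" for j
    using that r0(1) ID(2) by (auto simp: in_set_conv_nth nth_eq_iff_index_eq less_Suc_eq_le)
  have Hu: "?H \<subseteq> set u" by (rule set_take_subset)
  have PX: "g r \<in> ?S" if rr: "r \<in> PX" for r
  proof (cases "g r \<in> X")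
    case False
    then obtain j where "j < length u" "g r = u ! j" using O(1)[OF rr] by (auto simp: in_set_conv_nth)
    moreover then have "j \<le> i" using iJ(2) rr unfolding J_def by (metis (mono_tags) imageI mem_Collect_eq)
    ultimately show ?thesis using nth by simp
  qed simp
  have PY: "g r \<notin> ?S" if "r \<in> PY" for r
  proof
    assume "g r \<in> ?S"
    then have "g r \<in> ?H" using O(2)[OF that] ID(5,7) by blast
    then obtain j where "j < length u" "g r = u ! j" using Hu by (auto simp: in_set_conv_nth)
    then show False using O(3)[OF r0(2) that r0(1) _ r0(3)] nth \<open>g r \<in> ?H\<close> by fastforce
  qed
  have fin: "finite ?S" "finite X" using ID(4) finite_V by (auto intro: finite_subset)
  have "{r\<in>P. g r \<in> ?S} = PX" using PX PY D(4) by blast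
  then have "card (?S - g ` P) = card ?S - card X" using card_holes[OF fin(1) D(2)] D(6) by simp
  moreover have "card ?S = card X + card ?H" using ID(5) Hu fin by (intro card_Un_disjoint) auto
  ultimately have "card ?H \<le> card (?S - g ` P)" by simp
  then obtain g' where g': "eqv ?S g g'" "?H \<inter> g' ` P = {}"
    using clear[OF bare_isthmus_prefix_conn[OF I assms(1) r0(1)] fin(1) D(2)] by blast
  have "g' r \<in> X" if "r \<in> PX" for r
    using eqv_in[OF g'(1) PX[OF that]] g'(2) that D(4) by blast
  moreover have "g' r = g r" if "r \<in> PY" for r using eqv_out[OF g'(1) PY[OF that]] .
  moreover have "?S \<subseteq> V" using ID(4) Hu by blast
  ultimately show ?thesis using eqv_mono[OF g'(1)] by blast
qed

text \<open>With \<open>q\<close> on the first vertex, \<open>PX\<close> is confined to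
  \<open>X\<close> and fills it, so all holes lie ahead of \<open>q\<close>. There are
  \<open>length u\<close> of them: enough for \<open>tl u\<close> and one vertex of
  \<open>Y\<close>.\<close>

lemma front:
  assumes "conn V" and s: "sided X u Y PX PY g" and q: "q \<in> PY" "g q = hd u"
  shows "set u \<subseteq> Rng V q g"
    "\<exists>g'. eqv V g g' \<and> g' q \<in> Y \<and> adj (g' q) (last u) \<and> g' ` P \<inter> set u = {}"
proof -
  note D = sidedD[OF s] and O = orderedD[OF sidedD(8)[OF s eqv_refl]] and I = sidedD(1)[OF s]
  note ID = bare_isthmusD[OF I]
  have qP: "q \<in> P" using q D(4) by blast
  let ?Z = "Y \<union> set (tl u)"
  have u: "u = hd u # tl u" using ID(1) by simp
  have hdu: "hd u \<in> set u" "hd u \<notin> ?Z" using ID(1,2,6) by (auto, metis distinct.simps(2) u)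
  have fin: "finite X" "finite Y" using ID(4) finite_V by (metis finite_Un)+
  have sub: "g ` PX \<subseteq> X"
  proof
    fix v assume "v \<in> g ` PX"
    then obtain r where r: "r \<in> PX" "v = g r" by blast
    show "v \<in> X"
    proof (rule ccontr)
      assume "v \<notin> X"
      then obtain i where "i < length u" "g r = u ! i" using O(1)[OF r(1)] r(2) by (auto simp: in_set_conv_nth)
      moreover have "g q = u ! 0" "0 < length u" using q(2) ID(1) by (auto simp: hd_conv_nth)
      ultimately show False using O(3)[OF r(1) q(1)] by blast
    qed
  qed
  have "inj_on g PX" using D(2,4) unfolding cfg_def by (auto intro: inj_on_subset)
  then have "card (g ` PX) = card X" using D(6) by (simp add: card_image)
  then have gX: "g ` PX = X" using sub fin by (intro card_subset_eq)
  have "V - g ` P = ?Z - g ` P"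
  proof -
    have "X \<subseteq> g ` P" using gX D(4) by blast
    moreover have "hd u \<in> g ` P" using q(2) qP by (metis imageI)
    moreover have "V = X \<union> insert (hd u) (set (tl u)) \<union> Y" using ID(4) u by (metis list.simps(15))
    ultimately show ?thesis by blast
  qed
  then have holes: "card (?Z - g ` P) = length u" using D(3) by simp
  have Ye: "\<exists>y. y \<in> Y" using ID(9) by blast
  \<comment> \<open>For a path of one vertex the region is \<open>Y\<close> alone, possibly
    disconnected; the single hole then determines the neighbour to step to.\<close>
  have cZ: "conn ?Z" if "tl u \<noteq> []"
  proof -
    have l: "2 \<le> length u" using that ID(1) u by (cases "tl u") (auto, metis One_nat_def Suc_1 Suc_le_mono length_Cons le_add1 plus_1_eq_Suc)
    have "conn (Y \<union> set (take (Suc (length u - 2)) (rev u)))"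
      using bare_isthmus_prefix_conn[OF bare_isthmus_rev[OF I] assms(1)] l by simp
    moreover have "take (Suc (length u - 2)) (rev u) = rev (tl u)"
      using l by (simp add: take_rev Suc_diff_le drop_Suc)
    ultimately show ?thesis by simp
  qed
  have ZV: "?Z \<subseteq> V" using ID(4) u by (metis Un_least le_sup_iff order_refl set_subset_Cons subset_trans)
  have gq: "g q \<notin> ?Z" using hdu(2) q(2) by simp
  have su: "successively adj (g q # tl u)" using ID(3) u q(2) by metis
  show "set u \<subseteq> Rng V q g"
  proof
    fix v assume "v \<in> set u"
    then obtain i where i: "i < length u" "v = u ! i" by (auto simp: in_set_conv_nth)
    show "v \<in> Rng V q g"
    proof (cases "tl u = []")
      case True
      then have "v = hd u" using \<open>v \<in> set u\<close> u by (metis empty_iff list.set(1) set_ConsD)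
      then show ?thesis using q Rng_self by metis
    next
      case False
      have "successively adj (g q # take i (tl u))"
        using su by (metis append_take_drop_id append_Cons successively_append_iff)
      moreover have "distinct (take i (tl u))" "set (take i (tl u)) \<subseteq> ?Z"
        using ID(2) set_take_subset[of i "tl u"] by (auto simp: distinct_tl)
      moreover have "length (take i (tl u)) \<le> card (?Z - g ` P)" using holes by simp
      ultimately obtain g' where g': "eqv (insert (g q) ?Z) g g'" "g' q = last (g q # take i (tl u))"
        using push[OF D(2) qP cZ[OF False] ZV gq, of "take i (tl u)"] by blast
      have "g q # take i (tl u) = take (Suc i) u" using u q(2) by (metis take_Suc_Cons)
      then have "g' q = v" using g'(2) i by (simp add: take_Suc_conv_app_nth)
      moreover have "eqv V g g'" by (rule eqv_mono[OF g'(1)]) (use ZV hdu(1) q(2) ID(4) in auto)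
      ultimately show ?thesis using RngI by metis
    qed
  qed
  show "\<exists>g'. eqv V g g' \<and> g' q \<in> Y \<and> adj (g' q) (last u) \<and> g' ` P \<inter> set u = {}"
  proof (cases "tl u = []")
    case True
    then have u1: "set u = {hd u}" "last u = hd u" using u by (metis list.set(1) list.simps(15), metis last.simps)
    have "length u = 1" using True u by (metis One_nat_def length_Cons list.size(3))
    then have "card (Y - g ` P) = 1" using holes True by simp
    then obtain h where h: "h \<in> Y" "h \<notin> g ` P" by (metis Diff_iff card.empty all_not_in_conv zero_neq_one)
    obtain z where z: "z \<in> Y" "cn Y h z" "adj z (hd u)"
      using bare_isthmus_reach[OF I assms(1) h(1)] u1(2) by auto
    have "insert (hd u) Y - {g q} = Y" using q(2) hdu by auto
    then obtain g' h' where g': "h' = h \<or> h' = z" "eqv (insert (hd u) Y) g g'" "g' q = z" "g' ` P = insert h' (g ` P) - {hd u}"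
      using advance[OF D(2) qP, of "insert (hd u) Y" h z] z(2) h(2) adj_sym[OF z(3)] q(2) by auto
    have "eqv V g g'" by (rule eqv_mono[OF g'(2)]) (use ID(4) hdu in auto)
    moreover have "g' ` P \<inter> set u = {}" using g'(4) u1 by auto
    ultimately show ?thesis using g'(3) z u1 by auto
  next
    case False
    obtain y where y: "y \<in> Y" "adj y (last u)" using Ye bare_isthmus_reach[OF I assms(1)] by blast
    have "last (g q # tl u) = last u" using u q(2) by metis
    then have "successively adj (g q # tl u @ [y])"
      using su adj_sym[OF y(2)] by (simp add: successively_append_iff successively_Cons False)
    moreover have "distinct (tl u @ [y])" using ID(2,6) y(1) by (auto simp: distinct_tl dest: list.set_sel(2)[OF ID(1)])
    moreover have "length (tl u @ [y]) \<le> card (?Z - g ` P)" using holes ID(1) by simp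
    moreover have "set (tl u @ [y]) \<subseteq> ?Z" using y by auto
    ultimately obtain g' where g': "eqv (insert (g q) ?Z) g g'" "g' q = last (g q # tl u @ [y])"
      "set (butlast (g q # tl u @ [y])) \<inter> g' ` P = {}"
      using push[OF D(2) qP cZ[OF False] ZV gq, of "tl u @ [y]"] by blast
    have "butlast (g q # tl u @ [y]) = u" using u q(2) by (simp add: butlast_append)
    then have "g' ` P \<inter> set u = {}" using g'(3) by auto
    moreover have "eqv V g g'" by (rule eqv_mono[OF g'(1)]) (use ZV hdu(1) q(2) ID(4) in auto)
    ultimately show ?thesis using g'(2) y by auto
  qed
qed

text \<open>Contact allows \<open>q\<close> to be brought to \<open>hd u\<close>: either it is there
  already, or \<open>PX\<close> retreats and \<open>q\<close> walks down the freed part of the path.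
  Then \<open>front\<close> applies. Reversing the isthmus gives the same for
  \<open>p\<close>.\<close>

lemma contact_covers:
  assumes "conn V" and s: "sided X u Y PX PY f" and pq: "p \<in> PX" "q \<in> PY"
    and g: "eqv V f g" "adj (g p) (g q)"
  shows "set u \<subseteq> Rng V q f"
proof -
  have sg: "sided X u Y PX PY g" using sided_eqv[OF s g(1)] .
  note D = sidedD[OF sg] and O = orderedD[OF sidedD(8)[OF sg eqv_refl]] and I = sidedD(1)[OF sg]
  note ID = bare_isthmusD[OF I] and IE = bare_isthmus_edges[OF I]
  have qP: "q \<in> P" using pq D(4) by blast
  have Rg: "Rng V q g = Rng V q f" using Rng_eqv[OF sidedD(2)[OF s] g(1)] .
  show ?thesis
  proof (cases "g p \<in> X")
    case True
    then have "g q \<in> set u" using O(2)[OF pq(2)] IE(1) g(2) by blast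
    then have "g q = hd u" using IE(3)[OF True _ g(2)] by blast
    then show ?thesis using front(1)[OF assms(1) sg pq(2)] Rg by simp
  next
    case False
    then obtain i where i: "i < length u" "g p = u ! i" using O(1)[OF pq(1)] by (auto simp: in_set_conv_nth)
    obtain g1 where g1: "eqv V g g1" "\<And>r. r \<in> PX \<Longrightarrow> g1 r \<in> X" "\<And>r. r \<in> PY \<Longrightarrow> g1 r = g r"
      using retreat[OF assms(1) sg] by blast
    have c1: "cfg g1" using eqv_cfg[OF g1(1) D(2)] .
    let ?w = "rev (take (Suc i) u)"
    have empty: "v \<notin> g1 ` P" if v: "v \<in> set ?w" for v
    proof
      assume "v \<in> g1 ` P"
      then obtain r where r: "r \<in> P" "v = g1 r" by blast
      obtain j where j: "j \<le> i" "j < length u" "v = u ! j" using v i(1) by (auto simp: in_set_conv_nth less_Suc_eq_le)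
      have "g1 r \<in> set u" using j r(2) by (metis nth_mem)
      then have "r \<notin> PX" using g1(2)[of r] ID(5) by blast
      then have "r \<in> PY" using r(1) D(4) by blast
      then have "i < j" using O(3)[OF pq(1) _ i(1) j(2) i(2)] g1(3) r j(3) by simp
      then show False using j(1) by simp
    qed
    have ne: "take (Suc i) u \<noteq> []" using ID(1) by simp
    have lt: "last (take (Suc i) u) = u ! i" "hd (take (Suc i) u) = hd u"
      using i(1) ID(1) by (simp_all add: take_Suc_conv_app_nth hd_conv_nth nth_append)
    have "successively adj (take (Suc i) u)" using ID(3) by (metis append_take_drop_id successively_append_iff)
    then have "successively adj ?w" using succ_rev by blast
    moreover have "adj (g1 q) (hd ?w)" using g(2) i(2) g1(3)[OF pq(2)] lt(1) adj_sym ne by (simp add: hd_rev)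
    ultimately have "successively adj (g1 q # ?w)" using ne by (simp add: successively_Cons del: successively_rev)
    moreover have "distinct ?w" using ID(2) by simp
    moreover have "set ?w \<inter> g1 ` P = {}" using empty by blast
    moreover have "set ?w \<subseteq> V" using set_take_subset[of "Suc i" u] ID(4) by auto
    moreover have "g1 q \<in> V" using c1 qP unfolding cfg_def by blast
    ultimately have e: "eqv V g1 (g1(q := last (g1 q # ?w)))" using walk[OF c1 qP] by blast
    have "last (g1 q # ?w) = hd u" using ne lt(2) by (simp add: last_rev)
    then have e': "eqv V g1 (g1(q := hd u))" using e by simp
    have e2: "eqv V g (g1(q := hd u))" using eqv_trans[OF g1(1) e'] .
    have "set u \<subseteq> Rng V q (g1(q := hd u))" using front(1)[OF assms(1) sided_eqv[OF sg e2] pq(2)] by simp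
    then show ?thesis using Rng_eqv[OF D(2) e2] Rg by simp
  qed
qed

text \<open>The motions on the two sides are independent as long as \<open>PY\<close> stays in \<open>Y\<close>: the witness combines a configuration in
which \<open>p\<close> stands at the end of \<open>u\<close> with one in which \<open>q\<close> stands next to that end.\<close>
lemma covers_contact:
  assumes "conn V" and s: "sided X u Y PX PY f" and pq: "p \<in> PX" "q \<in> PY"
    and R: "set u \<subseteq> Rng V p f" "set u \<subseteq> Rng V q f"
  shows "\<exists>g. eqv V f g \<and> adj (g p) (g q)"
proof -
  note D = sidedD[OF s] and I = sidedD(1)[OF s]
  note ID = bare_isthmusD[OF I]
  have "hd u \<in> Rng V q f" "last u \<in> Rng V p f" using R ID(1) by auto
  then obtain g0 g where g0: "eqv V f g0" "g0 q = hd u" and g: "eqv V f g" "g p = last u" by (metis RngE)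
  obtain a where a: "eqv V g0 a" "a q \<in> Y" "adj (a q) (last u)" "a ` P \<inter> set u = {}"
    using front(2)[OF assms(1) sided_eqv[OF s g0(1)] pq(2) g0(2)] by blast
  have fa: "eqv V f a" using eqv_trans[OF g0(1) a(1)] .
  have ca: "cfg a" using eqv_cfg[OF fa D(2)] .
  have sa: "sided X u Y PX PY a" using sided_eqv[OF s fa] .
  have aY: "a r \<in> Y" if "r \<in> PY" for r
    using orderedD(2)[OF sidedD(8)[OF sa eqv_refl] that] a(4) that D(4) by blast
  \<comment> \<open>Moves of \<open>PY\<close> are skipped; moves of \<open>PX\<close> stay possible
    because they never enter \<open>Y\<close>, where \<open>PY\<close> is frozen.\<close>
  define hyb where "hyb = (\<lambda>g r. if r \<in> PX then g r else a r)"
  have "eqv V a (hyb h)" if "eqv V a h" for h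
    using that
  proof (induction rule: eqv_induct)
    case refl
    have "hyb a = a" unfolding hyb_def by auto
    then show ?case using eqv_refl by simp
  next
    case (step g h)
    then obtain r b where r: "r \<in> P" "b \<in> V" "adj (g r) b" "b \<notin> g ` P" "h = g(r := b)" "g r \<in> V" unfolding step_def by blast
    show ?case
    proof (cases "r \<in> PX")
      case False
      then have "hyb h = hyb g" using r(5) unfolding hyb_def by auto
      then show ?thesis using step by simp
    next
      case True
      have "b \<in> X \<union> set u" using orderedD(1)[OF sidedD(8)[OF sa eqv_step[OF step(1,2)]] True] r(5) by simp
      then have "b \<notin> Y" using ID(6,7) by blast
      then have "b \<notin> hyb g ` P" using r(4) aY D(4) unfolding hyb_def by auto
      moreover have "hyb h = (hyb g)(r := b)" using r(5) True unfolding hyb_def by auto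
      ultimately have "eqv V (hyb g) (hyb h)" using eqv_move[of r "hyb g" V b] r True by (simp add: hyb_def)
      then show ?thesis using eqv_trans[OF step(3)] by blast
    qed
  qed
  moreover have "eqv V a g" using eqv_trans[OF eqv_sym[OF fa D(2)] g(1)] .
  ultimately have "eqv V f (hyb g)" using eqv_trans[OF fa] by blast
  moreover have "adj (hyb g p) (hyb g q)" using adj_sym[OF a(3)] g(2) pq D(5) unfolding hyb_def by auto
  ultimately show ?thesis by blast
qed


section \<open>Pebbles with equal range that never meet\<close>

lemma cn_step: "cn S a b \<Longrightarrow> adj b c \<Longrightarrow> c \<in> S \<Longrightarrow> cn S a c"
  by (rule con_step)

text \<open>\<open>N\<close> is a lower bound for the number of inner vertices of a path from \<open>p\<close> to \<open>q\<close> over all reachable configurations, \<open>closest\<close> says that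
it is attained at \<open>g\<close> by the path with inner part \<open>m\<close>.  In \<open>star\<close> there is moreover a hole on a detour from \<open>p\<close> to \<open>q\<close>
that avoids the shortest paths, so that \<open>p\<close> and \<open>q\<close> lie on a cycle along which they can be rotated.\<close>
definition apart where
  "apart f p q N \<longleftrightarrow> conn V \<and> cfg f \<and> p \<in> P \<and> q \<in> P \<and> p \<noteq> q \<and> 1 \<le> card (V - f ` P) \<and> 0 < N \<and>
     (\<forall>g m. eqv V f g \<longrightarrow> successively adj (g p # m @ [g q]) \<longrightarrow> N \<le> length m)"

definition closest where
  "closest f p q N g m \<longleftrightarrow> eqv V f g \<and> successively adj (g p # m @ [g q]) \<and> length m = N"

definition star where
  "star f p q N g m h \<longleftrightarrow> closest f p q N g m \<and> h \<notin> g ` P \<and>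
     (\<exists>e. adj (g p) e \<and> cn (V - {g p, g q}) h e) \<and> (\<exists>e. adj (g q) e \<and> cn (V - {g p, g q}) h e)"

section \<open>Pairs of pebbles at least distance\<close>

lemma apartD:
  assumes "apart f p q N"
  shows "conn V" "cfg f" "p \<in> P" "q \<in> P" "p \<noteq> q" "1 \<le> card (V - f ` P)" "0 < N"
    "eqv V f g \<Longrightarrow> successively adj (g p # m @ [g q]) \<Longrightarrow> N \<le> length m"
  using assms unfolding apart_def by blast+

lemma succ_swap: "successively adj (b # rev m @ [a]) = successively adj (a # m @ [b])"
  using succ_rev[of "a # m @ [b]"] by simp

lemma apart_swap:
  assumes "apart f p q N" shows "apart f q p N"
proof -
  note A = apartD[OF assms]
  have "N \<le> length m" if "eqv V f g" "successively adj (g q # m @ [g p])" for g m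
    using A(8)[OF that(1), of "rev m"] succ_swap[of "g q" "rev m" "g p"] that(2) by simp
  then show ?thesis unfolding apart_def using A(1-7) by blast
qed

lemma closest_swap: "closest f p q N g m \<Longrightarrow> closest f q p N g (rev m)"
  unfolding closest_def using succ_swap by (simp del: successively_rev)

lemma star_swap: "star f p q N g m h \<Longrightarrow> star f q p N g (rev m) h"
  unfolding star_def using closest_swap by (simp add: insert_commute)

text \<open>Minimality makes the walk a path: cutting out a loop would leave a shorter walk between
  the same positions.\<close>

lemma closestD:
  assumes a: "apart f p q N" and m: "closest f p q N g m"
  shows "eqv V f g" "cfg g" "successively adj (g p # m @ [g q])" "length m = N" "m \<noteq> []"
    "distinct (g p # m @ [g q])" "set (g p # m @ [g q]) \<subseteq> V"
    "adj (g p) (hd m)" "adj (last m) (g q)" "g p \<in> V" "g q \<in> V" "\<not> adj (g p) (g q)"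
    "successively adj (g p # m)" "successively adj (m @ [g q])"
proof -
  note A = apartD[OF a]
  show 1: "eqv V f g" "successively adj (g p # m @ [g q])" "length m = N" using m unfolding closest_def by blast+
  show c: "cfg g" using eqv_cfg[OF 1(1) A(2)] .
  show ne: "m \<noteq> []" using 1(3) A(7) by auto
  show V: "g p \<in> V" "g q \<in> V" using c A(3,4) unfolding cfg_def by blast+
  show "adj (g p) (hd m)" "adj (last m) (g q)" using 1(2) ne by (auto simp: successively_Cons successively_append_iff)
  show "\<not> adj (g p) (g q)" using A(8)[OF 1(1), of "[]"] A(7) by auto
  show "successively adj (g p # m)" using 1(2) by (metis append_Cons successively_append_iff)
  show "successively adj (m @ [g q])" using 1(2) ne by (cases m) auto
  have "set ws \<subseteq> V" if "successively adj (a # ws)" for a ws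
    using that by (induction ws arbitrary: a) (auto simp: adj_V)
  then show "set (g p # m @ [g q]) \<subseteq> V" using 1(2) V by (metis insert_subset list.set(2))
  show "distinct (g p # m @ [g q])"
  proof (rule ccontr)
    assume "\<not> distinct (g p # m @ [g q])"
    then obtain as v bs cs where d: "g p # m @ [g q] = as @ [v] @ bs @ [v] @ cs"
      using not_distinct_decomp by blast
    define l where "l = as @ v # cs"
    have s: "successively adj l" using 1(2) unfolding d l_def by (auto simp: successively_append_iff successively_Cons)
    have "hd l = hd (g p # m @ [g q])" unfolding d l_def by (cases as) auto
    moreover have "last l = last (g p # m @ [g q])" unfolding d l_def by (cases cs) auto
    ultimately have hl: "hd l = g p" "last l = g q" by simp_all
    have "g p \<noteq> g q" using c A(3-5) unfolding cfg_def inj_on_def by blast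
    then obtain l' where "l = g p # l'" "l' \<noteq> []" using hl unfolding l_def by (cases as; cases cs) auto
    then obtain m' where m': "l = g p # m' @ [g q]" using hl(2) by (metis append_butlast_last_id last.simps)
    then have "N \<le> length m'" using A(8)[OF 1(1)] s by simp
    moreover have "length l < length (g p # m @ [g q])" unfolding d l_def by simp
    ultimately show False using m' 1(3) by simp
  qed
qed

text \<open>Otherwise \<open>p\<close> could step along the shortest path.\<close>
lemma no_hole_between:
  assumes a: "apart f p q N" and m: "closest f p q N g m" and h: "h \<notin> g ` P" "cn (V - {g p, g q}) h v" "v \<in> set m"
  shows False
proof -
  note A = apartD[OF a] and M = closestD[OF a m]
  have mW: "set m \<subseteq> V - {g p, g q}" using M(6,7) by auto
  have "successively adj m" using M(3) by (auto simp: successively_Cons successively_append_iff)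
  then have "cn (V - {g p, g q}) v (hd m)" using con_path2[OF _ mW h(3)] M(5) by simp
  then have "cn (V - {g p, g q}) h (hd m)" using con_trans h(2) by blast
  moreover have "V - {g q} - {g p} = V - {g p, g q}" by blast
  moreover have "g p \<in> V - {g q}" using M(6,10) by auto
  ultimately obtain g' where g': "eqv (V - {g q}) g g'" "g' p = hd m"
    using advance[OF M(2) A(3), of "V - {g q}" h "hd m"] h(1) M(8) by auto
  have "g' q = g q" using eqv_out[OF g'(1)] by simp
  moreover have "m = hd m # tl m" using M(5) by simp
  ultimately have "successively adj (g' p # tl m @ [g' q])" using M(3) g'(2)
    by (metis append_Cons successively.simps(3))
  moreover have "eqv V f g'" using eqv_trans[OF M(1) eqv_mono[OF g'(1)]] by blast
  ultimately have "N \<le> length (tl m)" using A(8) by blast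
  then show False using M(4,5) A(7) by simp
qed

section \<open>Rotations that keep the distance, and a hole on a detour\<close>

lemma between_occupied:
  assumes "apart f p q N" "closest f p q N g m" "v \<in> set m"
  shows "v \<in> g ` P"
proof (rule ccontr)
  assume "v \<notin> g ` P"
  moreover have "v \<in> V - {g p, g q}" using closestD(6,7)[OF assms(1,2)] assms(3) by auto
  ultimately show False using no_hole_between[OF assms(1,2) _ con_refl assms(3)] by blast
qed

text \<open>The pebble \<open>p\<close> steps back to \<open>e\<close>, the hole it leaves travels along the shortest path, and \<open>q\<close> follows.\<close>
lemma rotate:
  assumes a: "apart f p q N" and m: "closest f p q N g m"
    and h: "h \<notin> g ` P" "cn (V - {g p, g q}) h e" "adj (g p) e"
  shows "\<exists>g' h'. (h' = h \<or> h' = e) \<and> h' \<notin> g ` P \<and> closest f p q N g' (g p # butlast m) \<and> g' p = e \<and> g' q = last m \<and>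
    g' ` P = insert h' (g ` P) - {g q}"
proof -
  note A = apartD[OF a] and M = closestD[OF a m]
  let ?x = "g p" and ?y = "g q" and ?z = "last m"
  have hm: "v \<notin> set m" if "cn (V - {?x, ?y}) h v" for v using no_hole_between[OF a m h(1) that] by blast
  have eW: "e \<in> V - {?x, ?y}" "h \<in> V - {?x, ?y}" using con_in[OF h(2)] by blast+
  have em: "e \<notin> set m" "h \<notin> set m" using hm h(2) con_refl[OF eW(2), of adj] by blast+
  have zm: "?z \<in> set m" using M(5) by simp
  have zxy: "?z \<noteq> ?x" "?z \<noteq> ?y" "?x \<noteq> ?y" using M(6) zm by auto
  have "V - {?y} - {?x} = V - {?x, ?y}" by blast
  then obtain g1 h' where g1: "h' = h \<or> h' = e" "h' \<notin> g ` P" "eqv (V - {?y}) g g1" "g1 p = e" "g1 ` P = insert h' (g ` P) - {?x}"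
    using advance[OF M(2) A(3), of "V - {?y}" h e] h M(10) zxy(3) by auto
  have y1: "g1 q = ?y" using eqv_out[OF g1(3)] by simp
  have c1: "cfg g1" using eqv_cfg[OF g1(3) M(2)] .
  have x1: "?x \<notin> g1 ` P" using g1(5) by blast
  have z1: "?z \<in> g1 ` P" using g1(5) between_occupied[OF a m zm] zxy by blast
  have sub: "set (?x # m) \<subseteq> V - {e, ?y}" using M(6,7) em eW by auto
  have "?z \<in> set (?x # m)" using zm by simp
  then have sw: "cn (V - {e, ?y}) ?x ?z" by (rule con_path[OF M(13) sub])
  obtain g2 where g2: "eqv (V - {e, ?y}) g1 g2" "g2 ` P = insert ?x (g1 ` P - {?z})"
    using swap_hole[OF sw c1 x1 z1] by blast
  have pq2: "g2 p = e" "g2 q = ?y" using eqv_out[OF g2(1)] g1(4) y1 by auto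
  have c2: "cfg g2" using eqv_cfg[OF g2(1) c1] .
  have z2: "?z \<notin> g2 ` P" using g2(2) zxy by blast
  have "?z \<in> V" using M(7) zm by auto
  then have e3: "eqv V g2 (g2(q := ?z))"
    using eqv_move[OF A(4), of g2 V ?z] pq2 M(11) adj_sym[OF M(9)] z2 by auto
  define g3 where "g3 = g2(q := ?z)"
  have pq3: "g3 p = e" "g3 q = ?z" using pq2 A(5) unfolding g3_def by auto
  have "g3 ` P = insert ?z (g2 ` P - {?y})" using image_upd[of g2 q ?z] c2 A(4) pq2 unfolding g3_def cfg_def by auto
  also have "\<dots> = insert h' (g ` P) - {?y}"
  proof -
    have "h' \<noteq> ?z" using g1(1) em zm by blast
    moreover have "?x \<in> g ` P" "?z \<in> g ` P" using A(3) between_occupied[OF a m zm] by auto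
    ultimately show ?thesis unfolding g2(2) g1(5) using zxy by auto
  qed
  finally have i3: "g3 ` P = insert h' (g ` P) - {?y}" .
  have e': "eqv V f g3" using eqv_trans[OF eqv_trans[OF eqv_trans[OF M(1) eqv_mono[OF g1(3)]] eqv_mono[OF g2(1)]] e3]
    unfolding g3_def by blast
  have "e # (?x # butlast m) @ [?z] = e # ?x # m" using M(5) by simp
  then have "successively adj (g3 p # (?x # butlast m) @ [g3 q])"
    unfolding pq3 using M(13) adj_sym[OF h(3)] M(5) by simp
  moreover have "length (?x # butlast m) = N" using M(4,5) A(7) by simp
  ultimately have "closest f p q N g3 (?x # butlast m)" unfolding closest_def using e' by blast
  then show ?thesis using g1(1,2) pq3 i3 by blast
qed

text \<open>A hole cut off from \<open>q\<close> by \<open>p\<close> is used for a rotation of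
  \<open>p\<close> towards it. The old position of \<open>q\<close> becomes a hole on the side of
  \<open>q\<close>, and no hole counted before is lost.\<close>

lemma slide:
  assumes a: "apart f p q N" and m: "closest f p q N g m"
    and h: "h \<in> V" "h \<notin> g ` P" "\<not> cn (V - {g p}) h (g q)"
  shows "\<exists>g' m'. closest f p q N g' m' \<and>
    card {v. v \<notin> g ` P \<and> cn (V - {g p}) v (g q)} < card {v. v \<notin> g' ` P \<and> cn (V - {g' p}) v (g' q)}"
proof -
  note A = apartD[OF a] and M = closestD[OF a m]
  let ?x = "g p" and ?y = "g q" and ?z = "last m"
  have "h \<noteq> ?x" using h(2) A(3) by blast
  moreover have "cn V h ?x" using A(1) h(1) M(10) unfolding conn_def by blast
  ultimately obtain e where e: "cn (V - {?x}) h e" "adj e ?x" using con_nbr by blast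
  have "cn (V - {?x} - {?y}) h e" using con_avoid[OF e(1) h(3)] .
  then have c: "cn (V - {?x, ?y}) h e" by (rule con_mono) blast
  obtain g' h' where g': "h' = h \<or> h' = e" "closest f p q N g' (?x # butlast m)" "g' p = e" "g' q = ?z"
    "g' ` P = insert h' (g ` P) - {?y}"
    using rotate[OF a m h(2) c adj_sym[OF e(2)]] by (elim exE conjE) (rule that; assumption)
  note M' = closestD[OF a g'(2)]
  let ?H = "{v. v \<notin> g ` P \<and> cn (V - {?x}) v ?y}" and ?H' = "{v. v \<notin> g' ` P \<and> cn (V - {e}) v ?z}"
  have ney: "\<not> cn (V - {?x}) e ?y" using h(3) con_trans[OF _ e(1)] by blast
  have yz: "?y \<in> V - {e}" "?z \<in> V - {e}"
    using ney con_refl[of ?y "V - {?x}" adj] M(6,11) M'(6,7) g'(3,4) by auto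
  then have cyz: "cn (V - {e}) ?y ?z" using con_edge[OF yz adj_sym[OF M(9)]] by simp
  have "insert ?y ?H \<subseteq> ?H'"
  proof
    fix v assume "v \<in> insert ?y ?H"
    then consider "v = ?y" | "v \<notin> g ` P" "cn (V - {?x}) v ?y" by blast
    then show "v \<in> ?H'"
    proof cases
      case 1
      then show ?thesis using cyz g'(5) by blast
    next
      case 2
      have "v \<noteq> h'" using g'(1) 2(2) h(3) ney by blast
      then have "v \<notin> g' ` P" using g'(5) 2(1) by blast
      moreover have "\<not> cn (V - {?x}) v e" using ney 2(2) con_trans con_sym by blast
      then have "cn (V - {?x} - {e}) v ?y" using con_avoid[OF 2(2)] by blast
      then have "cn (V - {e}) v ?y" by (rule con_mono) blast
      ultimately show ?thesis using con_trans[OF cyz] by blast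
    qed
  qed
  moreover have "?y \<notin> ?H" using A(4) by blast
  moreover have "?H' \<subseteq> V" using con_in[of "V - {e}" _ ?z] by blast
  then have "finite ?H'" using finite_V finite_subset by blast
  ultimately have "card ?H < card ?H'" by (intro psubset_card_mono) auto
  then have "card ?H < card {v. v \<notin> g' ` P \<and> cn (V - {g' p}) v (g' q)}" by (simp only: g'(3,4))
  then show ?thesis by (intro exI conjI) (rule g'(2))
qed

text \<open>Maximize the number of holes connected to \<open>q\<close> off the position of
  \<open>p\<close>; by \<open>slide\<close> a maximum misses no hole.\<close>

lemma all_holes_behind:
  assumes a: "apart f p q N" and m: "closest f p q N g0 m0"
  shows "\<exists>g m. closest f p q N g m \<and> (\<forall>h\<in>V - g ` P. cn (V - {g p}) h (g q))"
proof -
  define c where "c = (\<lambda>(g, m::'a list). card {v. v \<notin> g ` P \<and> cn (V - {g p}) v (g q)})"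
  have bound: "c gm < Suc (card V)" for gm
  proof (cases gm)
    case (Pair g m)
    have "{v. v \<notin> g ` P \<and> cn (V - {g p}) v (g q)} \<subseteq> V" using con_in[of "V - {g p}" _ "g q"] by blast
    then show ?thesis unfolding Pair c_def using card_mono[OF finite_V] by (simp add: less_Suc_eq_le)
  qed
  obtain gm where gm: "case gm of (g, m) \<Rightarrow> closest f p q N g m"
    "\<And>gm'. (case gm' of (g, m) \<Rightarrow> closest f p q N g m) \<Longrightarrow> c gm' \<le> c gm"
    using ex_has_greatest_nat[of "\<lambda>(g, m). closest f p q N g m" "(g0, m0)" c "Suc (card V)"] m bound by auto
  obtain g m where gm': "gm = (g, m)" by force
  have "cn (V - {g p}) h (g q)" if hh: "h \<in> V - g ` P" for h
  proof (rule ccontr)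
    assume "\<not> cn (V - {g p}) h (g q)"
    then obtain g' m' where "closest f p q N g' m'" "c (g, m) < c (g', m')"
      using slide[OF a, of g m h] gm(1) hh unfolding gm' c_def by auto
    then show False using gm(2)[of "(g', m')"] gm' by simp
  qed
  then show ?thesis using gm(1) gm' by auto
qed

text \<open>With all holes behind \<open>q\<close>, the lemma on range boundaries applies to \<open>q\<close> in the graph without the position of \<open>p\<close>.
Unless the position of \<open>p\<close> is adjacent to the resulting isthmus or its far side, this is an isthmus of the whole graph that separates
\<open>p\<close> from \<open>q\<close>.\<close>
lemma star_exists:
  assumes a: "apart f p q N" and m: "closest f p q N g0 m0" and R: "Rng V p f = Rng V q f"
  shows "\<exists>g m h. star f p q N g m h"
proof -
  obtain g m where m: "closest f p q N g m" and H: "\<And>h. h \<in> V - g ` P \<Longrightarrow> cn (V - {g p}) h (g q)"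
    using all_holes_behind[OF a m] by blast
  note A = apartD[OF a] and M = closestD[OF a m]
  let ?x = "g p" and ?y = "g q" and ?z = "last m"
  define S where "S = component (V - {?x}) ?y"
  have SV: "S \<subseteq> V - {?x}" unfolding S_def by (rule component_subset)
  have cS: "conn S" unfolding S_def by (rule conn_comp)
  have xy: "?y \<noteq> ?x" "?z \<noteq> ?x" "?z \<in> V" using M(6,7) last_in_set[OF M(5)] by auto
  have yS: "?y \<in> S" using con_refl[of ?y "V - {?x}" adj] xy M(11) unfolding S_def component_def by blast
  have Sout: "b \<in> S" if "a \<in> S" "adj a b" "b \<noteq> ?x" for a b
    using that con_step[of adj "V - {?x}" ?y a b] adj_V[OF that(2)] unfolding S_def component_def by blast
  have zS: "?z \<in> S" using Sout[OF yS adj_sym[OF M(9)] xy(2)] .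
  have "V - g ` P \<subseteq> S" using H con_sym unfolding S_def component_def by blast
  then have hk: "card (S - g ` P) = card (V - g ` P)" using SV by (intro arg_cong[of _ _ card]) blast
  have hV: "card (V - g ` P) = card (V - f ` P)" using eqv_card[OF M(1) A(2) finite_V] .
  \<comment> \<open>Otherwise \<open>q\<close> would come to \<open>?z\<close> while
    \<open>p\<close> stays, and the distance would drop.\<close>
  have z: "?z \<notin> Rng S q g"
  proof
    assume "?z \<in> Rng S q g"
    then obtain g' where g': "eqv S g g'" "g' q = ?z" by (rule RngE)
    have "g' p = ?x" using eqv_out[OF g'(1)] SV by blast
    moreover have "?x # butlast m @ [?z] = ?x # m" using M(5) by simp
    ultimately have "successively adj (g' p # butlast m @ [g' q])" using M(5,13) g'(2) by simp
    moreover have "eqv V f g'" using eqv_trans[OF M(1) eqv_mono[OF g'(1)]] SV by blast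
    ultimately have "N \<le> length (butlast m)" using A(8) by blast
    then show False using M(4,5) A(7) by simp
  qed
  have SV': "S \<subseteq> V" using SV by blast
  have k1: "1 \<le> card (S - g ` P)" using hk hV A(6) by simp
  obtain D u E where I: "bare_isthmus S D u E" "length u = card (S - g ` P)" "hd u = ?y" "Rng S q g \<inter> E \<noteq> {}"
    "\<And>v. v \<in> E \<union> set (tl u) \<Longrightarrow> \<exists>h\<in>S - g ` P. cn (S - {?y}) v h"
    using range_boundary[OF cS SV' M(2) A(4) yS refl k1 zS adj_sym[OF M(9)] z] by blast
  note ID = bare_isthmusD[OF I(1)] and IE = bare_isthmus_edges[OF I(1)]
  have u: "u = ?y # tl u" using ID(1) I(3) by (cases u) auto
  show ?thesis
  proof (cases "\<exists>v\<in>E \<union> set (tl u). adj ?x v")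
    case True
    \<comment> \<open>The recorded hole \<open>h\<close> reaches the neighbour \<open>v\<close> of
      \<open>p\<close> without meeting \<open>q\<close>; being behind \<open>q\<close>, it also
      reaches a neighbour of \<open>q\<close>. So it lies on a detour.\<close>
    then obtain v where v: "v \<in> E \<union> set (tl u)" "adj ?x v" by blast
    obtain h where h: "h \<in> S" "h \<notin> g ` P" "cn (S - {?y}) v h" using I(5)[OF v(1)] by blast
    have "cn (V - {?x, ?y}) v h" by (rule con_mono[OF h(3)]) (use SV in blast)
    then have "cn (V - {?x, ?y}) h v" by (rule con_sym)
    moreover have "cn (V - {?x}) h ?y" using H h SV' by blast
    moreover have "h \<noteq> ?y" using h(2) A(4) by blast
    ultimately obtain t where t: "cn (V - {?x} - {?y}) h t" "adj t ?y" using con_nbr by blast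
    have "cn (V - {?x, ?y}) h t" by (rule con_mono[OF t(1)]) blast
    then have "star f p q N g m h" unfolding star_def
      using m h(2) v(2) \<open>cn (V - {?x, ?y}) h v\<close> adj_sym[OF t(2)] by blast
    then show ?thesis by blast
  next
    case False
    define X where "X = V - set u - E"
    have uE: "set u \<subseteq> S" "E \<subseteq> S" "set u \<inter> E = {}" using ID(4,6) by blast+
    have xX: "?x \<in> X" using M(10) SV uE unfolding X_def by blast
    have XD: "a = ?x \<or> a \<in> D" if "a \<in> X" "b \<in> S" "adj a b" for a b
      using that Sout[OF that(2) adj_sym[OF that(3)]] ID(4) unfolding X_def by blast
    have "\<not> adj a b" if "a \<in> X" "b \<in> E" for a b
      using XD[OF that(1)] uE(2) that(2) IE(1) False by blast
    moreover have "v = hd u" if "a \<in> X" "v \<in> set u" "adj a v" for a v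
    proof (cases "a = ?x")
      case True
      then have "v \<notin> set (tl u)" using False that(3) by blast
      then show ?thesis using that(2) u by (metis list.sel(1) set_ConsD)
    next
      case False
      then show ?thesis using XD[OF that(1) _ that(3)] uE(1) that(2,3) IE(3) by blast
    qed
    moreover have "X \<union> set u \<union> E = V" "X \<inter> set u = {}" "X \<inter> E = {}" using uE SV' unfolding X_def by blast+
    moreover have "X \<noteq> {}" using xX by blast
    ultimately have J: "bare_isthmus V X u E" using ID(1,2,3,6,9) IE(5,7) unfolding bare_isthmus_def by blast
    obtain PX PY where s: "sided X u E PX PY g" using sided_exists[OF J A(1) M(2)] I(2) hk by auto
    have RR: "Rng V p g = Rng V q g" using R Rng_eqv[OF A(2) M(1)] by simp
    have "Rng S q g \<subseteq> Rng V q g" using eqv_mono[OF _ SV'] unfolding Rng_def by blast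
    \<comment> \<open>The common range contains the position of \<open>p\<close> in \<open>X\<close>
      and, by the boundary lemma for \<open>q\<close>, a vertex of \<open>E\<close>; a pebble of
      either side can reach only one of the two.\<close>
    then have meets: "Rng V p g \<inter> E \<noteq> {}" "Rng V p g \<inter> X \<noteq> {}" using I(4) RR xX Rng_self by blast+
    have "p \<in> PX \<or> p \<in> PY" using sidedD(4)[OF s] A(3) by blast
    then show ?thesis using sided_Rng[OF s, of p] meets bare_isthmusD(5,6,7)[OF J] by blast
  qed
qed

text \<open>After a rotation the hole behind \<open>q\<close> must not be connected to the old position of \<open>p\<close>.\<close>
lemma apart_sep:
  assumes a: "apart f p q N" and m: "closest f p q N g m"
    and h: "h \<notin> g ` P" "cn (V - {g p, g q}) h e" "adj (g p) e"
  shows "\<not> cn (V - {e, last m}) (g p) (g q)"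
proof
  assume c: "cn (V - {e, last m}) (g p) (g q)"
  obtain g' h' where g': "closest f p q N g' (g p # butlast m)" "g' p = e" "g' q = last m" "g' ` P = insert h' (g ` P) - {g q}"
    using rotate[OF a m h] by (elim exE conjE) (rule that; assumption)
  have "g q \<notin> g' ` P" using g'(4) by blast
  then show False using no_hole_between[OF a g'(1), of "g q" "g p"] con_sym[OF c] g'(2,3) by simp
qed

section \<open>Positions around the cycle\<close>

lemma starD:
  assumes "star f p q N g m h"
  shows "closest f p q N g m" "h \<notin> g ` P" "\<exists>e. adj (g p) e \<and> cn (V - {g p, g q}) h e" "\<exists>e. adj (g q) e \<and> cn (V - {g p, g q}) h e"
  using assms unfolding star_def by blast+

text \<open>Of two entrances next to \<open>p\<close> into the component of the hole, one leads to
  \<open>q\<close> avoiding the other. After a rotation through the other, the old positions of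
  \<open>p\<close> and \<open>q\<close> would remain connected, contrary to
  \<open>apart_sep\<close>.\<close>

lemma star_unique:
  assumes a: "apart f p q N" and s: "star f p q N g m h"
    and e: "adj (g p) e1" "cn (V - {g p, g q}) h e1" "adj (g p) e2" "cn (V - {g p, g q}) h e2"
  shows "e1 = e2"
proof (rule ccontr)
  assume ne: "e1 \<noteq> e2"
  note S = starD[OF s] and M = closestD[OF a starD(1)[OF s]]
  let ?W = "V - {g p, g q}" let ?C = "component ?W h"
  obtain e' where e': "adj (g q) e'" "cn ?W h e'" using S(4) by blast
  have zm: "last m \<in> set m" using M(5) by simp
  have zC: "last m \<notin> ?C" using no_hole_between[OF a S(1,2) _ zm] unfolding component_def by blast
  have inC: "e1 \<in> ?C" "e2 \<in> ?C" "e' \<in> ?C" using e e' unfolding component_def by blast+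
  have zxy: "last m \<noteq> g p" "last m \<noteq> g q" using M(6) zm by auto
  have no: False if "adj (g p) c" "adj (g p) b" "b \<in> ?C" "cn (?C - {b}) c e'" for b c
  proof -
    have bW: "b \<in> ?W" using that(3) component_subset by blast
    have "?C - {b} \<subseteq> V - {b, last m}" using component_subset zC by blast
    then have ce: "cn (V - {b, last m}) c e'" using con_mono[OF that(4)] by blast
    have xy: "g p \<in> V - {b, last m}" "g q \<in> V - {b, last m}" using M(10,11) bW zxy by auto
    have "cn (V - {b, last m}) (g p) c" using con_edge[OF xy(1) _ that(1)] con_in[OF ce] by blast
    then have "cn (V - {b, last m}) (g p) e'" using con_trans[OF ce] by blast
    then have "cn (V - {b, last m}) (g p) (g q)" using cn_step[OF _ adj_sym[OF e'(1)] xy(2)] by blast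
    moreover have "cn ?W h b" using that(3) unfolding component_def by blast
    ultimately show False using apart_sep[OF a S(1,2) _ that(2)] by blast
  qed
  have "cn ?C e1 e'" using conn_comp inC unfolding conn_def by blast
  then show False using con_split[OF _ ne inC(2)] no[OF e(1,3) inC(2)] no[OF e(3,1) inC(1)] by blast
qed

text \<open>A common neighbour in the component of the hole would be the inner vertex of a shortest
  path, and a hole would reach it.\<close>

lemma star_ends:
  assumes a: "apart f p q N" and s: "star f p q N g m h"
    and e: "adj (g p) e" "cn (V - {g p, g q}) h e" "adj (g q) e'" "cn (V - {g p, g q}) h e'"
  shows "e \<noteq> e'"
proof
  assume ee: "e = e'"
  note S = starD[OF s] and M = closestD[OF a starD(1)[OF s]] and A = apartD[OF a]
  have p: "successively adj (g p # [e] @ [g q])" using e(1) adj_sym[OF e(3)] ee by simp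
  then have "N \<le> 1" using A(8)[OF M(1) p] by simp
  then have mi: "closest f p q N g [e]" unfolding closest_def using A(7) p M(1) by auto
  show False using no_hole_between[OF a mi S(2) e(2)] by simp
qed

text \<open>The hole left by \<open>q\<close> is again on a detour: through \<open>e'\<close> and
  the rest of the old component it reaches a neighbour of \<open>e\<close>, where \<open>p\<close>
  now stands. So rotations can be iterated.\<close>

lemma star_rotate:
  assumes a: "apart f p q N" and s: "star f p q N g m h" and e: "adj (g p) e" "cn (V - {g p, g q}) h e"
  shows "\<exists>g' h'. (h' = h \<or> h' = e) \<and> star f p q N g' (g p # butlast m) (g q) \<and> g' p = e \<and> g' q = last m \<and>
    g' ` P = insert h' (g ` P) - {g q}"
proof -
  note S = starD[OF s] and M = closestD[OF a starD(1)[OF s]]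
  let ?W = "V - {g p, g q}" and ?z = "last m"
  obtain g' h' where g': "h' = h \<or> h' = e" "closest f p q N g' (g p # butlast m)" "g' p = e" "g' q = ?z"
    "g' ` P = insert h' (g ` P) - {g q}"
    using rotate[OF a S(1,2) e(2,1)] by (elim exE conjE) (rule that; assumption)
  obtain e' where e': "adj (g q) e'" "cn ?W h e'" using S(4) by blast
  have ee: "e' \<noteq> e" using star_ends[OF a s e e'] by blast
  have zm: "?z \<in> set m" using M(5) by simp
  have zC: "\<not> cn ?W h ?z" using no_hole_between[OF a S(1,2) _ zm] by blast
  have "cn ?W e' e" using con_trans[OF e(2) con_sym[OF e'(2)]] .
  then obtain t where t: "cn (?W - {e}) e' t" "adj t e" using con_nbr ee by blast
  have "\<not> cn (?W - {e}) e' ?z"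
  proof
    assume "cn (?W - {e}) e' ?z"
    then have "cn ?W e' ?z" by (rule con_mono) blast
    then show False using zC con_trans[OF _ e'(2)] by blast
  qed
  then have "cn (?W - {e} - {?z}) e' t" using con_avoid[OF t(1)] by blast
  then have t': "cn (V - {e, ?z}) e' t" by (rule con_mono) blast
  have y: "g q \<in> V - {e, ?z}" using M(6,11) zm con_in[OF e(2)] by auto
  have "cn (V - {e, ?z}) (g q) e'" using con_edge[OF y _ e'(1)] con_in[OF t'] by blast
  then have "cn (V - {e, ?z}) (g q) t" using con_trans[OF t'] by blast
  moreover have "g q \<notin> g' ` P" using g'(5) by blast
  ultimately have "star f p q N g' (g p # butlast m) (g q)"
    unfolding star_def g'(3,4) using g'(2) adj_sym[OF t(2)] M(9) con_refl[OF y, of adj] by blast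
  then show ?thesis using g' by blast
qed

text \<open>Exchanging the roles of \<open>p\<close> and \<open>q\<close> reverses the sense of
  rotation.\<close>

lemma star_rotate_back:
  assumes a: "apart f p q N" and s: "star f p q N g m h" and e: "adj (g q) e" "cn (V - {g p, g q}) h e"
  shows "\<exists>g' h'. (h' = h \<or> h' = e) \<and> star f p q N g' (tl m @ [g q]) (g p) \<and> g' q = e \<and> g' p = hd m \<and>
    g' ` P = insert h' (g ` P) - {g p}"
proof -
  have c: "cn (V - {g q, g p}) h e" using e(2) by (simp add: insert_commute)
  have ne: "m \<noteq> []" using closestD(5)[OF a starD(1)[OF s]] .
  obtain g' h' where g': "h' = h \<or> h' = e" "star f q p N g' (g q # butlast (rev m)) (g p)" "g' q = e" "g' p = last (rev m)"
    "g' ` P = insert h' (g ` P) - {g p}"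
    using star_rotate[OF apart_swap[OF a] star_swap[OF s] e(1) c] by (elim exE conjE) (rule that; assumption)
  have "rev (g q # butlast (rev m)) = tl m @ [g q]" using ne by (simp add: butlast_rev)
  then have "star f p q N g' (tl m @ [g q]) (g p)" using star_swap[OF g'(2)] by metis
  then show ?thesis using g' ne by (auto simp: last_rev)
qed

text \<open>With \<open>p\<close> parked in the side branch at \<open>z\<close>, two holes near \<open>x\<close> bring \<open>p\<close> one step closer to \<open>q\<close>.\<close>
lemma no_return:
  assumes a: "apart f p q N" and m: "successively adj (x # m @ [y])" "distinct (x # m @ [y])" "length m = N" "set (x # m @ [y]) \<subseteq> V"
    and z: "z \<notin> set (x # m @ [y])" "adj z x"
    and g: "eqv V f g" "g p = z" "g q = y"
    and h: "h1 \<noteq> h2" "h1 \<notin> g ` P" "h2 \<notin> g ` P" "cn (V - {z, y}) h1 x" "cn (V - {z, y}) h2 x"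
  shows False
proof -
  note A = apartD[OF a]
  have ne: "m \<noteq> []" using m(3) A(7) by auto
  let ?C = "component (V - {z, y}) x"
  have cg: "cfg g" using eqv_cfg[OF g(1) A(2)] .
  have CV: "?C \<subseteq> V - {z, y}" by (rule component_subset)
  have hC: "h1 \<in> ?C" "h2 \<in> ?C" using con_sym[OF h(4)] con_sym[OF h(5)] unfolding component_def by blast+
  have x: "x \<in> ?C" using con_refl[of x "V - {z, y}" adj] con_in[OF h(4)] unfolding component_def by blast
  have xm: "adj x (hd m)" using m(1) ne by (auto simp: successively_Cons successively_append_iff)
  have hm: "hd m \<in> set m" using ne by simp
  have "hd m \<in> V - {z, y}" using m(2,4) z(1) hm by auto
  then have "hd m \<in> ?C" using x con_step[of adj "V - {z, y}" x x "hd m"] xm unfolding component_def by blast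
  moreover have "card {h1, h2} \<le> card (?C - g ` P)"
    using finite_subset[OF CV] finite_V h hC by (intro card_mono) auto
  moreover have "?C \<subseteq> V" "g p \<notin> ?C" using CV g(2) by blast+
  moreover have "x \<noteq> hd m" using m(2) hm by auto
  ultimately obtain g' where g': "eqv (insert (g p) ?C) g g'" "g' p = hd m"
    using push[OF cg A(3) conn_comp, of "V - {z, y}" x "[x, hd m]"] x xm z(2) g(2) h(1) by auto
  have "g q \<notin> insert (g p) ?C" using g z(1) CV by auto
  then have "g' q = y" using eqv_out[OF g'(1)] g(3) by metis
  moreover have "m = hd m # tl m" using ne by simp
  ultimately have "successively adj (g' p # tl m @ [g' q])" using m(1) g'(2)
    by (metis append_Cons successively.simps(3))
  moreover have "z \<in> V" using cg A(3) g(2) unfolding cfg_def by blast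
  then have "eqv V f g'" using eqv_trans[OF g(1) eqv_mono[OF g'(1)]] CV g(2) by blast
  ultimately have "N \<le> length (tl m)" using A(8) by blast
  then show False using m(3) ne A(7) by simp
qed

text \<open>With a hole in the branch, \<open>p\<close> could step to \<open>z\<close>; its old
  position and \<open>h\<close> would then be the two holes that \<open>no_return\<close>
  forbids.\<close>

lemma no_hole_in_branch:
  assumes a: "apart f p q N" and s: "star f p q N g m h"
    and z: "adj (g p) z" "\<And>c. adj (g q) c \<Longrightarrow> \<not> cn (V - {g p, g q}) z c"
    and l: "l \<notin> g ` P" "cn (V - {g p, g q}) l z"
  shows False
proof -
  note S = starD[OF s] and M = closestD[OF a starD(1)[OF s]] and A = apartD[OF a]
  let ?x = "g p" and ?y = "g q" and ?W = "V - {g p, g q}"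
  obtain e where e: "adj ?x e" "cn ?W h e" using S(3) by blast
  obtain e' where e': "adj ?y e'" "cn ?W h e'" using S(4) by blast
  have hz: "\<not> cn ?W h z" using z(2)[OF e'(1)] con_trans[OF e'(2)] con_sym by blast
  have "?W = V - {?y} - {?x}" by blast
  then obtain g' h' where g': "h' = l \<or> h' = z" "eqv (V - {?y}) g g'" "g' p = z" "g' ` P = insert h' (g ` P) - {?x}"
    using advance[OF M(2) A(3), of "V - {?y}" l z] l z(1) M(6,10) by auto
  have y': "g' q = ?y" using eqv_out[OF g'(2)] by simp
  have zW: "z \<in> ?W" using con_in[OF l(2)] by blast
  have "h \<noteq> h'" using g'(1) hz l(2) con_refl[OF zW, of adj] by blast
  then have hh: "h \<notin> g' ` P" "?x \<notin> g' ` P" "h \<noteq> ?x" using g'(4) S(2) A(3) by auto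
  have "cn (?W - {z}) h e" using con_avoid[OF e(2) hz] .
  then have he: "cn (V - {z, ?y}) h e" by (rule con_mono) blast
  have xV: "?x \<in> V - {z, ?y}" using M(6,10) zW by auto
  have "cn (V - {z, ?y}) h ?x" using cn_step[OF he adj_sym[OF e(1)] xV] .
  moreover have "z \<notin> set (?x # m @ [?y])"
  proof -
    have "z \<notin> set m" using no_hole_between[OF a S(1) l] by blast
    then show ?thesis using zW by auto
  qed
  moreover have "eqv V f g'" using eqv_trans[OF M(1) eqv_mono[OF g'(2)]] by blast
  ultimately show False
    using no_return[OF a M(3,6,4,7) _ adj_sym[OF z(1)] _ g'(3) y' hh(3,1,2)] con_refl[OF xV, of adj] by blast
qed

text \<open>Holes can enter the branch only through the position of \<open>p\<close>. So a backward
  rotation takes \<open>p\<close> out of the way, a hole is sent into the branch, \<open>p\<close>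
  follows to \<open>z\<close>, and \<open>q\<close> returns. This is again the situation of
  \<open>no_return\<close>.\<close>

lemma no_branch:
  assumes a: "apart f p q N" and s: "star f p q N g m h"
    and z: "adj (g p) z" "\<And>c. adj (g q) c \<Longrightarrow> \<not> cn (V - {g p, g q}) z c"
    and k: "2 \<le> card (V - g ` P)"
  shows False
proof -
  note S = starD[OF s] and M = closestD[OF a starD(1)[OF s]] and A = apartD[OF a]
  let ?x = "g p" and ?y = "g q" and ?W = "V - {g p, g q}"
  obtain e where e: "adj ?x e" "cn ?W h e" using S(3) by blast
  obtain e' where e': "adj ?y e'" "cn ?W h e'" using S(4) by blast
  have ee: "e \<noteq> e'" using star_ends[OF a s e e'] .
  have zW: "z \<in> ?W" using adj_V[OF z(1)] z(1) M(12) adj_irrefl by auto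
  have hz: "\<not> cn ?W h z" using z(2)[OF e'(1)] con_trans[OF e'(2)] con_sym by blast
  have "V - g ` P \<noteq> {h}" using k by auto
  moreover have "V - g ` P \<noteq> {}" using k by (metis card.empty not_numeral_le_zero)
  ultimately obtain l where l: "l \<in> V" "l \<notin> g ` P" "l \<noteq> h" by blast
  have lxy: "l \<notin> {?x, ?y}" using l(2) A(3,4) by blast
  have "cn V l ?x" using A(1) l(1) M(10) unfolding conn_def by blast
  moreover have "\<not> cn ?W l ?x" using con_in[of ?W l ?x] by blast
  ultimately obtain t b where t: "cn ?W l t" "b = ?x \<or> b = ?y" "adj t b" using con_hit[OF _ lxy] by blast
  have both: "\<exists>a1 c1. adj ?x a1 \<and> cn ?W l a1 \<and> adj ?y c1 \<and> cn ?W l c1"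
  proof (cases "b = ?x")
    case True
    then have "adj ?x t" using adj_sym[OF t(3)] by simp
    moreover obtain c where "adj ?y c" "cn ?W t c" using no_hole_in_branch[OF a s \<open>adj ?x t\<close> _ l(2) t(1)] by blast
    ultimately show ?thesis using t(1) con_trans[OF _ t(1)] by blast
  next
    case False
    then have ty: "adj ?y t" using adj_sym[OF t(3)] t(2) by simp
    have t': "cn (V - {?y, ?x}) l t" using t(1) by (simp add: insert_commute)
    obtain c where "adj ?x c" "cn (V - {?y, ?x}) t c"
      using no_hole_in_branch[OF apart_swap[OF a] star_swap[OF s] ty _ l(2) t'] by blast
    then have "adj ?x c" "cn ?W t c" by (simp_all add: insert_commute)
    then show ?thesis using ty t(1) con_trans[OF _ t(1)] by blast
  qed
  then obtain a1 c1 where ac: "adj ?x a1" "cn ?W l a1" "adj ?y c1" "cn ?W l c1" by blast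
  have zm: "last m \<in> set m" using M(5) by simp
  have zxy: "last m \<noteq> ?x" "last m \<noteq> ?y" using M(6) zm by auto
  \<comment> \<open>A second component touching both \<open>p\<close> and \<open>q\<close> would
    keep their positions connected after a rotation through \<open>e\<close>.\<close>
  have lh: "cn ?W l h"
  proof (rule ccontr)
    assume n: "\<not> cn ?W l h"
    have nz: "\<not> cn ?W l (last m)" using no_hole_between[OF a S(1) l(2) _ zm] by blast
    have ne: "\<not> cn ?W l e" using n con_trans[OF con_sym[OF e(2)]] by blast
    have sub: "component ?W l \<subseteq> V - {e, last m}" using component_subset[of ?W l] nz ne unfolding component_def by blast
    have "cn (component ?W l) a1 c1" using conn_comp ac(2,4) unfolding conn_def component_def by blast
    then have c: "cn (V - {e, last m}) a1 c1" using con_mono sub by blast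
    have "e \<in> ?W" using con_in[OF e(2)] by blast
    then have xy: "?x \<in> V - {e, last m}" "?y \<in> V - {e, last m}" using M(10,11) zxy by auto
    have "cn (V - {e, last m}) ?x a1" using con_edge[OF xy(1) _ ac(1)] con_in[OF c] by blast
    then have "cn (V - {e, last m}) ?x c1" using con_trans[OF c] by blast
    then have "cn (V - {e, last m}) ?x ?y" using cn_step[OF _ adj_sym[OF ac(3)] xy(2)] by blast
    then show False using apart_sep[OF a S(1,2) e(2,1)] by blast
  qed
  let ?C = "component ?W h"
  have CW: "?C \<subseteq> ?W" by (rule component_subset)
  have finC: "finite ?C" using finite_subset[OF CW] finite_V by blast
  have hW: "h \<in> ?W" using con_in[OF e(2)] by blast
  have "{h, l} \<subseteq> ?C - g ` P" using con_sym[OF lh] con_refl[OF hW, of adj] S(2) l(2) unfolding component_def by blast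
  then have "card {h, l} \<le> card (?C - g ` P)" using finC by (intro card_mono) auto
  \<comment> \<open>The hole at \<open>e'\<close> lets \<open>q\<close> give way; the one at
    \<open>e\<close> is later available for the branch.\<close>
  then have "card {e, e'} \<le> card (?C - g ` P)" using l(3) ee by simp
  moreover have "{e, e'} \<subseteq> ?C" using e e' unfolding component_def by blast
  ultimately obtain g1 where g1: "eqv ?C g g1" "{e, e'} \<inter> g1 ` P = {}" using clear[OF conn_comp finC M(2)] by blast
  have pq1: "g1 p = ?x" "g1 q = ?y" using eqv_out[OF g1(1)] CW by blast+
  have "eqv V g g1" by (rule eqv_mono[OF g1(1)]) (use CW in blast)
  then have e1: "eqv V f g1" using eqv_trans[OF M(1)] by blast
  have ee': "cn ?W e' e" using con_trans[OF e(2) con_sym[OF e'(2)]] .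
  have e'W: "e' \<in> ?W" "e \<in> ?W" using con_in[OF ee'] by blast+
  have s1: "star f p q N g1 m e'"
    unfolding star_def closest_def pq1 using e1 M(3,4) g1(2) e(1) ee' e'(1) con_refl[OF e'W(1), of adj] by blast
  have em: "e \<notin> set m" "e' \<notin> set m" using no_hole_between[OF a S(1,2)] e(2) e'(2) by blast+
  obtain g2 h2 where g2: "h2 = e'" "star f p q N g2 (tl m @ [?y]) ?x" "g2 q = e'" "g2 p = hd m"
    "g2 ` P = insert h2 (g1 ` P) - {?x}"
    using star_rotate_back[OF a s1, of e'] e'(1) con_refl[OF e'W(1), of adj] pq1 by auto
  note M2 = closestD[OF a starD(1)[OF g2(2)]]
  have hm: "hd m \<in> set m" using M(5) by simp
  have zm': "z \<notin> set m"
  proof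
    assume "z \<in> set m"
    have "successively adj m" using M(3) by (auto simp: successively_Cons successively_append_iff)
    moreover have "set m \<subseteq> ?W" using M(6,7) by auto
    ultimately have "cn ?W z (last m)" using con_path2 \<open>z \<in> set m\<close> zm by blast
    then show False using z(2)[OF adj_sym[OF M(9)]] by blast
  qed
  have ze: "z \<noteq> e" "z \<noteq> e'" using hz e(2) e'(2) by blast+
  let ?D = "component (V - {hd m, e'}) ?x"
  have DV: "?D \<subseteq> V - {hd m, e'}" by (rule component_subset)
  have xD': "?x \<in> V - {hd m, e'}" using M(6,10) hm e'W by auto
  have xD: "?x \<in> ?D" using con_refl[OF xD', of adj] unfolding component_def by blast
  have nb: "v \<in> ?D" if "adj ?x v" "v \<in> V - {hd m, e'}" for v
    using con_edge[OF xD' that(2,1)] unfolding component_def by blast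
  have "e \<noteq> hd m" "z \<noteq> hd m" using em hm zm' by blast+
  then have zD: "z \<in> ?D" "e \<in> ?D" using nb[OF z(1)] nb[OF e(1)] zW e'W(2) ze ee by auto
  have x2: "?x \<notin> g2 ` P" "e \<notin> g2 ` P" using g2(1,5) g1(2) ee by auto
  have "card {?x, e} \<le> card (?D - g2 ` P)"
    using finite_subset[OF DV] finite_V x2 xD zD by (intro card_mono) auto
  moreover have "?x \<noteq> e" "?x \<noteq> z" using e(1) z(1) adj_irrefl by metis+
  moreover have "?D \<subseteq> V" "g2 p \<notin> ?D" using DV g2(4) by blast+
  moreover have "successively adj (g2 p # [?x, z])" using g2(4) adj_sym[OF M(8)] z(1) by simp
  ultimately obtain g3 where g3: "eqv (insert (g2 p) ?D) g2 g3" "g3 p = z" "set [g2 p, ?x] \<inter> g3 ` P = {}"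
    using push[OF M2(2) A(3) conn_comp, of "V - {hd m, e'}" ?x "[?x, z]"] xD zD by auto
  have x3: "?x \<notin> g3 ` P" "hd m \<notin> g3 ` P" using g3(3) g2(4) by auto
  have "e' \<noteq> hd m" using em hm by blast
  then have q3: "g3 q = e'" using eqv_out[OF g3(1), of q] g2(3,4) DV by auto
  have hV: "hd m \<in> V" using M(7) hm by auto
  have "insert (g2 p) ?D \<subseteq> V" using DV g2(4) hV by auto
  then have e3: "eqv V f g3" using eqv_trans[OF M2(1) eqv_mono[OF g3(1)]] by blast
  \<comment> \<open>The hole left by \<open>p\<close> at \<open>hd m\<close> can run along the old
    shortest path to \<open>?y\<close>, so that \<open>q\<close> returns there; \<open>?x\<close>
    and \<open>e'\<close> are then empty.\<close>
  have "successively adj (m @ [?y])" using M(14) .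
  moreover have "set (m @ [?y]) \<subseteq> V - {z} - {e'}" using M(7,11) zm' zW em(2) e'W(1) by auto
  ultimately have "cn (V - {z} - {e'}) (hd m) ?y" using con_path2[of "m @ [?y]"] hm by auto
  moreover have "e' \<in> V - {z}" using e'W(1) ze by auto
  ultimately obtain g4 h4 where g4: "h4 = hd m \<or> h4 = ?y" "eqv (V - {z}) g3 g4" "g4 q = ?y" "g4 ` P = insert h4 (g3 ` P) - {e'}"
    using advance[OF eqv_cfg[OF e3 A(2)] A(4), of "V - {z}" "hd m" ?y] q3 x3(2) adj_sym[OF e'(1)] by auto
  have p4: "g4 p = z" using eqv_out[OF g4(2), of p] g3(2) by simp
  have "?x \<noteq> hd m" "?x \<noteq> ?y" using M(6) hm by auto
  then have h4: "?x \<notin> g4 ` P" "e' \<notin> g4 ` P" using g4(1,4) x3 by auto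
  have e4: "eqv V f g4" using eqv_trans[OF e3 eqv_mono[OF g4(2)]] by blast
  have xz: "?x \<in> V - {z, ?y}" using M(6,10) zW by auto
  have "\<not> cn ?W e' z" using hz con_trans[OF _ e'(2)] by blast
  then have "cn (?W - {z}) e' e" using con_avoid[OF ee'] by blast
  then have "cn (V - {z, ?y}) e' e" by (rule con_mono) blast
  then have "cn (V - {z, ?y}) e' ?x" using cn_step[OF _ adj_sym[OF e(1)] xz] by blast
  moreover have "z \<notin> set (?x # m @ [?y])" using zW zm' by auto
  moreover have "e' \<noteq> ?x" using e'W by blast
  ultimately show False
    using no_return[OF a M(3,6,4,7) _ adj_sym[OF z(1)] e4 p4 g4(3), of e' ?x] h4 con_refl[OF xz, of adj] by blast
qed

text \<open>A further neighbour \<open>z\<close> is either connected to \<open>q\<close> off both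
  positions, which a backward rotation refutes, or opens a side branch. With two holes
  \<open>no_branch\<close> applies. With one hole the position of \<open>p\<close> is a bare
  isthmus, and the range of \<open>p\<close> would meet both of its sides.\<close>

lemma star_neighbours:
  assumes a: "apart f p q N" and s: "star f p q N g m h"
    and z: "adj (g p) z" "z \<in> Rng V p f" "\<not> cn (V - {g p, g q}) h z"
  shows "z = hd m"
proof (rule ccontr)
  assume zx': "z \<noteq> hd m"
  note S = starD[OF s] and M = closestD[OF a starD(1)[OF s]] and A = apartD[OF a]
  let ?x = "g p" and ?y = "g q" and ?W = "V - {g p, g q}"
  obtain e where e: "adj ?x e" "cn ?W h e" using S(3) by blast
  obtain e' where e': "adj ?y e'" "cn ?W h e'" using S(4) by blast
  have zW: "z \<in> ?W" using adj_V[OF z(1)] z(1) M(12) adj_irrefl by auto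
  have hm: "hd m \<in> set m" using M(5) by simp
  have eW: "e \<in> ?W" "e' \<in> ?W" using con_in[OF e(2)] con_in[OF e'(2)] by blast+
  have branch: "\<not> cn ?W z c" if c: "adj ?y c" for c
  proof
    assume zc: "cn ?W z c"
    obtain g2 where g2: "star f p q N g2 (tl m @ [?y]) ?x" "g2 q = e'" "g2 p = hd m"
      using star_rotate_back[OF a s e'] by (elim exE conjE) (rule that; assumption)
    let ?U = "V - {hd m, e'}"
    have sep: "\<not> cn ?U ?y ?x"
      using apart_sep[OF apart_swap[OF a] closest_swap[OF S(1)] S(2), of e'] e' M(5)
      by (simp add: insert_commute last_rev)
    have xyU: "?x \<in> ?U" "?y \<in> ?U" using M(6,10,11) hm eW by auto
    have "\<not> cn ?W z e'" using z(3) con_trans[OF con_sym] e'(2) con_sym con_trans by blast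
    then have "cn (?W - {e'}) z c" using con_avoid[OF zc] by blast
    \<comment> \<open>In the rotated configuration the walk from \<open>z\<close> either joins the
      old positions of \<open>p\<close> and \<open>q\<close>, or gives \<open>hd m\<close> a second
      neighbour besides \<open>?x\<close> that is connected to the hole.\<close>
    then consider "cn (?W - {e'} - {hd m}) z c" | t where "cn (?W - {e'} - {hd m}) z t" "adj t (hd m)"
      using con_hit[of "?W - {e'}" z c "{hd m}"] zx' by blast
    then show False
    proof cases
      case 1
      then have zc': "cn ?U z c" by (rule con_mono) blast
      have "cn ?U ?x z" using con_edge[OF xyU(1) _ z(1)] con_in[OF zc'] by blast
      then have "cn ?U ?x c" using con_trans[OF zc'] by blast
      then have "cn ?U ?x ?y" using cn_step[OF _ adj_sym[OF c] xyU(2)] by blast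
      then show False using sep con_sym by blast
    next
      case 2
      have tx: "t \<noteq> ?x" using con_in[OF 2(1)] by blast
      have zt: "cn ?U z t" by (rule con_mono[OF 2(1)]) blast
      have "cn ?U ?x z" using con_edge[OF xyU(1) _ z(1)] con_in[OF zt] by blast
      then have "cn ?U ?x t" using con_trans[OF zt] by blast
      moreover have "cn ?U ?x ?x" using con_refl[OF xyU(1)] .
      ultimately show False
        using star_unique[OF a g2(1), of t ?x] adj_sym[OF 2(2)] adj_sym[OF M(8)] g2(2,3) tx by simp
    qed
  qed
  have kk: "1 \<le> card (V - g ` P)" using eqv_card[OF M(1) A(2) finite_V] A(6) by simp
  show False
  proof (cases "2 \<le> card (V - g ` P)")
    case True
    then show False using no_branch[OF a s z(1) branch] by blast
  next
    case False
    then have k1: "card (V - g ` P) = 1" using kk by simp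
    define X where "X = component ?W z"
    define Y where "Y = V - X - {?x}"
    have XW: "X \<subseteq> ?W" unfolding X_def by (rule component_subset)
    have zX: "z \<in> X" using con_refl[OF zW, of adj] unfolding X_def component_def by blast
    have yY: "?y \<in> Y" using XW M(6,11) unfolding Y_def by auto
    have XY: "\<not> adj b c" if "b \<in> X" "c \<in> Y" for b c
    proof
      assume bc: "adj b c"
      have zb: "cn ?W z b" using that(1) unfolding X_def component_def by blast
      show False
      proof (cases "c = ?y")
        case True
        then show False using branch[OF adj_sym] bc zb by blast
      next
        case False
        then have "c \<in> ?W" using that(2) unfolding Y_def by blast
        then have "cn ?W z c" using cn_step[OF zb bc] by blast
        then show False using that(2) unfolding Y_def X_def component_def by blast
      qed
    qed
    have "X \<union> set [?x] \<union> Y = V" "X \<inter> set [?x] = {}" "Y \<inter> set [?x] = {}" "X \<inter> Y = {}"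
      using XW M(10) unfolding Y_def by auto
    then have I: "bare_isthmus V X [?x] Y" unfolding bare_isthmus_def using XY zX yY by auto
    then obtain PX PY where sd: "sided X [?x] Y PX PY g" using sided_exists[OF _ A(1) M(2)] k1 by fastforce
    obtain g' where g': "star f p q N g' (?x # butlast m) ?y" "g' p = e" using star_rotate[OF a s e] by (elim exE conjE) (rule that; assumption)
    have "e \<in> Rng V p f" using RngI[OF closestD(1)[OF a starD(1)[OF g'(1)]], of p] g'(2) by simp
    then have "e \<in> Rng V p g" "z \<in> Rng V p g" using z(2) Rng_eqv[OF A(2) M(1)] by auto
    moreover have "e \<in> Y"
    proof -
      have "\<not> cn ?W z e" using z(3) e(2) con_sym con_trans by blast
      then show ?thesis using eW unfolding Y_def X_def component_def by blast
    qed
    moreover have "p \<in> PX \<or> p \<in> PY" using sidedD(4)[OF sd] A(3) by blast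
    ultimately show False using sided_Rng[OF sd, of p] zX bare_isthmusD(5,6,7)[OF I] by blast
  qed
qed

text \<open>The positions of \<open>p\<close> in the configurations \<open>star\<close> are closed under taking neighbours in the range, so they exhaust it.\<close>
lemma two_neighbours:
  assumes a: "apart f p q N" and m: "closest f p q N g0 m0" and R: "Rng V p f = Rng V q f" and x: "x \<in> Rng V p f"
  shows "\<exists>b c. b \<noteq> c \<and> {v \<in> Rng V p f. adj x v} = {b, c}"
proof -
  note A = apartD[OF a]
  define M where "M = {g p | g. \<exists>m h. star f p q N g m h}"
  have MI: "g p \<in> M" if "star f p q N g m h" for g m h using that unfolding M_def by blast
  have nb: "\<exists>b c. b \<noteq> c \<and> b \<in> M \<and> c \<in> M \<and> {v \<in> Rng V p f. adj v' v} = {b, c}" if vM: "v' \<in> M" for v'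
  proof -
    obtain g m h where s: "star f p q N g m h" "v' = g p" using vM unfolding M_def by blast
    note S = starD[OF s(1)] and Mi = closestD[OF a starD(1)[OF s(1)]]
    obtain e where e: "adj (g p) e" "cn (V - {g p, g q}) h e" using S(3) by blast
    obtain e' where e': "adj (g q) e'" "cn (V - {g p, g q}) h e'" using S(4) by blast
    obtain g1 where g1: "star f p q N g1 (g p # butlast m) (g q)" "g1 p = e" using star_rotate[OF a s(1) e] by (elim exE conjE) (rule that; assumption)
    obtain g2 where g2: "star f p q N g2 (tl m @ [g q]) (g p)" "g2 p = hd m" using star_rotate_back[OF a s(1) e'] by (elim exE conjE) (rule that; assumption)
    have inM: "e \<in> M" "hd m \<in> M" using MI[OF g1(1)] MI[OF g2(1)] g1(2) g2(2) by simp_all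
    have MR: "e \<in> Rng V p f" "hd m \<in> Rng V p f"
      using RngI[OF closestD(1)[OF a starD(1)[OF g1(1)]], of p] RngI[OF closestD(1)[OF a starD(1)[OF g2(1)]], of p] g1(2) g2(2) by simp_all
    have "hd m \<in> set m" using Mi(5) by simp
    then have "hd m \<noteq> e" using no_hole_between[OF a S(1,2) e(2)] by blast
    moreover have "{v \<in> Rng V p f. adj v' v} = {hd m, e}"
    proof
      show "{hd m, e} \<subseteq> {v \<in> Rng V p f. adj v' v}" using MR e(1) Mi(8) s(2) by blast
      show "{v \<in> Rng V p f. adj v' v} \<subseteq> {hd m, e}"
      proof
        fix z assume "z \<in> {v \<in> Rng V p f. adj v' v}"
        then have z: "z \<in> Rng V p f" "adj (g p) z" using s(2) by auto
        show "z \<in> {hd m, e}"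
        proof (cases "cn (V - {g p, g q}) h z")
          case True
          then show ?thesis using star_unique[OF a s(1) e z(2)] by simp
        next
          case False
          then show ?thesis using star_neighbours[OF a s(1) z(2,1)] by simp
        qed
      qed
    qed
    ultimately show ?thesis using inM by blast
  qed
  obtain g1 m1 h1 where s1: "star f p q N g1 m1 h1" using star_exists[OF a m R] by blast
  have fg1: "eqv V f g1" using closestD(1)[OF a starD(1)[OF s1]] .
  obtain g where g: "eqv V f g" "g p = x" using x by (rule RngE)
  have "eqv V g1 g" using eqv_trans[OF eqv_sym[OF fg1 A(2)] g(1)] .
  then have "g p \<in> M"
  proof (induction rule: eqv_induct)
    case refl
    show ?case by (rule MI[OF s1])
  next
    case (step g h)
    then obtain r b where r: "adj (g r) b" "h = g(r := b)" unfolding step_def by blast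
    show ?case
    proof (cases "r = p")
      case True
      have "eqv V f h" using eqv_trans[OF fg1 eqv_step[OF step(1,2)]] .
      then have "b \<in> Rng V p f" using RngI[of V f h p] r(2) True by simp
      then have b: "b \<in> {v \<in> Rng V p f. adj (g p) v}" using r(1) True by blast
      obtain b1 c1 where bc: "b1 \<in> M" "c1 \<in> M" "{v \<in> Rng V p f. adj (g p) v} = {b1, c1}"
        using nb[OF step(3)] by (elim exE conjE) (rule that; assumption)
      have "b \<in> {b1, c1}" using b unfolding bc(3) .
      then have "b \<in> M" using bc(1,2) by blast
      then show ?thesis using r(2) True by simp
    qed (use step r in auto)
  qed
  then show ?thesis using nb[of x] g(2) by blast
qed

lemma successively_nth: "successively adj w \<Longrightarrow> Suc i < length w \<Longrightarrow> adj (w ! i) (w ! Suc i)"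
  by (simp add: successively_conv_nth)

end

section \<open>Ranges that are cycles\<close>

definition cyclic_succ :: "'a list \<Rightarrow> ('a \<times> 'a) set" where
  "cyclic_succ w = {(w ! i, w ! (Suc i mod length w)) | i. i < length w}"

lemma cyclic_succ_unique:
  assumes "distinct w"
  shows "(b, x) \<in> cyclic_succ w \<Longrightarrow> (b, y) \<in> cyclic_succ w \<Longrightarrow> x = y"
    "(x, b) \<in> cyclic_succ w \<Longrightarrow> (y, b) \<in> cyclic_succ w \<Longrightarrow> x = y"
proof -
  show "(b, x) \<in> cyclic_succ w \<Longrightarrow> (b, y) \<in> cyclic_succ w \<Longrightarrow> x = y"
    using assms unfolding cyclic_succ_def by (auto simp: nth_eq_iff_index_eq)
  have inj: "i = j" if "i < n" "j < n" "Suc i mod n = Suc j mod n" for i j n :: nat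
    using that by (simp add: mod_Suc split: if_splits)
  show "x = y" if xy: "(x, b) \<in> cyclic_succ w" "(y, b) \<in> cyclic_succ w"
  proof -
    obtain i j where ij: "i < length w" "x = w ! i" "b = w ! (Suc i mod length w)"
      "j < length w" "y = w ! j" "b = w ! (Suc j mod length w)"
      using xy unfolding cyclic_succ_def by blast
    then have "Suc i mod length w < length w" "Suc j mod length w < length w" by (metis gr_implies_not0 mod_less_divisor neq0_conv)+
    then have "Suc i mod length w = Suc j mod length w" using nth_eq_iff_index_eq[OF assms] ij(3,6) by metis
    then show ?thesis using inj ij by blast
  qed
qed

context pebbling
begin

section \<open>From two neighbours everywhere to a cycle\<close>

lemma Rng_conn: "a \<in> Rng V p f \<Longrightarrow> cn (Rng V p f) (f p) a"
proof (elim RngE)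
  fix g assume g: "eqv V f g" "g p = a"
  have "cn (Rng V p f) (f p) (g p)"
    using g(1)
  proof (induction rule: eqv_induct)
    case refl
    show ?case by (rule con_refl) (rule Rng_self)
  next
    case (step g h)
    then obtain r b where r: "adj (g r) b" "h = g(r := b)" unfolding step_def by blast
    show ?case
    proof (cases "r = p")
      case True
      have "h p \<in> Rng V p f" using RngI[OF eqv_step[OF step(1,2)]] .
      then show ?thesis using cn_step[OF step(3)] r True by simp
    qed (use r step(3) in simp)
  qed
  then show ?thesis using g(2) by simp
qed

text \<open>A longest path closes up, because the neighbours of its first vertex lie on it.\<close>
lemma two_regular_cyclic:
  assumes R: "finite R" "a \<in> R" "\<And>b. b \<in> R \<Longrightarrow> cn R a b"
    and two: "\<And>x. x \<in> R \<Longrightarrow> \<exists>b c. b \<noteq> c \<and> {v \<in> R. adj x v} = {b, c}"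
  shows "\<exists>w. 3 \<le> length w \<and> distinct w \<and> set w = R \<and>
    {(x, y). x \<in> R \<and> y \<in> R \<and> adj x y} = cyclic_succ w \<union> (cyclic_succ w)\<inverse>"
proof -
  define paths where "paths = (\<lambda>w. w \<noteq> [] \<and> distinct w \<and> successively adj w \<and> set w \<subseteq> R)"
  have "length w < Suc (card R)" if "paths w" for w
  proof -
    have "card (set w) \<le> card R" using that R(1) unfolding paths_def by (intro card_mono) auto
    then show ?thesis using that distinct_card[of w] unfolding paths_def by simp
  qed
  moreover have "paths [a]" unfolding paths_def using R(2) by simp
  ultimately obtain w where w: "paths w" "\<And>w'. paths w' \<Longrightarrow> length w' \<le> length w"
    using ex_has_greatest_nat[of paths "[a]" length "Suc (card R)"] by blast
  have W: "w \<noteq> []" "distinct w" "successively adj w" "set w \<subseteq> R" using w(1) unfolding paths_def by blast+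
  let ?n = "length w"
  have nb: "v1 = v2 \<or> v1 = v3 \<or> v2 = v3" if nv: "x \<in> R" "v1 \<in> R" "v2 \<in> R" "v3 \<in> R" "adj x v1" "adj x v2" "adj x v3" for x v1 v2 v3
  proof -
    obtain b c where bc: "{v \<in> R. adj x v} = {b, c}" using two[OF nv(1)] by blast
    have "v1 \<in> {b, c}" "v2 \<in> {b, c}" "v3 \<in> {b, c}" using nv unfolding bc[symmetric] by blast+
    then show ?thesis by blast
  qed
  have inR: "w ! i \<in> R" if "i < ?n" for i using that W(4) by auto
  have adjw: "adj (w ! i) (w ! Suc i)" if "Suc i < ?n" for i using successively_nth W(3) that by blast
  have hd0: "hd w = w ! 0" using W(1) by (simp add: hd_conv_nth)
  have hdR: "w ! 0 \<in> R" using inR W(1) by simp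
  have hd_nb: "v \<in> set w" if v: "v \<in> R" "adj (w ! 0) v" for v
  proof (rule ccontr)
    assume "v \<notin> set w"
    then have "paths (v # w)" unfolding paths_def
      using W v adj_sym[OF v(2)] hd0 by (cases w) auto
    then show False using w(2) by fastforce
  qed
  obtain b c where bc: "b \<noteq> c" "{v \<in> R. adj (w ! 0) v} = {b, c}" using two[OF hdR] by blast
  have "b \<in> {v \<in> R. adj (w ! 0) v}" "c \<in> {v \<in> R. adj (w ! 0) v}" unfolding bc(2) by blast+
  then have bcR: "b \<in> R" "adj (w ! 0) b" "c \<in> R" "adj (w ! 0) c" by blast+
  have "b \<in> set w" "c \<in> set w" using hd_nb bcR by blast+
  then obtain ib ic where i: "ib < ?n" "b = w ! ib" "ic < ?n" "c = w ! ic" by (auto simp: in_set_conv_nth)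
  have i0: "ib \<noteq> 0" "ic \<noteq> 0" "ib \<noteq> ic" using i bcR bc(1) adj_irrefl by metis+
  then have n3: "3 \<le> ?n" using i(1,3) by linarith
  obtain j where j: "1 < j" "j < ?n" "adj (w ! 0) (w ! j)"
  proof (cases "ib = 1")
    case True
    then show ?thesis using that[of ic] i i0 bcR by auto
  next
    case False
    then show ?thesis using that[of ib] i i0 bcR by auto
  qed
  \<comment> \<open>Otherwise \<open>w ! j\<close> would have three neighbours in \<open>R\<close>:
    \<open>w ! 0\<close> and its two neighbours on the path.\<close>
  have jn: "j = ?n - 1"
  proof (rule ccontr)
    assume "j \<noteq> ?n - 1"
    then have sj: "Suc j < ?n" using j by simp
    have 1: "adj (w ! j) (w ! (j - 1))" using adj_sym[OF adjw[of "j - 1"]] j by simp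
    have eq: "w ! 0 = w ! (j - 1) \<or> w ! 0 = w ! Suc j \<or> w ! (j - 1) = w ! Suc j"
      using nb[OF inR[OF j(2)] hdR inR inR adj_sym[OF j(3)] 1 adjw[OF sj]] sj by simp
    have l: "0 < ?n" "j - 1 < ?n" "Suc j < ?n" using sj j by auto
    show False using eq nth_eq_iff_index_eq[OF W(2) l(1,2)] nth_eq_iff_index_eq[OF W(2) l(1,3)]
      nth_eq_iff_index_eq[OF W(2) l(2,3)] j(1) by auto
  qed
  have cyc: "adj (w ! i) (w ! (Suc i mod ?n))" if "i < ?n" for i
  proof (cases "Suc i = ?n")
    case True
    then have "i = j" using jn by simp
    then show ?thesis using True adj_sym[OF j(3)] by simp
  next
    case False
    then show ?thesis using adjw that by simp
  qed
  have nbs: "(w ! i, v) \<in> cyclic_succ w \<or> (v, w ! i) \<in> cyclic_succ w" if i: "i < ?n" and v: "v \<in> R" "adj (w ! i) v" for i v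
  proof -
    define pr where "pr = (if i = 0 then ?n - 1 else i - 1)"
    have pr: "pr < ?n" "Suc pr mod ?n = i" using i n3 unfolding pr_def by (auto simp: mod_Suc)
    have nx: "Suc i mod ?n < ?n" by (rule mod_less_divisor) (use n3 in linarith)
    have "pr \<noteq> Suc i mod ?n" using i n3 unfolding pr_def by (auto simp: mod_Suc)
    then have ne: "w ! pr \<noteq> w ! (Suc i mod ?n)" using nth_eq_iff_index_eq[OF W(2) pr(1) nx] by blast
    have "adj (w ! i) (w ! pr)" using adj_sym[OF cyc[OF pr(1)]] pr(2) by simp
    then have "v = w ! pr \<or> v = w ! (Suc i mod ?n)"
      using nb[OF inR[OF i] v(1) inR[OF pr(1)] inR[OF nx] v(2) _ cyc[OF i]] ne by blast
    then show ?thesis unfolding cyclic_succ_def using i pr by auto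
  qed
  have succ_in: "x \<in> set w \<and> y \<in> set w \<and> adj x y" if xy: "(x, y) \<in> cyclic_succ w" for x y
  proof -
    obtain i where i: "i < ?n" "x = w ! i" "y = w ! (Suc i mod ?n)" using xy unfolding cyclic_succ_def by blast
    moreover have "Suc i mod ?n < ?n" by (rule mod_less_divisor) (use n3 in linarith)
    ultimately show ?thesis using cyc by auto
  qed
  have "set w = R"
  proof
    show "R \<subseteq> set w"
    proof
      fix x assume x: "x \<in> R"
      have c: "cn R (w ! 0) x" using con_trans[OF R(3)[OF x] con_sym[OF R(3)[OF hdR]]] .
      show "x \<in> set w"
      proof (rule con_closed[OF c])
        show "w ! 0 \<in> set w" using W(1) by simp
        fix b c assume "b \<in> set w" and bc: "adj b c" "c \<in> R"
        then obtain i where "i < ?n" "b = w ! i" by (auto simp: in_set_conv_nth)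
        then show "c \<in> set w" using nbs[of i c] succ_in bc by blast
      qed
    qed
  qed (rule W(4))
  moreover have "{(x, y). x \<in> R \<and> y \<in> R \<and> adj x y} = cyclic_succ w \<union> (cyclic_succ w)\<inverse>"
  proof (intro equalityI subsetI)
    fix e assume "e \<in> {(x, y). x \<in> R \<and> y \<in> R \<and> adj x y}"
    then obtain x y where e: "e = (x, y)" "x \<in> R" "y \<in> R" "adj x y" by blast
    then obtain i where "i < ?n" "x = w ! i" using \<open>set w = R\<close> by (auto simp: in_set_conv_nth)
    then show "e \<in> cyclic_succ w \<union> (cyclic_succ w)\<inverse>" using nbs[of i y] e by blast
  next
    fix e assume "e \<in> cyclic_succ w \<union> (cyclic_succ w)\<inverse>"
    then obtain x y where e: "e = (x, y)" "(x, y) \<in> cyclic_succ w \<or> (y, x) \<in> cyclic_succ w" by (cases e) auto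
    then have "x \<in> set w" "y \<in> set w" "adj x y" using succ_in[of x y] succ_in[of y x] adj_sym[of y x] by blast+
    then show "e \<in> {(x, y). x \<in> R \<and> y \<in> R \<and> adj x y}" using e(1) W(4) by blast
  qed
  ultimately show ?thesis using n3 W(2) by blast
qed

lemma con_list: "cn S a b \<Longrightarrow> \<exists>w. w \<noteq> [] \<and> successively adj w \<and> hd w = a \<and> last w = b"
proof (induction rule: con.induct)
  case (con_refl a)
  show ?case by (intro exI[of _ "[a]"]) simp
next
  case (con_step a b c)
  then obtain w where "w \<noteq> []" "successively adj w" "hd w = a" "last w = b" by blast
  then show ?case using con_step.hyps(2) by (intro exI[of _ "w @ [c]"]) (simp add: successively_append_iff)
qed

text \<open>The constant \<open>N\<close> is the least number of inner vertices over all reachable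
  configurations; it is positive because the pebbles never become adjacent.\<close>

lemma no_contact_two_neighbours:
  assumes "conn V" "cfg f" "p \<in> P" "q \<in> P" "p \<noteq> q" "1 \<le> card (V - f ` P)" and R: "Rng V p f = Rng V q f"
    and nc: "\<And>g. eqv V f g \<Longrightarrow> \<not> adj (g p) (g q)" and x: "x \<in> Rng V p f"
  shows "\<exists>b c. b \<noteq> c \<and> {v \<in> Rng V p f. adj x v} = {b, c}"
proof -
  define Q where "Q = (\<lambda>n. \<exists>g m. eqv V f g \<and> successively adj (g p # m @ [g q]) \<and> length m = n)"
  have V: "f p \<in> V" "f q \<in> V" and ne: "f p \<noteq> f q" using assms(2-5) unfolding cfg_def inj_on_def by blast+
  obtain w where w: "w \<noteq> []" "successively adj w" "hd w = f p" "last w = f q"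
    using con_list[of V "f p" "f q"] assms(1) V unfolding conn_def by blast
  have "w = f p # butlast (tl w) @ [f q]"
    using w ne by (metis append_butlast_last_id last.simps list.collapse)
  then have "successively adj (f p # butlast (tl w) @ [f q])" using w(2) by metis
  then have "Q (length (butlast (tl w)))" unfolding Q_def using eqv_refl[of V f] by blast
  then have L: "Q (LEAST n. Q n)" by (rule LeastI)
  define N where "N = (LEAST n. Q n)"
  obtain g m where gm: "eqv V f g" "successively adj (g p # m @ [g q])" "length m = N" using L unfolding Q_def N_def by blast
  have min: "N \<le> length m" if "eqv V f g" "successively adj (g p # m @ [g q])" for g m
    unfolding N_def by (rule Least_le) (use that Q_def in blast)
  have "N \<noteq> 0" using gm nc[OF gm(1)] by auto
  then have a: "apart f p q N" unfolding apart_def using assms(1-6) min by blast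
  have "closest f p q N g m" unfolding closest_def using gm by blast
  then show ?thesis using two_neighbours[OF a _ R x] by blast
qed

section \<open>The order of pebbles along a cycle\<close>

definition next_on where
  "next_on R f p q g \<longleftrightarrow> (\<exists>w. w \<noteq> [] \<and> distinct w \<and> successively adj w \<and> set w \<subseteq> R \<and> hd w = g p \<and> last w = g q \<and>
     (\<forall>r\<in>P - {p, q}. Rng V r f = R \<longrightarrow> g r \<notin> set w))"

lemma next_on_swap: "next_on R f p q g \<Longrightarrow> next_on R f q p g"
proof -
  assume "next_on R f p q g"
  then obtain w where w: "w \<noteq> []" "distinct w" "successively adj w" "set w \<subseteq> R" "hd w = g p" "last w = g q"
    "\<forall>r\<in>P - {p, q}. Rng V r f = R \<longrightarrow> g r \<notin> set w" unfolding next_on_def by blast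
  have "successively adj (rev w)" using w(3) succ_rev by blast
  then show ?thesis unfolding next_on_def using w
    by (intro exI[of _ "rev w"]) (auto simp: hd_rev last_rev insert_commute simp del: successively_rev)
qed

text \<open>If \<open>p\<close> moves onto the path, the part up to its new position is cut off;
  otherwise the new position is put in front.\<close>

lemma next_on_move:
  assumes n: "next_on R f p q g" and b: "adj (g p) b" "b \<notin> g ` P" "b \<in> R" and pq: "p \<noteq> q" "q \<in> P"
  shows "next_on R f p q (g(p := b))"
proof -
  obtain w where w: "w \<noteq> []" "distinct w" "successively adj w" "set w \<subseteq> R" "hd w = g p" "last w = g q"
    "\<And>r. r \<in> P - {p, q} \<Longrightarrow> Rng V r f = R \<Longrightarrow> g r \<notin> set w" using n unfolding next_on_def by blast
  have oth: "(g(p := b)) r = g r" "g r \<noteq> b" if "r \<in> P - {p, q}" for r using that b(2) by auto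
  show ?thesis
  proof (cases "b \<in> set w")
    case True
    then obtain as bs where ab: "w = as @ b # bs" by (meson split_list)
    have 1: "distinct (b # bs)" "successively adj (b # bs)" "set (b # bs) \<subseteq> R" "last (b # bs) = g q"
      using w ab by (auto simp: successively_append_iff)
    have "(g(p := b)) r \<notin> set (b # bs)" if "r \<in> P - {p, q}" "Rng V r f = R" for r
      using w(7)[OF that] ab oth[OF that(1)] by auto
    then show ?thesis unfolding next_on_def using 1 pq by (intro exI[of _ "b # bs"]) auto
  next
    case False
    have "successively adj (b # w)" using w(1,3,5) adj_sym[OF b(1)] by (cases w) auto
    moreover have "(g(p := b)) r \<notin> set (b # w)" if "r \<in> P - {p, q}" "Rng V r f = R" for r
      using w(7)[OF that] oth[OF that(1)] by auto
    ultimately show ?thesis unfolding next_on_def using w(1,2,4,6) False b(3) pq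
      by (intro exI[of _ "b # w"]) auto
  qed
qed

text \<open>A third pebble of the same range could enter the path only at an inner vertex. That
  vertex would have three neighbours in \<open>R\<close>: two on the path and the previous position
  of the pebble.\<close>

lemma next_on_step:
  assumes R: "Rng V p f = R" "Rng V q f = R" and pq: "p \<noteq> q" "p \<in> P" "q \<in> P"
    and deg: "\<And>b x y z. b \<in> R \<Longrightarrow> x \<in> R \<Longrightarrow> y \<in> R \<Longrightarrow> z \<in> R \<Longrightarrow> adj b x \<Longrightarrow> adj b y \<Longrightarrow> adj b z \<Longrightarrow>
      x = y \<or> x = z \<or> y = z"
    and g: "eqv V f g" "step V g h" and n: "next_on R f p q g"
  shows "next_on R f p q h"
proof -
  obtain r b where r: "r \<in> P" "adj (g r) b" "b \<notin> g ` P" "h = g(r := b)" using g(2) unfolding step_def by blast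
  have hR: "b \<in> Rng V r f" using RngI[OF eqv_step[OF g], of r] r(4) by simp
  consider "r = p" | "r = q" | "r \<noteq> p" "r \<noteq> q" by blast
  then show ?thesis
  proof cases
    case 1
    have "b \<in> R" using hR 1 R(1) by simp
    then have "next_on R f p q (g(p := b))" using next_on_move[OF n _ r(3) _ pq(1,3)] r(2) 1 by blast
    then show ?thesis using r(4) 1 by simp
  next
    case 2
    have "b \<in> R" using hR 2 R(2) by simp
    then have "next_on R f q p (g(q := b))" using next_on_move[OF next_on_swap[OF n] _ r(3) _ pq(1)[symmetric] pq(2)] r(2) 2 by blast
    then show ?thesis using r(4) 2 next_on_swap by simp
  next
    case 3
    obtain w where w: "w \<noteq> []" "distinct w" "successively adj w" "set w \<subseteq> R" "hd w = g p" "last w = g q"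
      "\<And>r. r \<in> P - {p, q} \<Longrightarrow> Rng V r f = R \<Longrightarrow> g r \<notin> set w" using n unfolding next_on_def by blast
    have "b \<notin> set w" if rR: "Rng V r f = R"
    proof
      assume bw: "b \<in> set w"
      then obtain as bs where ab: "w = as @ b # bs" by (meson split_list)
      have "b \<noteq> g p" "b \<noteq> g q" using r(3) pq(2,3) by blast+
      then have ne: "as \<noteq> []" "bs \<noteq> []" using w(5,6) ab by auto
      then have a: "adj (last as) b" "adj b (hd bs)" using w(3) ab by (cases bs; auto simp: successively_append_iff)+
      have "set as \<inter> set bs = {}" using w(2) ab by auto
      then have l: "last as \<in> set w" "hd bs \<in> set w" "last as \<noteq> hd bs"
        using ab last_in_set[OF ne(1)] hd_in_set[OF ne(2)] by auto
      have gr: "g r \<in> R" "g r \<notin> set w" using RngI[OF g(1), of r] rR w(7) r(1) 3 by auto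
      have "last as = hd bs \<or> last as = g r \<or> hd bs = g r"
        using deg[of b "last as" "hd bs" "g r"] bw l(1,2) w(4) gr(1) adj_sym[OF a(1)] a(2) adj_sym[OF r(2)] by blast
      then show False using l gr(2) by auto
    qed
    then have "h s \<notin> set w" if "s \<in> P - {p, q}" "Rng V s f = R" for s
      using w(7)[OF that] that r(4) by (cases "s = r") auto
    then show ?thesis unfolding next_on_def using w 3 r(4) by (intro exI[of _ w]) auto
  qed
qed

text \<open>At contact the edge itself is the required path; reversibility carries the property back
  to \<open>f\<close>.\<close>

lemma contact_next_on:
  assumes R: "Rng V p f = R" "Rng V q f = R" and pq: "p \<noteq> q" "p \<in> P" "q \<in> P" and f: "cfg f"
    and deg: "\<And>b x y z. b \<in> R \<Longrightarrow> x \<in> R \<Longrightarrow> y \<in> R \<Longrightarrow> z \<in> R \<Longrightarrow> adj b x \<Longrightarrow> adj b y \<Longrightarrow> adj b z \<Longrightarrow>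
      x = y \<or> x = z \<or> y = z"
    and g: "eqv V f g" "adj (g p) (g q)"
  shows "next_on R f p q f"
proof -
  have cg: "cfg g" using eqv_cfg[OF g(1) f] .
  have "g r \<noteq> g p \<and> g r \<noteq> g q" if "r \<in> P - {p, q}" for r
    using cg pq that unfolding cfg_def inj_on_def by blast
  moreover have "g p \<noteq> g q" using g(2) adj_irrefl by metis
  moreover have "g p \<in> R" "g q \<in> R" using RngI[OF g(1)] R by auto
  ultimately have n: "next_on R f p q g" unfolding next_on_def using g(2) by (intro exI[of _ "[g p, g q]"]) auto
  have "eqv V f h \<and> next_on R f p q h" if "eqv V g h" for h
    using that
  proof (induction rule: eqv_induct)
    case (step h h')
    then have "eqv V f h" "next_on R f p q h" by blast+
    moreover have "next_on R f p q h'" by (rule next_on_step[OF R pq deg calculation(1) step(2) calculation(2)])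
    ultimately show ?case using eqv_step[OF _ step(2)] by blast
  qed (use g n in blast)
  then show ?thesis using eqv_sym[OF g(1) f] by blast
qed

text \<open>A foreign pebble on \<open>R\<close> stands on an isthmus that separates it from \<open>p\<close>; the pebbles of its side retreat
into that side.\<close>
lemma foreigners_leave:
  assumes V: "conn V" and f: "cfg f" and k: "1 \<le> card (V - f ` P)" and p: "p \<in> P" "Rng V p f = R"
  shows "\<exists>g. eqv V f g \<and> (\<forall>r\<in>P. if Rng V r f = R then g r = f r else g r \<notin> R)"
proof -
  have "\<exists>g'. eqv V f g' \<and> (\<forall>r\<in>P. if Rng V r f = R then g' r = f r else g' r \<notin> R)"
    if "eqv V f g" "\<forall>r\<in>P. Rng V r f = R \<longrightarrow> g r = f r" for g
    using that
  proof (induction "card {r\<in>P. Rng V r f \<noteq> R \<and> g r \<in> R}" arbitrary: g rule: less_induct)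
    case less
    show ?case
    proof (cases "{r\<in>P. Rng V r f \<noteq> R \<and> g r \<in> R} = {}")
      case True
      have "if Rng V r f = R then g r = f r else g r \<notin> R" if "r \<in> P" for r
        using True less.prems(2) that by auto
      then show ?thesis using less.prems(1) by blast
    next
      case False
      then obtain t where t: "t \<in> P" "Rng V t f \<noteq> R" "g t \<in> R" by blast
      have cg: "cfg g" using eqv_cfg[OF less.prems(1) f] .
      have RR: "Rng V r g = Rng V r f" for r using Rng_eqv[OF f less.prems(1)] .
      have kg: "1 \<le> card (V - g ` P)" using eqv_card[OF less.prems(1) f finite_V] k by simp
      have "Rng V t g \<noteq> Rng V p g" using RR p(2) t(2) by simp
      then obtain X u Y PX PY where s: "sided X u Y PX PY g" "t \<in> PX" "p \<in> PY" "Rng V p g \<inter> Y \<noteq> {}"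
        using separated[OF V cg t(1) p(1) kg] by blast
      obtain g' where g': "eqv V g g'" "\<And>r. r \<in> PX \<Longrightarrow> g' r \<in> X" "\<And>r. r \<in> PY \<Longrightarrow> g' r = g r"
        using retreat[OF V s(1)] by blast
      note I = bare_isthmusD[OF sidedD(1)[OF s(1)]]
      have RY: "R \<subseteq> Y \<union> set u" "R \<inter> Y \<noteq> {}" using sided_Rng(2)[OF s(1,3)] s(4) RR p(2) by auto
      have XR: "v \<notin> R" if "v \<in> X" for v using RY(1) that I(5,7) by blast
      have sameY: "r \<in> PY" if "r \<in> P" "Rng V r f = R" for r
      proof (rule ccontr)
        assume "r \<notin> PY"
        then have "r \<in> PX" using that(1) sidedD(4)[OF s(1)] by blast
        then have "R \<subseteq> X \<union> set u" using sided_Rng(1)[OF s(1)] RR that(2) by metis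
        then show False using RY(2) I(6,7) by blast
      qed
      have e: "eqv V f g'" using eqv_trans[OF less.prems(1) g'(1)] .
      have "{r\<in>P. Rng V r f \<noteq> R \<and> g' r \<in> R} \<subseteq> {r\<in>P. Rng V r f \<noteq> R \<and> g r \<in> R} - {t}"
      proof
        fix r assume r: "r \<in> {r\<in>P. Rng V r f \<noteq> R \<and> g' r \<in> R}"
        then have "r \<notin> PX" using g'(2) XR by blast
        then have "r \<in> PY" "r \<noteq> t" using r sidedD(4)[OF s(1)] s(2) by blast+
        then show "r \<in> {r\<in>P. Rng V r f \<noteq> R \<and> g r \<in> R} - {t}" using r g'(3) by auto
      qed
      then have "{r\<in>P. Rng V r f \<noteq> R \<and> g' r \<in> R} \<subset> {r\<in>P. Rng V r f \<noteq> R \<and> g r \<in> R}" using t by blast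
      then have "card {r\<in>P. Rng V r f \<noteq> R \<and> g' r \<in> R} < card {r\<in>P. Rng V r f \<noteq> R \<and> g r \<in> R}"
        using finite_P by (intro psubset_card_mono) auto
      moreover have "\<forall>r\<in>P. Rng V r f = R \<longrightarrow> g' r = f r" using g'(3) sameY less.prems(2) by simp
      ultimately show ?thesis using less.hyps e by blast
    qed
  qed
  then show ?thesis using eqv_refl[of V f] by blast
qed

text \<open>Once the foreign pebbles have left \<open>R\<close>, the inner vertices of the path are
  empty and \<open>p\<close> walks up to \<open>q\<close>.\<close>

lemma next_on_contact:
  assumes V: "conn V" and f: "cfg f" and k: "1 \<le> card (V - f ` P)" and pq: "p \<in> P" "q \<in> P" "p \<noteq> q"
    and R: "Rng V p f = R" "Rng V q f = R" and n: "next_on R f p q f"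
  shows "\<exists>g. eqv V f g \<and> adj (g p) (g q)"
proof -
  obtain g where g: "eqv V f g" "\<And>r. r \<in> P \<Longrightarrow> if Rng V r f = R then g r = f r else g r \<notin> R"
    using foreigners_leave[OF V f k pq(1) R(1)] by blast
  have gpq: "g p = f p" "g q = f q" using g(2)[OF pq(1)] g(2)[OF pq(2)] R by simp_all
  have cg: "cfg g" using eqv_cfg[OF g(1) f] .
  have gV: "g p \<in> V" using cg pq(1) unfolding cfg_def by blast
  obtain w where w: "w \<noteq> []" "distinct w" "successively adj w" "set w \<subseteq> R" "hd w = f p" "last w = f q"
    "\<And>r. r \<in> P - {p, q} \<Longrightarrow> Rng V r f = R \<Longrightarrow> f r \<notin> set w" using n unfolding next_on_def by blast
  have ne: "f p \<noteq> f q" using f pq unfolding cfg_def inj_on_def by blast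
  define m where "m = butlast (tl w)"
  have wm: "w = g p # m @ [g q]"
    unfolding m_def gpq using w(1,5,6) ne by (metis append_butlast_last_id last.simps list.collapse)
  have free: "v \<notin> g ` P" if v: "v \<in> set m" for v
  proof
    assume "v \<in> g ` P"
    then obtain r where r: "r \<in> P" "v = g r" by blast
    have "r \<noteq> p" "r \<noteq> q" using w(2) v r(2) unfolding wm by auto
    moreover have vw: "v \<in> set w" using v unfolding wm by simp
    then have "g r \<in> R" using w(4) r(2) by blast
    then have "Rng V r f = R" "g r = f r" using g(2)[OF r(1)] by (auto split: if_splits)
    ultimately show False using w(7)[of r] r vw by auto
  qed
  have s: "successively adj (g p # m)" using w(3) unfolding wm by (metis append_Cons successively_append_iff)
  have d: "distinct m" using w(2) unfolding wm by simp
  have mV: "set m \<subseteq> V" using w(4) Rng_sub[of f p V] gV gpq R(1) unfolding wm by auto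
  have fr: "set m \<inter> g ` P = {}" using free by blast
  define l where "l = last (g p # m)"
  have e: "eqv V g (g(p := l))" unfolding l_def by (rule walk[OF cg pq(1) s d fr mV gV])
  have "adj l (g q)"
    using w(3) unfolding wm l_def by (metis append_Cons last_ConsL list.discI list.sel(1) successively_append_iff)
  then have "adj ((g(p := l)) p) ((g(p := l)) q)" using pq(3) by simp
  then show ?thesis using eqv_trans[OF g(1) e] by blast
qed

end

section \<open>Walks and cycles of the graph\<close>

lemma vwalk_successively:
  "vwalk w G \<longleftrightarrow> w \<noteq> [] \<and> set w \<subseteq> verts G \<and> successively (dominates G) w"
proof -
  have "set (vwalk_arcs w) \<subseteq> arcs_ends G \<longleftrightarrow> successively (dominates G) w"
    by (induction w rule: vwalk_arcs.induct) auto
  then show ?thesis unfolding vwalk_def by blast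
qed

lemma set_vwalk_arcs: "set (vwalk_arcs w) = {(w ! i, w ! Suc i) | i. Suc i < length w}"
proof (induction w rule: vwalk_arcs.induct)
  case (3 x y w)
  have "{((x # y # w) ! i, (x # y # w) ! Suc i) | i. Suc i < length (x # y # w)} =
    insert (x, y) {((y # w) ! i, (y # w) ! Suc i) | i. Suc i < length (y # w)}" (is "?A = ?B")
  proof
    show "?A \<subseteq> ?B"
    proof
      fix e assume "e \<in> ?A"
      then obtain i where "e = ((x # y # w) ! i, (x # y # w) ! Suc i)" "Suc i < length (x # y # w)" by blast
      then show "e \<in> ?B" by (cases i) auto
    qed
    show "?B \<subseteq> ?A"
    proof
      fix e assume "e \<in> ?B"
      then consider "e = (x, y)" | i where "e = ((y # w) ! i, (y # w) ! Suc i)" "Suc i < length (y # w)" by blast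
      then show "e \<in> ?A"
      proof cases
        case 1
        then show ?thesis by (intro CollectI exI[of _ 0]) simp
      next
        case 2
        then show ?thesis by (intro CollectI exI[of _ "Suc i"]) simp
      qed
    qed
  qed
  then show ?case using 3 by simp
qed auto

lemma vwalk_arcs_cyclic_succ:
  assumes "w \<noteq> []"
  shows "set (vwalk_arcs (w @ [hd w])) = cyclic_succ w"
proof -
  have eq: "(w @ [hd w]) ! i = w ! i \<and> (w @ [hd w]) ! Suc i = w ! (Suc i mod length w)" if "i < length w" for i
    using that assms by (cases "Suc i = length w") (auto simp: nth_append hd_conv_nth)
  show ?thesis unfolding set_vwalk_arcs cyclic_succ_def
  proof (intro Collect_cong ex_cong1)
    fix e i
    show "(e = ((w @ [hd w]) ! i, (w @ [hd w]) ! Suc i) \<and> Suc i < length (w @ [hd w])) =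
      (e = (w ! i, w ! (Suc i mod length w)) \<and> i < length w)"
      using eq[of i] by auto
  qed
qed

lemma arcs_ends_induce: "arcs_ends (G \<restriction> R) = {(u, v). u \<in> R \<and> v \<in> R \<and> u \<rightarrow>\<^bsub>G\<^esub> v}"
  unfolding arcs_ends_conv by auto

lemma is_cycle_induce:
  "is_cycle (G \<restriction> R) \<longleftrightarrow> (\<exists>w. 3 \<le> length w \<and> distinct w \<and> set w = R \<and>
     {(u, v). u \<in> R \<and> v \<in> R \<and> u \<rightarrow>\<^bsub>G\<^esub> v} = cyclic_succ w \<union> (cyclic_succ w)\<inverse>)"
proof -
  have eq: "set (vwalk_arcs (w @ [hd w])) = cyclic_succ w" if "3 \<le> length w" for w :: "'a list"
    by (rule vwalk_arcs_cyclic_succ) (use that in auto)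
  show ?thesis unfolding is_cycle_def arcs_ends_induce induce_subgraph_verts
    by (rule ex_cong1, rule conj_cong[OF refl]) (simp only: eq)
qed

theorem theorem6:
  fixes G :: "('a, 'b) pre_digraph" and P :: "'p set" and f :: "'p \<Rightarrow> 'a"
    and p q :: 'p and n m k :: nat
  assumes "graph G" and "connected G" and "card (verts G) = n"
    and "finite P" and "card P = m"
    and "k = n - m" and "k \<ge> 1"
    and "configuration G P f"
    and "p \<in> P" and "q \<in> P" and "p \<noteq> q"
  shows "contacts G P f p q \<longleftrightarrow>
      (reachable_range G P p f = reachable_range G P q f \<and>
         \<not> is_cycle (G \<restriction> reachable_range G P p f))
    \<or> (reachable_range G P p f = reachable_range G P q f \<and>
         is_cycle (G \<restriction> reachable_range G P p f) \<and> next_along_cycle G P f p q)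
    \<or> (reachable_range G P p f \<noteq> reachable_range G P q f \<and>
         (\<exists>vs. isthmus G k vs \<and> reachable_range G P p f \<inter> reachable_range G P q f = set vs))"
proof -
  interpret G: graph G by fact
  interpret pebbling "verts G" "dominates G" P
  proof
    show "b \<in> verts G" if "a \<rightarrow>\<^bsub>G\<^esub> b" for a b using G.adj_in_verts(2)[OF that] .
    show "b \<rightarrow>\<^bsub>G\<^esub> a" if "a \<rightarrow>\<^bsub>G\<^esub> b" for a b using G.graph_symmetric that .
    show "\<not> a \<rightarrow>\<^bsub>G\<^esub> a" for a using G.adj_not_same by blast
  qed (use assms in auto)
  let ?V = "verts G"
  have conn: "conn ?V"
    unfolding conn_def
  proof (intro ballI)
    fix u v assume uv: "u \<in> ?V" "v \<in> ?V"
    then have "u \<rightarrow>\<^sup>*\<^bsub>G\<^esub> v"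
      using G.symmetric_connected_imp_strongly_connected[OF G.sym_arcs assms(2)] by blast
    then show "cn ?V u v"
    proof (induction rule: G.reachable_induct)
      case base
      show ?case by (rule con_refl) (rule base)
    next
      case (step x y)
      show ?case by (rule cn_step[OF step(3,2)]) (rule G.adj_in_verts(2)[OF step(2)])
    qed
  qed
  have f: "cfg f" using assms(8) unfolding configuration_def cfg_def .
  have move: "pebble_move G P g h \<longleftrightarrow> cfg g \<and> step ?V g h" for g h
    unfolding pebble_move_def step_def configuration_def cfg_def using G.adj_in_verts by blast
  have equiv: "pebble_equiv G P f g \<longleftrightarrow> eqv ?V f g" if "cfg f" for f g
  proof
    assume "pebble_equiv G P f g"
    then show "eqv ?V f g" unfolding pebble_equiv_def eqv_def
      by (rule rtranclp_mono[THEN predicate2D, rotated]) (use move in blast)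
  next
    assume "eqv ?V f g"
    then have "pebble_equiv G P f g \<and> cfg g"
    proof (induction rule: eqv_induct)
      case refl
      then show ?case unfolding pebble_equiv_def using that by simp
    next
      case (step g h)
      then have "pebble_move G P g h" "cfg h" using move step_cfg by blast+
      then show ?case using step(3) unfolding pebble_equiv_def by (metis rtranclp.rtrancl_into_rtrancl)
    qed
    then show "pebble_equiv G P f g" ..
  qed
  \<comment> \<open>A chain of moves ending in \<open>f\<close> is empty or begins with a move,
    which presupposes a configuration. So equivalence, stated as motion towards \<open>f\<close>,
    can be reversed.\<close>
  have cfg_back: "cfg g" if "pebble_equiv G P g f" for g
    using that unfolding pebble_equiv_def
    by (cases rule: converse_rtranclpE) (use f move in auto)
  have equiv': "pebble_equiv G P g f \<longleftrightarrow> eqv ?V f g" for g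
    using equiv[of g f] cfg_back eqv_sym eqv_cfg f by blast
  have Rg: "reachable_range G P r f = Rng ?V r f" for r
    unfolding reachable_range_def Rng_def equiv' by blast
  have ct: "contacts G P f p q \<longleftrightarrow> (\<exists>g. eqv ?V f g \<and> g p \<rightarrow>\<^bsub>G\<^esub> g q)"
    unfolding contacts_def equiv' ..
  have holes: "card (?V - f ` P) = k"
  proof -
    have "card (?V - f ` P) = card ?V - card (f ` P)"
      using f assms(4) unfolding cfg_def by (intro card_Diff_subset) auto
    moreover have "card (f ` P) = card P" using f unfolding cfg_def by (intro card_image) blast
    ultimately show ?thesis using assms by simp
  qed
  have k1: "1 \<le> card (?V - f ` P)" using holes assms(7) by simp
  note pq = assms(9-11)
  have fV: "f p \<in> ?V" using f pq unfolding cfg_def by blast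
  define R where "R = Rng ?V p f"
  have RV: "R \<subseteq> ?V" unfolding R_def by (rule Rng_sub) (rule fV)
  show ?thesis
  proof (cases "Rng ?V p f = Rng ?V q f")
    case True
    have Rp: "Rng ?V p f = R" and Rq: "Rng ?V q f = R" using True unfolding R_def by simp_all
    have nx: "next_along_cycle G P f p q \<longleftrightarrow> next_on R f p q f"
    proof -
      have "vpath w (G \<restriction> R) \<longleftrightarrow> w \<noteq> [] \<and> distinct w \<and> successively (dominates G) w \<and> set w \<subseteq> R" for w
      proof -
        have "successively (dominates (G \<restriction> R)) w = successively (dominates G) w" if "set w \<subseteq> R"
          using that by (intro successively_cong) (auto simp: arcs_ends_induce)
        then show ?thesis unfolding vpath_def vwalk_successively induce_subgraph_verts by blast
      qed
      then show ?thesis unfolding next_along_cycle_def next_on_def Rg R_def[symmetric] by (simp add: conj_assoc) 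
    qed
    have cyc: ?thesis if c: "is_cycle (G \<restriction> R)"
    proof -
      obtain w where w: "distinct w"
        "{(u, v). u \<in> R \<and> v \<in> R \<and> u \<rightarrow>\<^bsub>G\<^esub> v} = cyclic_succ w \<union> (cyclic_succ w)\<inverse>"
        using c unfolding is_cycle_induce by blast
      \<comment> \<open>On a cycle every neighbour is the successor or the predecessor, and both are
        unique.\<close>
      have deg: "x = y \<or> x = z \<or> y = z"
        if "b \<in> R" "x \<in> R" "y \<in> R" "z \<in> R" "b \<rightarrow>\<^bsub>G\<^esub> x" "b \<rightarrow>\<^bsub>G\<^esub> y" "b \<rightarrow>\<^bsub>G\<^esub> z" for b x y z
      proof -
        have "(b, v) \<in> cyclic_succ w \<or> (v, b) \<in> cyclic_succ w" if "v \<in> R" "b \<rightarrow>\<^bsub>G\<^esub> v" for v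
          using \<open>b \<in> R\<close> that w(2) by blast
        then show ?thesis using that cyclic_succ_unique[OF w(1)] by metis
      qed
      have "contacts G P f p q \<longleftrightarrow> next_on R f p q f"
      proof
        assume "contacts G P f p q"
        then obtain g where g: "eqv ?V f g" "g p \<rightarrow>\<^bsub>G\<^esub> g q" unfolding ct by blast
        show "next_on R f p q f" by (rule contact_next_on[OF Rp Rq pq(3,1,2) f deg g])
      next
        assume "next_on R f p q f"
        then show "contacts G P f p q" unfolding ct by (rule next_on_contact[OF conn f k1 pq Rp Rq])
      qed
      then show ?thesis using True c unfolding Rg nx R_def by blast
    qed
    have "contacts G P f p q" if c: "\<not> is_cycle (G \<restriction> R)"
    proof (rule ccontr)
      assume nc: "\<not> contacts G P f p q"
      then have nc': "\<not> g p \<rightarrow>\<^bsub>G\<^esub> g q" if "eqv ?V f g" for g using that unfolding ct by blast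
      have "\<exists>b c. b \<noteq> c \<and> {v \<in> R. x \<rightarrow>\<^bsub>G\<^esub> v} = {b, c}" if "x \<in> R" for x
        using no_contact_two_neighbours[OF conn f pq k1 True nc'] that unfolding R_def by simp
      moreover have "finite R" using RV finite_V finite_subset by blast
      moreover have "f p \<in> R" "\<And>b. b \<in> R \<Longrightarrow> cn R (f p) b" unfolding R_def using Rng_self Rng_conn by blast+
      ultimately have "is_cycle (G \<restriction> R)" unfolding is_cycle_induce by (intro two_regular_cyclic)
      then show False using c by blast
    qed
    then show ?thesis using cyc True unfolding Rg R_def by blast
  next
    case False
    obtain X u Y PX PY where s: "sided X u Y PX PY f" "p \<in> PX" "q \<in> PY"
      using separated[OF conn f pq(1,2) k1 False] by blast
    note I = bare_isthmusD[OF sidedD(1)[OF s(1)]]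
    have uk: "length u = k" using sidedD(3)[OF s(1)] holes by simp
    have cu: "card (set u) = k" using distinct_card[OF I(2)] uk by simp
    have sub: "Rng ?V p f \<inter> Rng ?V q f \<subseteq> set u"
      using sided_Rng(1)[OF s(1,2)] sided_Rng(2)[OF s(1,3)] I(5-7) by blast
    have "contacts G P f p q \<longleftrightarrow> (\<exists>vs. isthmus G k vs \<and> Rng ?V p f \<inter> Rng ?V q f = set vs)"
    proof
      assume "contacts G P f p q"
      then obtain g where g: "eqv ?V f g" "g p \<rightarrow>\<^bsub>G\<^esub> g q" unfolding ct by blast
      have "set u \<subseteq> Rng ?V q f" by (rule contact_covers[OF conn s g])
      moreover have "set (rev u) \<subseteq> Rng ?V p f"
        by (rule contact_covers[OF conn sided_rev[OF s(1)] s(3,2) g(1) adj_sym[OF g(2)]])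
      ultimately have "Rng ?V p f \<inter> Rng ?V q f = set u" using sub by auto
      moreover have "isthmus G k u"
      proof -
        have uV: "set u \<subseteq> ?V" using I(4) by blast
        have "vpath u G" unfolding vpath_def vwalk_successively using I(1-3) uV by blast
        moreover have "set w \<inter> set u \<noteq> {}" if w: "vpath w G" "hd w \<in> X" "last w \<in> Y" for w
        proof
          assume e: "set w \<inter> set u = {}"
          have w': "w \<noteq> []" "set w \<subseteq> ?V" "successively (dominates G) w"
            using w(1) unfolding vpath_def vwalk_successively by blast+
          have "set w \<subseteq> ?V - set u" using w'(2) e by blast
          then have c: "cn (?V - set u) (hd w) (last w)" using con_path2[OF w'(3)] w'(1) by simp
          have "last w \<in> X"
          proof (rule con_closed[OF c w(2)])
            fix b c assume "b \<in> X" "b \<rightarrow>\<^bsub>G\<^esub> c" "c \<in> ?V - set u"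
            then show "c \<in> X" using I(4) bare_isthmus_edges(1)[OF sidedD(1)[OF s(1)]] by blast
          qed
          then show False using w(3) I(7) by blast
        qed
        moreover have "X \<union> Y = ?V - set u" using I(4-6) by blast
        ultimately show ?thesis unfolding isthmus_def using uk I(7-9) by blast
      qed
      ultimately show "\<exists>vs. isthmus G k vs \<and> Rng ?V p f \<inter> Rng ?V q f = set vs" by blast
    next
      assume "\<exists>vs. isthmus G k vs \<and> Rng ?V p f \<inter> Rng ?V q f = set vs"
      then obtain vs where vs: "vpath vs G" "length vs = k" "Rng ?V p f \<inter> Rng ?V q f = set vs"
        unfolding isthmus_def by blast
      \<comment> \<open>The intersection of the ranges lies in \<open>set u\<close>, which also has
        \<open>k\<close> elements; hence \<open>vs\<close> occupies exactly the bare isthmus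
        \<open>u\<close>.\<close>
      have "card (set vs) = k" using vs(1,2) distinct_card unfolding vpath_def by blast
      then have "set vs = set u" using sub vs(3) cu by (intro card_subset_eq) auto
      then have "set u \<subseteq> Rng ?V p f" "set u \<subseteq> Rng ?V q f" using vs(3) by blast+
      then show "contacts G P f p q" unfolding ct by (rule covers_contact[OF conn s])
    qed
    then show ?thesis using False unfolding Rg by blast
  qed
qed

end
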